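(* Suppose $\beta+\gamma>2$. Then $\rho^\star<\infty$. If moreover $m=m_n$ is a sequence of positive integers with $m/n\to\rho$, where $\rho>\rho^\star$, then with high $P_{m,n}$-probability $$Q_n^{(1)}=(\rho-\rho^\star)n+o(n)\quad\text{and}\quad Q_n^{(2)}=o(n),$$ that is, for every $\eta>0$, as $n\to\infty$, $$P_{m,n}\big(|Q_n^{(1)}-(\rho-\rho^\star)n|>\eta n\big)\to0\quad\text{and}\quad P_{m,n}\big(Q_n^{(2)}>\eta n\big)\to 0.$$
   Context: Let $\mu$ be a probability distribution on $[0,1]$ such that for some $\gamma>0$, $\alpha_1>0$, $\mu([1-x,1])\sim\alpha_1x^\gamma$ as $x\downarrow0$. Let $(p_k)_{k\ge0}$ be a probability distribution on $\mathbb N_0=\{0,1,2,\dots\}$ with $p_0>0$ such that for some $\beta>1$, $\alpha_2>0$, $p_k\sim\alpha_2k^{-\beta}$ as $k\to\infty$. Put $\Phi(z)=\sum_{k\ge0}p_kz^k$ for $z\in[0,1]$ and define the critical density $\rho^\star=\int\frac{x\Phi'(x)}{\Phi(x)}\,\mu(dx)$. Let $\mathbf X=(X_i)_{i\ge1}$ be i.i.d. with law $\mu$ (law denoted $\mathtt P$, expectation $\mathtt E$). Given $\mathbf X$ and integers $m,n$, the quenched law $P_{\mathbf X}$ of $(Q_1,\dots,Q_n)$ is $$P_{\mathbf X}(Q_1=q_1,\dots,Q_n=q_n)=\frac1{Z_{m,n}}\prod_{i=1}^nX_i^{q_i}p_{q_i},\qquad q_i\in\mathbb N_0,\ q_1+\dots+q_n=m,$$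 where $Z_{m,n}$ is the normalisation constant (convention $0^0=1$; $Z_{m,n}>0$ with $\mathtt P$-probability tending to $1$). $P_{m,n}=\mathtt E P_{\mathbf X}$ denotes the annealed law, the joint law of $(X_1,\dots,X_n)$ and $(Q_1,\dots,Q_n)$. $Q_n^{(1)}\ge Q_n^{(2)}\ge\dots\ge Q_n^{(n)}$ is the decreasing order statistics of $(Q_1,\dots,Q_n)$. *)

theory Defs
  imports "HOL-Probability.Probability" "HOL-Library.Landau_Symbols"
begin

definition genfun :: "nat pmf \<Rightarrow> real \<Rightarrow> real" where
  "genfun p z = (\<Sum>k. pmf p k * z ^ k)"

text \<open>
  The critical density, a priori possibly infinite. The generating function is a power series
  with radius of convergence at least 1, so \<open>deriv\<close> is its genuine derivative on \<open>[0,1)\<close>. The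
  value of \<open>deriv\<close> at the endpoint 1 is irrelevant: the assumption on the tail of
  \<open>\<mu>\<close> near 1 excludes an atom there.
\<close>
definition critical_density :: "real measure \<Rightarrow> nat pmf \<Rightarrow> ennreal" where
  "critical_density \<mu> p =
     (\<integral>\<^sup>+x\<in>{0..1}. ennreal (x * deriv (genfun p) x / genfun p x) \<partial>\<mu>)"

text \<open>
  Vectors indexed by \<open>{1..n}\<close> are extensional functions on \<open>{1..n}\<close>.
\<close>
definition configs :: "nat \<Rightarrow> nat \<Rightarrow> (nat \<Rightarrow> nat) set" where
  "configs m n = {q \<in> {1..n} \<rightarrow>\<^sub>E UNIV. (\<Sum>i=1..n. q i) = m}"

definition weight :: "nat pmf \<Rightarrow> nat \<Rightarrow> (nat \<Rightarrow> real) \<Rightarrow> (nat \<Rightarrow> nat) \<Rightarrow> real" where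
  "weight p n x q = (\<Prod>i=1..n. x i ^ q i * pmf p (q i))"

definition partition_fun :: "nat pmf \<Rightarrow> nat \<Rightarrow> nat \<Rightarrow> (nat \<Rightarrow> real) \<Rightarrow> real" where
  "partition_fun p m n x = (\<Sum>q\<in>configs m n. weight p n x q)"

text \<open>
  Mass function of the quenched law. If the normalisation constant vanishes, the law is by
  convention the point mass at the zero vector, so that it is a probability distribution for
  every \<open>x\<close> with nonnegative entries.
\<close>
definition quenched_prob ::
    "nat pmf \<Rightarrow> nat \<Rightarrow> nat \<Rightarrow> (nat \<Rightarrow> real) \<Rightarrow> (nat \<Rightarrow> nat) \<Rightarrow> real" where
  "quenched_prob p m n x q =
     (if partition_fun p m n x = 0 then (if q = (\<lambda>i\<in>{1..n}. 0) then 1 else 0)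
      else if q \<in> configs m n then weight p n x q / partition_fun p m n x
      else 0)"

text \<open>
  The annealed law, as the joint law of \<open>(X\<^sub>1, \<dots>, X\<^sub>n)\<close> and \<open>(Q\<^sub>1, \<dots>, Q\<^sub>n)\<close>: the first
  component is i.i.d. with law \<open>\<mu>\<close>, and \<open>quenched_prob\<close> is the conditional mass function of
  the second component given the first.
\<close>
definition annealed_law ::
    "real measure \<Rightarrow> nat pmf \<Rightarrow> nat \<Rightarrow> nat \<Rightarrow> ((nat \<Rightarrow> real) \<times> (nat \<Rightarrow> nat)) measure" where
  "annealed_law \<mu> p m n =
     density ((\<Pi>\<^sub>M i\<in>{1..n}. \<mu>) \<Otimes>\<^sub>M count_space ({1..n} \<rightarrow>\<^sub>E UNIV))
       (\<lambda>(x, q). ennreal (quenched_prob p m n x q))"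

text \<open>
  The \<open>j\<close>-th largest of \<open>q 1, \<dots>, q n\<close>, counted with multiplicity; meaningful for
  \<open>1 \<le> j \<le> n\<close>.
\<close>
definition order_stat :: "nat \<Rightarrow> nat \<Rightarrow> (nat \<Rightarrow> nat) \<Rightarrow> nat" where
  "order_stat n j q = rev (sort (map q [1..<Suc n])) ! (j - 1)"

end

theory Submission imports Defs "HOL-Real_Asymp.Real_Asymp" begin

text \<open>
  Let \<open>X*\<close> be the largest of the fitnesses \<open>X i\<close>. The quenched law does not change when the fitnesses are
  rescaled to \<open>r i = X i / X*\<close>. Under the product weights given by \<open>r\<close>, the contents that do not
  exceed a level \<open>l = \<epsilon> n\<close> have total mass \<open>\<rho>\<^sup>* n + o(n)\<close>: by a Chernoff bound with tilt of
  order \<open>ln n / n\<close> an excess has probability at most \<open>n\<close> to the power \<open>- \<beta> - 1\<close>, and a deficit is exponentially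
  unlikely. Conditioning on the total \<open>m\<close> costs only a factor of order \<open>n\<close> to the power \<open>\<beta>\<close>, because the site of
  fitness \<open>X*\<close> can absorb the excess. On the other hand, two contents larger than \<open>l\<close> can be
  merged in the fitter of the two sites. Far from \<open>X*\<close> this gains an exponential factor; near \<open>X*\<close>
  there are few sites, and \<open>\<beta> > 1\<close>, \<open>\<beta> + \<gamma> > 2\<close> make their number times \<open>n\<close> to the power \<open>1 - \<beta>\<close> tend to 0. Hence exactly
  one content exceeds \<open>l\<close>, and it equals \<open>m - \<rho>\<^sup>* n + o(n)\<close>.
\<close>

section \<open>Configurations and weights\<close>

text \<open>The obstacle: near fitness 1 the mean content can be infinite, since \<beta> may be at
  most 2, so no single moment controls all sites. Choose u with max 0 (2 - \<beta>) < u < min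
  \<gamma> 1, which is possible because \<beta> > 1 and \<beta> + \<gamma> > 2. About n to the power
  1 - u fitnesses lie within n to the power - u / \<gamma> of 1. For these few sites only a moment
  of order s is used, with 1 - u < s < \<beta> - 1 and s < 1; the remaining sites have, on average,
  a bounded moment of order 1 + c for some small c > 0. The tilt t = A ln n / n is a compromise: exp
  (- t n \<eta>) must beat the polynomial cost of conditioning, while exp (t \<epsilon> n) has to
  stay a power of n so small that the gain from those moments absorbs it. This forces \<epsilon> to
  be small compared with c and \<eta>. Dividing by the maximum moves the other fitnesses towards 1.
  Requiring the maximum to be twice as close to 1 as the boundary of the near zone keeps the far
  sites under control. All randomness of the fitnesses is confined to one typical event; given it,
  the estimates are deterministic and uniform in the environment.\<close>

lemma configs_le: "q \<in> configs m n \<Longrightarrow> i \<in> {1..n} \<Longrightarrow> q i \<le> m"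
  using member_le_sum[of i "{1..n}" q] by (auto simp: configs_def)

lemma configs_subset_PiE: "configs m n \<subseteq> {1..n} \<rightarrow>\<^sub>E {..m}"
proof
  fix q assume q: "q \<in> configs m n"
  with configs_le[OF q] show "q \<in> {1..n} \<rightarrow>\<^sub>E {..m}"
    by (auto simp: configs_def PiE_iff)
qed

lemma finite_configs: "finite (configs m n)"
  by (rule finite_subset[OF configs_subset_PiE]) (auto intro: finite_PiE)

lemma configs_sum: "q \<in> configs m n \<Longrightarrow> (\<Sum>i=1..n. q i) = m"
  by (simp add: configs_def)

lemma weight_nonneg: "(\<And>i. i \<in> {1..n} \<Longrightarrow> 0 \<le> x i) \<Longrightarrow> 0 \<le> weight p n x q"
  by (auto simp: weight_def intro!: prod_nonneg)

lemma weight_scale: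
  assumes "q \<in> configs m n"
  shows "weight p n (\<lambda>i. c * x i) q = c ^ m * weight p n x q"
proof -
  have "weight p n (\<lambda>i. c * x i) q = (\<Prod>i=1..n. c ^ q i) * weight p n x q"
    by (simp add: weight_def power_mult_distrib mult.assoc flip: prod.distrib)
  also have "(\<Prod>i=1..n. c ^ q i) = c ^ m"
    using configs_sum[OF assms] by (simp flip: power_sum)
  finally show ?thesis .
qed

text \<open>Moving the whole content of site \<open>j\<close> to a site \<open>i\<close> of larger fitness.\<close>

lemma transfer_bound:
  assumes ij: "i \<in> {1..n}" "j \<in> {1..n}" "i \<noteq> j"
    and x: "\<And>l. l \<in> {1..n} \<Longrightarrow> 0 \<le> x l" and xj: "x j \<le> \<theta> * x i"
    and \<theta>: "0 \<le> \<theta>" "\<theta> \<le> 1" and \<kappa>: "0 \<le> \<kappa>"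
    and p: "\<And>a b. A \<le> a \<Longrightarrow> L \<le> b \<Longrightarrow> a + b \<le> m \<Longrightarrow>
              pmf p a * pmf p b \<le> \<kappa> * (pmf p 0 * pmf p (a + b))"
  shows "(\<Sum>q | q \<in> configs m n \<and> A \<le> q i \<and> L \<le> q j. weight p n x q) \<le>
           real (m + 1) * \<kappa> * \<theta> ^ L * (\<Sum>q | q \<in> configs m n \<and> A \<le> q i. weight p n x q)"
proof -
  define S where "S = {q. q \<in> configs m n \<and> A \<le> q i \<and> L \<le> q j}"
  define R where "R = {q. q \<in> configs m n \<and> A \<le> q i}"
  \<comment> \<open>The second component records the moved amount. It makes the map injective, and
    its at most m + 1 values are the price \<open>real (m + 1)\<close> of the transfer.\<close>
  define \<phi> where "\<phi> = (\<lambda>q::nat\<Rightarrow>nat. (q(i := q i + q j, j := 0), q j))"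
  have fin: "finite S" "finite R"
    using finite_configs by (auto simp: S_def R_def)
  have inj: "inj_on \<phi> S"
  proof (rule inj_onI)
    fix q q' assume "\<phi> q = \<phi> q'"
    then have *: "q(i := q i + q j, j := 0) = q'(i := q' i + q' j, j := 0)" and j: "q j = q' j"
      by (auto simp: \<phi>_def)
    have "q l = q' l" for l
      using fun_cong[OF *, of l] fun_cong[OF *, of i] j ij by (auto split: if_splits)
    then show "q = q'" by auto
  qed
  have im: "\<phi> ` S \<subseteq> R \<times> {..m}"
  proof
    fix y assume "y \<in> \<phi> ` S"
    then obtain q where q: "q \<in> S" "y = \<phi> q" by auto
    have qc: "q \<in> configs m n" using q by (simp add: S_def)
    have split: "(\<Sum>l\<in>{1..n}. f l) = f i + (f j + (\<Sum>l\<in>{1..n} - {i} - {j}. f l))"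
      for f :: "nat \<Rightarrow> nat"
      using ij by (subst sum.remove[of _ i], simp, simp, subst sum.remove[of _ j]) auto
    have "(\<Sum>l\<in>{1..n}. (q(i := q i + q j, j := 0)) l) = (\<Sum>l\<in>{1..n}. q l)"
      unfolding split using ij by auto
    then have "q(i := q i + q j, j := 0) \<in> configs m n"
      using qc ij by (auto simp: configs_def PiE_iff extensional_def)
    then show "y \<in> R \<times> {..m}"
      using q ij configs_le[OF qc, of j] by (auto simp: R_def S_def \<phi>_def)
  qed
  have le: "weight p n x q \<le> \<kappa> * \<theta> ^ L * weight p n x (fst (\<phi> q))" if q: "q \<in> S" for q
  proof -
    have qc: "q \<in> configs m n" "A \<le> q i" "L \<le> q j" using q by (auto simp: S_def)
    define r where "r = (\<Prod>l\<in>{1..n} - {i} - {j}. x l ^ q l * pmf p (q l))"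
    have r0: "0 \<le> r" unfolding r_def by (intro prod_nonneg) (use x in auto)
    have xi: "0 \<le> x i" and xj0: "0 \<le> x j" using x ij by auto
    have w: "weight p n x q = (x i ^ q i * pmf p (q i)) * ((x j ^ q j * pmf p (q j)) * r)"
      unfolding weight_def r_def using ij
      by (subst prod.remove[of _ i], simp, simp, subst prod.remove[of _ j]) auto
    have w': "weight p n x (fst (\<phi> q)) = (x i ^ (q i + q j) * pmf p (q i + q j)) * (pmf p 0 * r)"
      unfolding weight_def r_def \<phi>_def using ij
      by (subst prod.remove[of _ i], simp, simp, subst prod.remove[of _ j]) auto
    have "(\<Sum>l\<in>{i,j}. q l) \<le> (\<Sum>l\<in>{1..n}. q l)"
      using ij by (intro sum_mono2) auto
    then have "q i + q j \<le> m"
      using ij configs_sum[OF qc(1)] by simp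
    then have pp: "pmf p (q i) * pmf p (q j) \<le> \<kappa> * (pmf p 0 * pmf p (q i + q j))"
      using p qc by auto
    have "x j ^ q j \<le> (\<theta> * x i) ^ q j" using xj xj0 by (intro power_mono)
    also have "\<dots> \<le> \<theta> ^ L * x i ^ q j"
      unfolding power_mult_distrib using \<theta> qc xi by (intro mult_right_mono power_decreasing) auto
    finally have "x i ^ q i * x j ^ q j \<le> \<theta> ^ L * x i ^ (q i + q j)"
      using mult_left_mono[of "x j ^ q j" "\<theta> ^ L * x i ^ q j" "x i ^ q i"] xi
      by (simp add: power_add mult_ac)
    then have "(x i ^ q i * x j ^ q j) * (pmf p (q i) * pmf p (q j)) * r \<le>
          (\<theta> ^ L * x i ^ (q i + q j)) * (\<kappa> * (pmf p 0 * pmf p (q i + q j))) * r"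
      using pp r0 xi \<theta> xj0
      by (intro mult_right_mono[OF mult_mono[OF _ pp]]) auto
    then show ?thesis
      unfolding w w' by (simp add: mult_ac)
  qed
  have "(\<Sum>q\<in>S. weight p n x q) \<le> (\<Sum>q\<in>S. \<kappa> * \<theta> ^ L * weight p n x (fst (\<phi> q)))"
    by (intro sum_mono le)
  also have "\<dots> = (\<Sum>y\<in>\<phi> ` S. \<kappa> * \<theta> ^ L * weight p n x (fst y))"
    by (simp add: sum.reindex[OF inj])
  also have "\<dots> \<le> (\<Sum>y\<in>R \<times> {..m}. \<kappa> * \<theta> ^ L * weight p n x (fst y))"
    by (intro sum_mono2) (use fin im x \<kappa> \<theta> in \<open>auto intro!: mult_nonneg_nonneg weight_nonneg\<close>)
  also have "\<dots> = (\<Sum>q\<in>R. \<Sum>b\<in>{..m}. \<kappa> * \<theta> ^ L * weight p n x q)"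
    unfolding sum.cartesian_product by (simp add: split_def)
  also have "\<dots> = real (m + 1) * \<kappa> * \<theta> ^ L * (\<Sum>q\<in>R. weight p n x q)"
    by (simp add: sum_distrib_left mult_ac)
  finally show ?thesis by (simp add: S_def R_def)
qed

lemma card_large_le:
  assumes "q \<in> configs m n"
  shows "card {i \<in> {1..n}. L \<le> q i} * L \<le> m"
proof -
  have "card {i \<in> {1..n}. L \<le> q i} * L = (\<Sum>i\<in>{i \<in> {1..n}. L \<le> q i}. L)" by simp
  also have "\<dots> \<le> (\<Sum>i\<in>{i \<in> {1..n}. L \<le> q i}. q i)" by (intro sum_mono) auto
  also have "\<dots> \<le> (\<Sum>i\<in>{1..n}. q i)" by (intro sum_mono2) auto
  also have "\<dots> = m" using configs_sum[OF assms] .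
  finally show ?thesis .
qed

lemma sum_Ex_le:
  fixes f :: "'a \<Rightarrow> real"
  assumes "finite S" "finite J" "\<And>q. q \<in> S \<Longrightarrow> 0 \<le> f q"
  shows "(\<Sum>q | q \<in> S \<and> (\<exists>j\<in>J. P j q). f q) \<le> (\<Sum>j\<in>J. \<Sum>q | q \<in> S \<and> P j q. f q)"
proof -
  have "(\<Sum>q | q \<in> S \<and> (\<exists>j\<in>J. P j q). f q) = (\<Sum>q\<in>S. if \<exists>j\<in>J. P j q then f q else 0)"
    using assms by (simp add: sum.inter_filter)
  also have "\<dots> \<le> (\<Sum>q\<in>S. \<Sum>j\<in>J. if P j q then f q else 0)"
  proof (intro sum_mono)
    fix q assume q: "q \<in> S"
    show "(if \<exists>j\<in>J. P j q then f q else 0) \<le> (\<Sum>j\<in>J. if P j q then f q else 0)"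
    proof (cases "\<exists>j\<in>J. P j q")
      case True
      then obtain j where "j \<in> J" "P j q" by auto
      then show ?thesis
        using member_le_sum[of j J "\<lambda>j. if P j q then f q else 0"] assms q by auto
    qed (auto intro!: sum_nonneg assms q)
  qed
  also have "\<dots> = (\<Sum>j\<in>J. \<Sum>q\<in>S. if P j q then f q else 0)"
    by (rule sum.swap)
  also have "\<dots> = (\<Sum>j\<in>J. \<Sum>q | q \<in> S \<and> P j q. f q)"
    using assms by (simp add: sum.inter_filter)
  finally show ?thesis .
qed

text \<open>All donors outside H hand their content to the one site M. The receiver may hold any
  content, so \<open>transfer_bound\<close> is used with A = 0. The union over donors costs n, which
  is affordable against \<open>\<theta> ^ L\<close>.\<close>

lemma large_off_sites_bound:
  assumes x: "\<And>l. l \<in> {1..n} \<Longrightarrow> 0 \<le> x l" and M: "M \<in> {1..n}" "M \<in> H"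
    and off: "\<And>j. j \<in> {1..n} - H \<Longrightarrow> x j \<le> \<theta> * x M"
    and \<theta>: "0 \<le> \<theta>" "\<theta> \<le> 1" and \<kappa>: "0 \<le> \<kappa>"
    and p: "\<And>a b. L \<le> b \<Longrightarrow> a + b \<le> m \<Longrightarrow>
              pmf p a * pmf p b \<le> \<kappa> * (pmf p 0 * pmf p (a + b))"
  shows "(\<Sum>q | q \<in> configs m n \<and> (\<exists>j\<in>{1..n} - H. L \<le> q j). weight p n x q) \<le>
           real n * (real (m + 1) * \<kappa> * \<theta> ^ L) * partition_fun p m n x"
proof -
  let ?S = "\<lambda>j. {q. q \<in> configs m n \<and> 0 \<le> q M \<and> L \<le> q j}"
  have "(\<Sum>q | q \<in> configs m n \<and> (\<exists>j\<in>{1..n} - H. L \<le> q j). weight p n x q) \<le>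
      (\<Sum>j\<in>{1..n} - H. \<Sum>q\<in>?S j. weight p n x q)"
    by (simp, rule sum_Ex_le) (use x finite_configs in \<open>auto intro: weight_nonneg\<close>)
  also have "\<dots> \<le> (\<Sum>j\<in>{1..n} - H. real (m + 1) * \<kappa> * \<theta> ^ L * partition_fun p m n x)"
  proof (intro sum_mono)
    fix j assume j: "j \<in> {1..n} - H"
    have "(\<Sum>q\<in>?S j. weight p n x q) \<le> real (m + 1) * \<kappa> * \<theta> ^ L *
        (\<Sum>q | q \<in> configs m n \<and> 0 \<le> q M. weight p n x q)"
      by (rule transfer_bound) (use assms j in auto)
    then show "(\<Sum>q\<in>?S j. weight p n x q) \<le> real (m + 1) * \<kappa> * \<theta> ^ L * partition_fun p m n x"
      by (simp add: partition_fun_def)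
  qed
  also have "\<dots> = real (card ({1..n} - H)) * (real (m + 1) * \<kappa> * \<theta> ^ L * partition_fun p m n x)"
    by simp
  also have "\<dots> \<le> real n * (real (m + 1) * \<kappa> * \<theta> ^ L * partition_fun p m n x)"
  proof (rule mult_right_mono)
    show "real (card ({1..n} - H)) \<le> real n"
      using card_mono[of "{1..n}" "{1..n} - H"] by auto
    show "0 \<le> real (m + 1) * \<kappa> * \<theta> ^ L * partition_fun p m n x"
      using \<kappa> \<theta> x by (auto simp: partition_fun_def intro!: mult_nonneg_nonneg sum_nonneg weight_nonneg)
  qed
  finally show ?thesis by (simp add: mult_ac)
qed


text \<open>
  For a pair of sites in \<open>H\<close> the transfer goes to the fitter of the two; the number of sites with
  content at least \<open>L\<close> is at most \<open>m / L\<close>, so only one factor \<open>card H\<close> is lost.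
\<close>

lemma two_large_sites_bound:
  assumes x: "\<And>l. l \<in> {1..n} \<Longrightarrow> 0 \<le> x l" and H: "H \<subseteq> {1..n}"
    and \<kappa>: "0 \<le> \<kappa>" and L: "0 < L"
    and p: "\<And>a b. L \<le> a \<Longrightarrow> L \<le> b \<Longrightarrow> a + b \<le> m \<Longrightarrow>
              pmf p a * pmf p b \<le> \<kappa> * (pmf p 0 * pmf p (a + b))"
  shows "(\<Sum>q | q \<in> configs m n \<and> (\<exists>i\<in>H. \<exists>j\<in>H. i \<noteq> j \<and> L \<le> q i \<and> L \<le> q j). weight p n x q) \<le>
           real (card H) * (real (m + 1) * \<kappa>) * (real m / real L) * partition_fun p m n x"
proof -
  define J where "J = {(i, j). i \<in> H \<and> j \<in> H \<and> i \<noteq> j \<and> x j \<le> x i}"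
  have fH: "finite H" using H by (rule finite_subset) auto
  have JH: "J \<subseteq> H \<times> H" by (auto simp: J_def)
  have fJ: "finite J" using fH by (intro finite_subset[OF JH]) auto
  have w: "0 \<le> weight p n x q" for q using x by (rule weight_nonneg)
  let ?g = "\<lambda>i. \<Sum>q | q \<in> configs m n \<and> L \<le> q i. weight p n x q"
  have "(\<Sum>q | q \<in> configs m n \<and> (\<exists>i\<in>H. \<exists>j\<in>H. i \<noteq> j \<and> L \<le> q i \<and> L \<le> q j). weight p n x q) =
      (\<Sum>q | q \<in> configs m n \<and> (\<exists>y\<in>J. L \<le> q (fst y) \<and> L \<le> q (snd y)). weight p n x q)"
  proof (intro sum.cong refl Collect_cong conj_cong)
    fix q
    show "(\<exists>i\<in>H. \<exists>j\<in>H. i \<noteq> j \<and> L \<le> q i \<and> L \<le> q j) \<longleftrightarrow>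
          (\<exists>y\<in>J. L \<le> q (fst y) \<and> L \<le> q (snd y))" (is "?A \<longleftrightarrow> ?B")
    proof
      assume ?A
      then obtain i j where ij: "i \<in> H" "j \<in> H" "i \<noteq> j" "L \<le> q i" "L \<le> q j" by blast
      then have "(i, j) \<in> J \<or> (j, i) \<in> J" by (auto simp: J_def)
      then show ?B using ij by (auto intro: bexI[of _ "(i, j)"] bexI[of _ "(j, i)"])
    qed (auto simp: J_def)
  qed
  also have "\<dots> \<le> (\<Sum>y\<in>J. \<Sum>q | q \<in> configs m n \<and> L \<le> q (fst y) \<and> L \<le> q (snd y). weight p n x q)"
    by (rule sum_Ex_le) (use finite_configs fJ w in auto)
  also have "\<dots> \<le> (\<Sum>y\<in>J. real (m + 1) * \<kappa> * ?g (fst y))"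
  proof (rule sum_mono)
    fix y assume y: "y \<in> J"
    then have y': "fst y \<in> {1..n}" "snd y \<in> {1..n}" "fst y \<noteq> snd y" "x (snd y) \<le> 1 * x (fst y)"
      using H by (auto simp: J_def)
    show "(\<Sum>q | q \<in> configs m n \<and> L \<le> q (fst y) \<and> L \<le> q (snd y). weight p n x q) \<le>
        real (m + 1) * \<kappa> * ?g (fst y)"
      using transfer_bound[OF y'(1-3) x y'(4) _ _ \<kappa> p] by auto
  qed
  \<comment> \<open>The bound no longer depends on the donor, so summing over donors gives
    \<open>card H\<close>; the sum over receivers is kept for the double counting of large
    sites.\<close>
  also have "\<dots> \<le> (\<Sum>y\<in>H \<times> H. real (m + 1) * \<kappa> * ?g (fst y))"
    by (rule sum_mono2) (use fH JH \<kappa> w in \<open>auto intro!: mult_nonneg_nonneg sum_nonneg\<close>)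
  also have "\<dots> = (\<Sum>i\<in>H. \<Sum>j\<in>H. real (m + 1) * \<kappa> * ?g i)"
    unfolding sum.cartesian_product by (simp add: split_def)
  also have "\<dots> = real (card H) * (real (m + 1) * \<kappa>) * (\<Sum>i\<in>H. ?g i)"
    by (simp add: sum_distrib_left mult_ac)
  also have "(\<Sum>i\<in>H. ?g i) \<le> (\<Sum>i\<in>{1..n}. ?g i)"
    by (rule sum_mono2) (use H w in \<open>auto intro!: sum_nonneg\<close>)
  also have "(\<Sum>i\<in>{1..n}. ?g i) = (\<Sum>i\<in>{1..n}. \<Sum>q\<in>configs m n. if L \<le> q i then weight p n x q else 0)"
    using finite_configs by (simp add: sum.inter_filter)
  also have "\<dots> = (\<Sum>q\<in>configs m n. \<Sum>i\<in>{1..n}. if L \<le> q i then weight p n x q else 0)"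
    by (rule sum.swap)
  also have "\<dots> = (\<Sum>q\<in>configs m n. real (card {i\<in>{1..n}. L \<le> q i}) * weight p n x q)"
    by (simp add: sum.inter_filter[symmetric])
  also have "\<dots> \<le> (\<Sum>q\<in>configs m n. (real m / real L) * weight p n x q)"
  proof (intro sum_mono mult_right_mono w)
    fix q assume "q \<in> configs m n"
    then have "real (card {i\<in>{1..n}. L \<le> q i}) * real L \<le> real m"
      using card_large_le[of q m n L] by (simp only: of_nat_mult[symmetric] of_nat_le_iff)
    then show "real (card {i\<in>{1..n}. L \<le> q i}) \<le> real m / real L"
      using L by (simp add: field_simps)
  qed
  also have "\<dots> = (real m / real L) * partition_fun p m n x"
    by (simp add: partition_fun_def sum_distrib_left)
  finally show ?thesis using \<kappa> by (simp add: mult_left_mono mult.assoc)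
qed

text \<open>Exponential Markov inequality for unnormalised product weights: the tilted sum
  factorises over the sites, and 1 + y \<le> exp y turns the product into a sum in the exponent. The
  masses \<open>\<Phi> i\<close> are kept as a prefactor, to be compared later with the partition
  function. The statistic f may be negative, so lower deviations are covered too.\<close>

lemma chernoff_bound:
  fixes a :: "'i \<Rightarrow> nat \<Rightarrow> real" and \<Phi> :: "'i \<Rightarrow> real" and f :: "nat \<Rightarrow> real"
  assumes I: "finite I" and a: "\<And>i k. i \<in> I \<Longrightarrow> 0 \<le> a i k" and \<Phi>: "\<And>i. i \<in> I \<Longrightarrow> 0 < \<Phi> i"
    and le: "\<And>i. i \<in> I \<Longrightarrow> (\<Sum>k\<le>m. a i k) \<le> \<Phi> i" and t: "0 \<le> t"
  shows "(\<Sum>q | q \<in> I \<rightarrow>\<^sub>E {..m} \<and> B \<le> (\<Sum>i\<in>I. f (q i)). \<Prod>i\<in>I. a i (q i)) \<le>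
     (\<Prod>i\<in>I. \<Phi> i) * exp (- t * B + (\<Sum>i\<in>I. (\<Sum>k\<le>m. a i k * (exp (t * f k) - 1)) / \<Phi> i))"
proof -
  let ?S = "I \<rightarrow>\<^sub>E {..m}"
  have fin: "finite ?S" using I by (intro finite_PiE) auto
  have pr: "0 \<le> (\<Prod>i\<in>I. a i (q i))" for q by (intro prod_nonneg) (use a in auto)
  have "(\<Sum>q | q \<in> ?S \<and> B \<le> (\<Sum>i\<in>I. f (q i)). \<Prod>i\<in>I. a i (q i)) \<le>
      (\<Sum>q | q \<in> ?S \<and> B \<le> (\<Sum>i\<in>I. f (q i)). (\<Prod>i\<in>I. a i (q i)) * exp (t * ((\<Sum>i\<in>I. f (q i)) - B)))"
  proof (intro sum_mono)
    fix q assume "q \<in> {q \<in> ?S. B \<le> (\<Sum>i\<in>I. f (q i))}"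
    then have "1 \<le> exp (t * ((\<Sum>i\<in>I. f (q i)) - B))" using t by auto
    from mult_left_mono[OF this pr[of q]]
    show "(\<Prod>i\<in>I. a i (q i)) \<le> (\<Prod>i\<in>I. a i (q i)) * exp (t * ((\<Sum>i\<in>I. f (q i)) - B))" by simp
  qed
  also have "\<dots> \<le> (\<Sum>q\<in>?S. (\<Prod>i\<in>I. a i (q i)) * exp (t * ((\<Sum>i\<in>I. f (q i)) - B)))"
    by (intro sum_mono2) (use fin pr in auto)
  also have "\<dots> = exp (- t * B) * (\<Sum>q\<in>?S. \<Prod>i\<in>I. a i (q i) * exp (t * f (q i)))"
    using I by (simp add: sum_distrib_left right_diff_distrib exp_diff exp_minus exp_sum
        prod.distrib field_simps)
  also have "(\<Sum>q\<in>?S. \<Prod>i\<in>I. a i (q i) * exp (t * f (q i))) = (\<Prod>i\<in>I. \<Sum>k\<le>m. a i k * exp (t * f k))"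
    using I by (subst prod_sum_PiE) auto
  also have "\<dots> \<le> (\<Prod>i\<in>I. \<Phi> i * exp ((\<Sum>k\<le>m. a i k * (exp (t * f k) - 1)) / \<Phi> i))"
  proof (intro prod_mono conjI)
    fix i assume i: "i \<in> I"
    show "0 \<le> (\<Sum>k\<le>m. a i k * exp (t * f k))"
      using a[OF i] by (intro sum_nonneg) auto
    have "(\<Sum>k\<le>m. a i k * exp (t * f k)) = (\<Sum>k\<le>m. a i k) + (\<Sum>k\<le>m. a i k * (exp (t * f k) - 1))"
      by (simp add: algebra_simps sum_subtractf)
    also have "\<dots> \<le> \<Phi> i * (1 + (\<Sum>k\<le>m. a i k * (exp (t * f k) - 1)) / \<Phi> i)"
      using le[OF i] \<Phi>[OF i] by (simp add: field_simps)
    also have "\<dots> \<le> \<Phi> i * exp ((\<Sum>k\<le>m. a i k * (exp (t * f k) - 1)) / \<Phi> i)"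
      using \<Phi>[OF i] by (intro mult_left_mono exp_ge_add_one_self) auto
    finally show "(\<Sum>k\<le>m. a i k * exp (t * f k)) \<le> \<dots>" .
  qed
  also have "\<dots> = (\<Prod>i\<in>I. \<Phi> i) * exp (\<Sum>i\<in>I. (\<Sum>k\<le>m. a i k * (exp (t * f k) - 1)) / \<Phi> i)"
    using I by (simp add: prod.distrib exp_sum)
  finally show ?thesis
    unfolding exp_add by (simp add: mult_ac)
qed

section \<open>The two largest contents in terms of individual sites\<close>

lemma order_stat_one:
  assumes "1 \<le> n"
  shows "order_stat n 1 q = Max (q ` {1..n})"
proof -
  define l where "l = sort (map q [1..<Suc n])"
  have ne: "l \<noteq> []" and "sorted l" and set_l: "set l = q ` {1..n}"
    using assms by (auto simp: l_def atLeastLessThanSuc_atLeastAtMost simp flip: length_0_conv simp del: upt_Suc)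
  have "rev l ! 0 = last l"
    using ne by (metis hd_conv_nth hd_rev rev_is_Nil_conv)
  also have "last l = Max (set l)"
  proof (rule Max_eqI[symmetric])
    fix y assume "y \<in> set l"
    then obtain i where "i < length l" "y = l ! i" by (auto simp: in_set_conv_nth)
    then show "y \<le> last l"
      using sorted_nth_mono[OF \<open>sorted l\<close>, of i "length l - 1"] ne by (simp add: last_conv_nth)
  qed (use ne in auto)
  finally show ?thesis unfolding order_stat_def l_def[symmetric] set_l by simp
qed

lemma order_stat_two_ge:
  assumes n: "2 \<le> n" and c: "c \<le> order_stat n 2 q"
  shows "\<exists>i\<in>{1..n}. \<exists>j\<in>{1..n}. i \<noteq> j \<and> c \<le> q i \<and> c \<le> q j"
proof -
  define l where "l = sort (map q [1..<Suc n])"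
  have len: "length l = n" by (simp add: l_def)
  have "sorted l" by (simp add: l_def)
  have l2: "c \<le> l ! (n - 2)"
    using c n len unfolding order_stat_def l_def[symmetric] by (simp add: rev_nth numeral_2_eq_2)
  have l1: "c \<le> l ! (n - 1)"
    using l2 sorted_nth_mono[OF \<open>sorted l\<close>, of "n - 2" "n - 1"] n len by linarith
  have "{n-2, n-1} \<subseteq> {i. i < length l \<and> c \<le> l ! i}"
    using l1 l2 n len by auto
  then have "card {n-2, n-1} \<le> card {i. i < length l \<and> c \<le> l ! i}"
    by (intro card_mono) auto
  then have "2 \<le> length (filter (\<lambda>y. c \<le> y) l)"
    using n by (simp add: length_filter_conv_card card_insert_if split: if_splits)
  also have "length (filter (\<lambda>y. c \<le> y) l) = length (filter (\<lambda>y. c \<le> y) (map q [1..<Suc n]))"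
    unfolding l_def by (metis filter_sort length_sort)
  also have "\<dots> = length (filter (\<lambda>i. c \<le> q i) [1..<Suc n])"
    by (simp add: filter_map o_def del: upt_Suc)
  also have "\<dots> = card {i \<in> {1..n}. c \<le> q i}"
    by (subst distinct_card[symmetric]) (auto simp del: upt_Suc intro!: arg_cong[of _ _ card])
  finally have "\<not> card {i \<in> {1..n}. c \<le> q i} \<le> Suc 0" by simp
  then have "\<exists>i\<in>{i \<in> {1..n}. c \<le> q i}. \<exists>j\<in>{i \<in> {1..n}. c \<le> q i}. i \<noteq> j"
    by (subst (asm) card_le_Suc0_iff_eq) auto
  then show ?thesis by blast
qed

section \<open>Reduction of the annealed law to the quenched weights\<close>

lemma measurable_quenched_prob:
  fixes \<mu> :: "real measure"
  assumes [measurable_cong]: "sets \<mu> = sets borel"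
  shows "(\<lambda>(x, q). ennreal (quenched_prob p m n x q)) \<in> borel_measurable
    ((\<Pi>\<^sub>M i\<in>{1..n}. \<mu>) \<Otimes>\<^sub>M count_space ({1..n} \<rightarrow>\<^sub>E UNIV))"
proof -
  have w: "(\<lambda>x. weight p n x q) \<in> borel_measurable (\<Pi>\<^sub>M i\<in>{1..n}. \<mu>)" for q
    unfolding weight_def
  proof (intro borel_measurable_prod borel_measurable_times borel_measurable_power borel_measurable_const)
    fix i assume "i \<in> {1..n}"
    then have "(\<lambda>x. x i) \<in> measurable (\<Pi>\<^sub>M i\<in>{1..n}. \<mu>) \<mu>" by (rule measurable_component_singleton)
    then show "(\<lambda>x. x i) \<in> borel_measurable (\<Pi>\<^sub>M i\<in>{1..n}. \<mu>)"
      by (simp add: measurable_cong_sets[OF refl assms])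
  qed
  have z: "(\<lambda>x. partition_fun p m n x) \<in> borel_measurable (\<Pi>\<^sub>M i\<in>{1..n}. \<mu>)"
    unfolding partition_fun_def by (intro borel_measurable_sum w)
  have qp: "(\<lambda>x. ennreal (quenched_prob p m n x q)) \<in> borel_measurable (\<Pi>\<^sub>M i\<in>{1..n}. \<mu>)" for q
    unfolding quenched_prob_def using w[measurable] z[measurable] by measurable
  have c: "countable ({1..n} \<rightarrow>\<^sub>E (UNIV :: nat set))"
    by (intro countable_PiE) auto
  have "(\<lambda>\<omega>. ennreal (quenched_prob p m n (fst \<omega>) (snd \<omega>))) \<in> borel_measurable
    ((\<Pi>\<^sub>M i\<in>{1..n}. \<mu>) \<Otimes>\<^sub>M count_space ({1..n} \<rightarrow>\<^sub>E UNIV))"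
    \<comment> \<open>The second component takes countably many values, so joint measurability
      reduces to measurability in x for each fixed q.\<close>
    by (rule measurable_compose_countable'[where g = snd and I = "{1..n} \<rightarrow>\<^sub>E UNIV"])
       (use c measurable_compose[OF measurable_fst qp] in auto)
  then show ?thesis by (simp add: split_def)
qed

lemma quenched_prob_nn_integral_le:
  assumes x: "\<And>i. i \<in> {1..n} \<Longrightarrow> 0 \<le> x i"
  shows "(\<integral>\<^sup>+q. ennreal (quenched_prob p m n x q) \<partial>count_space ({1..n} \<rightarrow>\<^sub>E UNIV)) \<le> 1"
proof (cases "partition_fun p m n x = 0")
  case True
  have "(\<integral>\<^sup>+q. ennreal (quenched_prob p m n x q) \<partial>count_space ({1..n} \<rightarrow>\<^sub>E UNIV)) =
      (\<Sum>q\<in>{\<lambda>i\<in>{1..n}. 0}. ennreal (quenched_prob p m n x q))"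
    by (rule nn_integral_count_space') (auto simp: quenched_prob_def True)
  then show ?thesis by (simp add: quenched_prob_def True)
next
  case False
  have w: "0 \<le> weight p n x q" for q using x by (rule weight_nonneg)
  then have Z: "0 \<le> partition_fun p m n x" by (auto simp: partition_fun_def intro: sum_nonneg)
  have "(\<integral>\<^sup>+q. ennreal (quenched_prob p m n x q) \<partial>count_space ({1..n} \<rightarrow>\<^sub>E UNIV)) =
      (\<Sum>q\<in>configs m n. ennreal (quenched_prob p m n x q))"
    by (rule nn_integral_count_space') (use finite_configs in \<open>auto simp: quenched_prob_def False configs_def\<close>)
  also have "\<dots> = ennreal (\<Sum>q\<in>configs m n. weight p n x q / partition_fun p m n x)"
    using False w Z by (simp add: quenched_prob_def)
  also have "\<dots> = 1"
    using False by (simp add: partition_fun_def flip: sum_divide_distrib)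
  finally show ?thesis by simp
qed

text \<open>Fubini splits the annealed probability over the fitnesses: a good x contributes at most
  \<epsilon>, and a bad x at most 1 because the quenched law has mass at most 1. Convergence under
  the annealed law thus reduces to a deterministic inequality between sums of weights.\<close>

lemma annealed_measure_le:
  fixes \<mu> :: "real measure" and good :: "(nat \<Rightarrow> real) \<Rightarrow> bool" and n :: nat
  defines "P \<equiv> (\<Pi>\<^sub>M i\<in>{1..n}. \<mu>)"
  assumes \<mu>: "prob_space \<mu>" and sets: "sets \<mu> = sets borel" and nonneg: "AE x in \<mu>. 0 \<le> x"
    and bad: "{x \<in> space P. \<not> good x} \<in> sets P" and \<epsilon>: "0 \<le> \<epsilon>"
    and good: "\<And>x. good x \<Longrightarrow> (\<forall>i\<in>{1..n}. 0 \<le> x i) \<and> 0 < partition_fun p m n x \<and>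
      (\<Sum>q | q \<in> configs m n \<and> B q. weight p n x q) \<le> \<epsilon> * partition_fun p m n x"
  shows "measure (annealed_law \<mu> p m n) {\<omega> \<in> space (annealed_law \<mu> p m n). B (snd \<omega>)} \<le>
    \<epsilon> + measure P {x \<in> space P. \<not> good x}"
proof -
  interpret P: prob_space P
    unfolding P_def by (intro prob_space_PiM \<mu>)
  define Q :: "(nat \<Rightarrow> nat) set" where "Q = {1..n} \<rightarrow>\<^sub>E UNIV"
  have cQ: "countable Q" unfolding Q_def by (intro countable_PiE) auto
  interpret C: sigma_finite_measure "count_space Q"
    by (rule sigma_finite_measure_count_space_countable[OF cQ])
  define f where "f = (\<lambda>(x, q). ennreal (quenched_prob p m n x q))"
  have f: "f \<in> borel_measurable (P \<Otimes>\<^sub>M count_space Q)"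
    unfolding f_def P_def Q_def by (rule measurable_quenched_prob[OF sets])
  have law: "annealed_law \<mu> p m n = density (P \<Otimes>\<^sub>M count_space Q) f"
    by (simp add: annealed_law_def P_def Q_def f_def)
  define A where "A = {\<omega> \<in> space (annealed_law \<mu> p m n). B (snd \<omega>)}"
  have A: "A = space P \<times> {q \<in> Q. B q}"
    by (auto simp: A_def law space_pair_measure)
  have A_meas: "A \<in> sets (P \<Otimes>\<^sub>M count_space Q)"
    unfolding A by (intro pair_measureI) auto
  have "emeasure (annealed_law \<mu> p m n) A = (\<integral>\<^sup>+\<omega>. f \<omega> * indicator A \<omega> \<partial>(P \<Otimes>\<^sub>M count_space Q))"
    unfolding law using f A_meas by (rule emeasure_density)
  also have "\<dots> = (\<integral>\<^sup>+x. \<integral>\<^sup>+q. f (x, q) * indicator A (x, q) \<partial>count_space Q \<partial>P)"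
    using f A_meas by (intro C.nn_integral_fst[symmetric] borel_measurable_times_ennreal) auto
  also have "\<dots> \<le> (\<integral>\<^sup>+x. ennreal \<epsilon> + indicator {x \<in> space P. \<not> good x} x \<partial>P)"
  proof (rule nn_integral_mono_AE)
    have "AE x in P. \<forall>i\<in>{1..n}. 0 \<le> x i"
      unfolding P_def by (intro eventually_ball_finite ballI AE_PiM_component \<mu> nonneg) auto
    with AE_space show "AE x in P. (\<integral>\<^sup>+q. f (x, q) * indicator A (x, q) \<partial>count_space Q) \<le>
        ennreal \<epsilon> + indicator {x \<in> space P. \<not> good x} x"
    proof (eventually_elim, goal_cases)
      case (1 x)
      show ?case
      proof (cases "good x")
        case True
        note g = good[OF True]
        have w: "0 \<le> weight p n x q" for q using g by (intro weight_nonneg) auto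
        have "(\<integral>\<^sup>+q. f (x, q) * indicator A (x, q) \<partial>count_space Q) \<le>
           (\<integral>\<^sup>+q. f (x, q) * indicator {q. B q} q \<partial>count_space Q)"
          by (intro nn_integral_mono) (auto simp: A indicator_def)
        also have "\<dots> = (\<Sum>q\<in>{q. q \<in> configs m n \<and> B q}. f (x, q) * indicator {q. B q} q)"
        proof (intro nn_integral_count_space')
          show "{q. q \<in> configs m n \<and> B q} \<subseteq> Q"
            by (auto simp: configs_def Q_def)
        qed (use g finite_configs in \<open>auto simp: f_def quenched_prob_def\<close>)
        also have "\<dots> = (\<Sum>q\<in>{q. q \<in> configs m n \<and> B q}. ennreal (weight p n x q / partition_fun p m n x))"
          using g by (intro sum.cong) (auto simp: f_def quenched_prob_def)
        also have "\<dots> = ennreal ((\<Sum>q | q \<in> configs m n \<and> B q. weight p n x q) / partition_fun p m n x)"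
          using g w by (subst sum_ennreal) (auto simp: sum_divide_distrib)
        also have "\<dots> \<le> ennreal \<epsilon>"
          using g by (intro ennreal_leI) (auto simp: divide_le_eq)
        finally show ?thesis by (simp add: add_increasing2)
      next
        case False
        have "(\<integral>\<^sup>+q. f (x, q) * indicator A (x, q) \<partial>count_space Q) \<le>
            (\<integral>\<^sup>+q. ennreal (quenched_prob p m n x q) \<partial>count_space Q)"
          by (intro nn_integral_mono) (auto simp: f_def indicator_def)
        also have "\<dots> \<le> 1"
          unfolding Q_def using 1 by (intro quenched_prob_nn_integral_le) auto
        also have "\<dots> \<le> ennreal \<epsilon> + indicator {x \<in> space P. \<not> good x} x" 
          using False 1 by simp
        finally show ?thesis .
      qed
    qed
  qed
  also have "\<dots> = ennreal \<epsilon> + emeasure P {x \<in> space P. \<not> good x}"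
    using bad by (simp add: nn_integral_add P.emeasure_space_1)
  also have "\<dots> = ennreal (\<epsilon> + measure P {x \<in> space P. \<not> good x})"
    using \<epsilon> by (simp add: P.emeasure_eq_measure)
  finally show ?thesis
    unfolding A_def[symmetric] using \<epsilon>
    by (simp add: measure_def enn2real_leI)
qed

section \<open>Generating functions\<close>

lemma asymp_equiv_eventually_bounds:
  fixes f g :: "'a \<Rightarrow> real"
  assumes fg: "asymp_equiv f F g" and g: "eventually (\<lambda>x. 0 < g x) F"
  shows "eventually (\<lambda>x. g x / 2 \<le> f x \<and> f x \<le> 2 * g x) F"
proof -
  have "((\<lambda>x. if f x = 0 \<and> g x = 0 then 1 else f x / g x) \<longlongrightarrow> 1) F"
    using fg by (simp add: asymp_equiv_def)
  then have "eventually (\<lambda>x. (if f x = 0 \<and> g x = 0 then 1 else f x / g x) \<in> {1/2<..<2}) F"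
    by (rule topological_tendstoD) auto
  then show ?thesis
    using g by eventually_elim (auto simp: field_simps)
qed

lemma ennreal_suminf: "summable f \<Longrightarrow> (\<And>k. 0 \<le> f k) \<Longrightarrow> ennreal (\<Sum>k. f k) = (\<Sum>k. ennreal (f k))"
  by (rule suminf_ennreal2[symmetric]) auto

lemma pmf_sums_1: "(\<lambda>k. pmf p k) sums (1::real)" for p :: "nat pmf"
  using sums_infsetsum_nat[of "pmf p" UNIV] pmf_abs_summable[of p UNIV] by (simp add: infsetsum_pmf_eq_1)

lemma summable_genfun_abs: "\<bar>z\<bar> \<le> 1 \<Longrightarrow> summable (\<lambda>k. pmf p k * z ^ k)" for z :: real
  by (rule summable_comparison_test'[OF sums_summable[OF pmf_sums_1[of p]], of 0])
     (auto simp: abs_mult power_abs mult_left_le power_le_one)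

lemma summable_genfun: "0 \<le> z \<Longrightarrow> z \<le> 1 \<Longrightarrow> summable (\<lambda>k. pmf p k * z ^ k)" for z :: real
  by (rule summable_genfun_abs) auto

lemma genfun_ge: "0 \<le> z \<Longrightarrow> z \<le> 1 \<Longrightarrow> pmf p 0 \<le> genfun p z"
  unfolding genfun_def using sum_le_suminf[OF summable_genfun[of z p], of "{0}"] by auto

lemma genfun_one: "genfun p 1 = 1"
  using sums_unique[OF pmf_sums_1[of p]] by (simp add: genfun_def)

lemma continuous_on_genfun: "continuous_on {0..1} (genfun p)"
proof -
  have "uniform_limit {0..1} (\<lambda>n z. \<Sum>k<n. pmf p k * z ^ k) (\<lambda>z. \<Sum>k. pmf p k * z ^ k) sequentially"
    by (rule Weierstrass_m_test[OF _ sums_summable[OF pmf_sums_1[of p]]])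
       (auto simp: mult_left_le power_le_one)
  then have "continuous_on {0..1} (\<lambda>z. \<Sum>k. pmf p k * z ^ k)"
    by (rule uniform_limit_theorem[rotated]) (auto intro!: continuous_intros always_eventually)
  then show ?thesis by (simp add: genfun_def[abs_def])
qed

lemma borel_measurable_genfun [measurable]: "genfun p \<in> borel_measurable borel"
  unfolding genfun_def[abs_def] by measurable

text \<open>Moment of order 1 + c of the tilted weights. The shift by 1 makes c the gain over the
  mean: cutting the mean at level K costs a factor K to the power - c. Negative c is used as well: c
  = s - 1 gives the moment of order s < 1.\<close>

definition tail_moment :: "nat pmf \<Rightarrow> real \<Rightarrow> real \<Rightarrow> real" where
  "tail_moment p c z = (\<Sum>k. real k powr (1 + c) * pmf p k * z ^ k)"

lemma borel_measurable_tail_moment [measurable]: "tail_moment p c \<in> borel_measurable borel"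
  unfolding tail_moment_def[abs_def] by measurable

lemma summable_powr_geometric:
  assumes "0 \<le> z" "z < 1"
  shows "summable (\<lambda>k. real k powr a * z ^ k :: real)"
proof (cases "z = 0")
  case False
  \<comment> \<open>Half of the geometric decay absorbs the power of k, the other half is
    summable.\<close>
  define w where "w = sqrt z"
  have w: "0 < w" "w < 1" "z = w * w"
    using assms False by (auto simp: w_def)
  have "(\<lambda>k. real k powr a * w ^ k) \<longlonglongrightarrow> 0"
    using w(1,2) by real_asymp
  then have "eventually (\<lambda>k. real k powr a * w ^ k < 1) sequentially"
    by (rule order_tendstoD) auto
  then have "eventually (\<lambda>k. norm (real k powr a * z ^ k) \<le> w ^ k) sequentially"
  proof eventually_elim
    case (elim k)
    then have "(real k powr a * w ^ k) * w ^ k \<le> 1 * w ^ k" using w by (intro mult_right_mono) auto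
    then show ?case using w by (simp add: power_mult_distrib mult_ac)
  qed
  then show ?thesis
    by (rule summable_comparison_test_ev) (use w in auto)
qed (auto simp: power_0_left intro!: summable_finite[of "{0}"])

lemma summable_tail_moment:
  assumes "0 \<le> z" "z < 1"
  shows "summable (\<lambda>k. real k powr (1 + c) * pmf p k * z ^ k)"
  by (rule summable_comparison_test'[OF summable_powr_geometric[OF assms, of "1 + c"], of 0])
     (use assms in \<open>auto simp: pmf_le_1 mult_left_le intro!: mult_right_mono\<close>)

lemma tail_moment_nonneg: "0 \<le> z \<Longrightarrow> z < 1 \<Longrightarrow> 0 \<le> tail_moment p c z"
  unfolding tail_moment_def by (intro suminf_nonneg summable_tail_moment) auto

lemma tail_moment_mono: "0 \<le> y \<Longrightarrow> y \<le> z \<Longrightarrow> z < 1 \<Longrightarrow> tail_moment p c y \<le> tail_moment p c z"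
  unfolding tail_moment_def
  by (intro suminf_le summable_tail_moment) (auto intro!: mult_left_mono power_mono)

lemma sum_le_tail_moment:
  assumes "0 \<le> z" "z < 1" "finite A"
  shows "(\<Sum>k\<in>A. real k powr (1 + c) * pmf p k * z ^ k) \<le> tail_moment p c z"
  unfolding tail_moment_def by (rule sum_le_suminf) (use assms summable_tail_moment in auto)

text \<open>Mean content of a site of fitness z when contents above K are counted as 0. Unlike the
  full mean, it is bounded and continuous up to z = 1, so Hoeffding's inequality and uniform
  continuity apply to it.\<close>

definition trunc_mean :: "nat pmf \<Rightarrow> nat \<Rightarrow> real \<Rightarrow> real" where
  "trunc_mean p K z = (\<Sum>k\<le>K. real k * pmf p k * z ^ k) / genfun p z"

lemma borel_measurable_trunc_mean [measurable]: "trunc_mean p K \<in> borel_measurable borel"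
  unfolding trunc_mean_def[abs_def] by measurable

lemma continuous_on_trunc_mean:
  assumes "0 < pmf p 0"
  shows "continuous_on {0..1} (trunc_mean p K)"
  unfolding trunc_mean_def[abs_def]
  by (intro continuous_intros continuous_on_genfun) (use genfun_ge[of _ p] assms in fastforce)

lemma trunc_mean_bounds:
  assumes p: "0 < pmf p 0" and z: "0 \<le> z" "z \<le> 1"
  shows "0 \<le> trunc_mean p K z" "trunc_mean p K z \<le> K"
proof -
  have g: "0 < genfun p z" using genfun_ge[OF z, of p] p by simp
  then show "0 \<le> trunc_mean p K z"
    using z by (auto simp: trunc_mean_def intro!: divide_nonneg_nonneg sum_nonneg)
  have "(\<Sum>k\<le>K. real k * pmf p k * z ^ k) \<le> (\<Sum>k\<le>K. real K * (pmf p k * z ^ k))"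
    unfolding mult.assoc by (intro sum_mono mult_right_mono) (use z in auto)
  also have "\<dots> = real K * (\<Sum>k\<le>K. pmf p k * z ^ k)"
    by (simp add: sum_distrib_left)
  also have "\<dots> \<le> real K * genfun p z"
    unfolding genfun_def by (intro mult_left_mono sum_le_suminf summable_genfun z) (use z in auto)
  finally show "trunc_mean p K z \<le> K"
    using g by (simp add: trunc_mean_def divide_le_eq)
qed

lemma summable_mean_series:
  assumes "0 \<le> z" "z < 1"
  shows "summable (\<lambda>k. real k * pmf p k * z ^ k)"
  using summable_tail_moment[OF assms, of 0 p] by simp

text \<open>For k > K, the factor k is at most K to the power - c times k to the power 1 +
  c.\<close>

lemma mean_series_tail_bounds:
  assumes z: "0 \<le> z" "z < 1" and K: "1 \<le> K" and c: "0 \<le> c"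
  shows "(\<Sum>k\<le>K. real k * pmf p k * z ^ k) \<le> (\<Sum>k. real k * pmf p k * z ^ k)"
    and "(\<Sum>k. real k * pmf p k * z ^ k) \<le>
           (\<Sum>k\<le>K. real k * pmf p k * z ^ k) + real K powr (- c) * tail_moment p c z"
proof -
  note s = summable_mean_series[OF z, of p]
  show "(\<Sum>k\<le>K. real k * pmf p k * z ^ k) \<le> (\<Sum>k. real k * pmf p k * z ^ k)"
    by (rule sum_le_suminf[OF s]) (use z in auto)
  have "(\<Sum>k. real k * pmf p k * z ^ k) =
      (\<Sum>k. real (k + Suc K) * pmf p (k + Suc K) * z ^ (k + Suc K)) + (\<Sum>k<Suc K. real k * pmf p k * z ^ k)"
    by (rule suminf_split_initial_segment[OF s])
  also have "(\<Sum>k. real (k + Suc K) * pmf p (k + Suc K) * z ^ (k + Suc K)) \<le>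
     (\<Sum>k. real K powr (- c) * (real (k + Suc K) powr (1 + c) * pmf p (k + Suc K) * z ^ (k + Suc K)))"
  proof (rule suminf_le)
    show "summable (\<lambda>k. real (k + Suc K) * pmf p (k + Suc K) * z ^ (k + Suc K))"
      by (subst summable_iff_shift) (rule s)
    show "summable (\<lambda>k. real K powr (- c) * (real (k + Suc K) powr (1 + c) * pmf p (k + Suc K) * z ^ (k + Suc K)))"
      by (intro summable_mult) (subst summable_iff_shift, rule summable_tail_moment[OF z])
    fix k
    have "1 \<le> (real (k + Suc K) / real K) powr c"
      using K c by (intro ge_one_powr_ge_zero) auto
    also have "\<dots> = real (k + Suc K) powr c * real K powr (- c)"
      using K by (simp add: powr_divide powr_minus field_simps)
    finally have "real (k + Suc K) * 1 \<le> real (k + Suc K) * (real (k + Suc K) powr c * real K powr (- c))"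
      by (intro mult_left_mono) auto
    then have "real (k + Suc K) \<le> real K powr (- c) * real (k + Suc K) powr (1 + c)"
      by (simp add: powr_add mult_ac)
    then have "real (k + Suc K) * (pmf p (k + Suc K) * z ^ (k + Suc K)) \<le>
        real K powr (- c) * real (k + Suc K) powr (1 + c) * (pmf p (k + Suc K) * z ^ (k + Suc K))"
      by (rule mult_right_mono) (use z in auto)
    then show "real (k + Suc K) * pmf p (k + Suc K) * z ^ (k + Suc K) \<le>
        real K powr (- c) * (real (k + Suc K) powr (1 + c) * pmf p (k + Suc K) * z ^ (k + Suc K))"
      by (simp only: mult.assoc)
  qed
  also have "\<dots> = real K powr (- c) * (\<Sum>k. real (k + Suc K) powr (1 + c) * pmf p (k + Suc K) * z ^ (k + Suc K))"
    by (rule suminf_mult) (subst summable_iff_shift, rule summable_tail_moment[OF z])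
  also have "(\<Sum>k. real (k + Suc K) powr (1 + c) * pmf p (k + Suc K) * z ^ (k + Suc K)) \<le> tail_moment p c z"
    unfolding tail_moment_def suminf_split_initial_segment[OF summable_tail_moment[OF z], of c p "Suc K"]
    using z by (simp add: sum_nonneg del: sum.lessThan_Suc)
  finally show "(\<Sum>k. real k * pmf p k * z ^ k) \<le>
           (\<Sum>k\<le>K. real k * pmf p k * z ^ k) + real K powr (- c) * tail_moment p c z"
    by (simp add: mult_left_mono lessThan_Suc_atMost)
qed

lemma deriv_genfun:
  assumes "0 \<le> z" "z < 1"
  shows "z * deriv (genfun p) z = (\<Sum>k. real k * pmf p k * z ^ k)"
proof -
  have "(genfun p has_field_derivative (\<Sum>k. diffs (pmf p) k * z ^ k)) (at z)"
    unfolding genfun_def[abs_def]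
    by (rule termdiffs_strong[of _ 1]) (use sums_summable[OF pmf_sums_1[of p]] assms in auto)
  then have "deriv (genfun p) z = (\<Sum>k. diffs (pmf p) k * z ^ k)"
    by (rule DERIV_imp_deriv)
  also have "z * \<dots> = (\<Sum>k. z * (diffs (pmf p) k * z ^ k))"
    by (rule suminf_mult[symmetric])
       (rule termdiff_converges[of z 1], use summable_genfun_abs[of _ p] assms in auto)
  also have "\<dots> = (\<Sum>k. real (Suc k) * pmf p (Suc k) * z ^ Suc k)"
    by (simp add: diffs_def mult_ac)
  also have "\<dots> = (\<Sum>k. real k * pmf p k * z ^ k)"
    using suminf_split_head[OF summable_mean_series[OF assms, of p]] by simp
  finally show ?thesis .
qed

lemma summable_powr_pmf:
  assumes C: "\<And>k. 1 \<le> k \<Longrightarrow> pmf p k \<le> C * real k powr (- \<beta>)" and s: "s < \<beta> - 1"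
  shows "summable (\<lambda>k. real k powr s * pmf p k)"
proof (rule summable_comparison_test')
  show "summable (\<lambda>k. C * real k powr (s - \<beta>))"
    using s by (intro summable_mult) (simp add: summable_real_powr_iff)
  fix k :: nat assume k: "1 \<le> k"
  have "real k powr s * pmf p k \<le> real k powr s * (C * real k powr (- \<beta>))"
    by (intro mult_left_mono C k) auto
  then show "norm (real k powr s * pmf p k) \<le> C * real k powr (s - \<beta>)"
    by (simp add: powr_diff powr_minus field_simps)
qed

section \<open>The fitness distribution\<close>

locale fitness_law = prob_space \<mu> for \<mu> :: "real measure" +
  fixes \<alpha> \<gamma> :: real
  assumes sets_law [measurable_cong]: "sets \<mu> = sets borel"
    and support: "measure \<mu> {0..1} = 1"
    and gamma_pos: "0 < \<gamma>" and alpha_pos: "0 < \<alpha>"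
    and tail: "asymp_equiv (\<lambda>x. measure \<mu> {1 - x..1}) (at_right 0) (\<lambda>x. \<alpha> * x powr \<gamma>)"
begin

text \<open>The asymptotics give both bounds only near 0. On the rest of (0, 1] they hold after a
  change of constants: from above because probabilities are at most 1, from below by
  monotonicity.\<close>

lemma tail_bounds:
  obtains C c where "0 < C" "0 < c"
    "\<And>y. 0 < y \<Longrightarrow> y \<le> 1 \<Longrightarrow> prob {1 - y..1} \<le> C * y powr \<gamma>"
    "\<And>y. 0 < y \<Longrightarrow> y \<le> 1 \<Longrightarrow> c * y powr \<gamma> \<le> prob {1 - y..1}"
proof -
  have "eventually (\<lambda>y. \<alpha> * y powr \<gamma> / 2 \<le> prob {1 - y..1} \<and> prob {1 - y..1} \<le> 2 * (\<alpha> * y powr \<gamma>)) (at_right 0)"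
    by (rule asymp_equiv_eventually_bounds[OF tail])
       (use alpha_pos in \<open>auto simp: eventually_at_right_field intro!: exI[of _ 1]\<close>)
  then obtain b where b: "0 < b" "\<And>y. 0 < y \<Longrightarrow> y < b \<Longrightarrow>
      \<alpha> * y powr \<gamma> / 2 \<le> prob {1 - y..1} \<and> prob {1 - y..1} \<le> 2 * (\<alpha> * y powr \<gamma>)"
    unfolding eventually_at_right_field by auto
  \<comment> \<open>Strictly below b, so that the asymptotic bounds are available at
    \<open>y0\<close> itself.\<close>
  define y0 where "y0 = min 1 (b / 2)"
  have y0: "0 < y0" "y0 < b" "y0 \<le> 1" using b by (auto simp: y0_def)
  define C where "C = 2 * \<alpha> + y0 powr (- \<gamma>)"
  define c where "c = \<alpha> / 2 * y0 powr \<gamma>"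
  show thesis
  proof (rule that[of C c])
    show "0 < C" "0 < c" using alpha_pos y0 by (auto simp: C_def c_def add_pos_nonneg)
    fix y :: real assume y: "0 < y" "y \<le> 1"
    show "prob {1 - y..1} \<le> C * y powr \<gamma>"
    proof (cases "y < b")
      case True
      then show ?thesis using b(2)[of y] y by (simp add: C_def algebra_simps add_increasing)
    next
      case False
      then have "1 \<le> y0 powr (- \<gamma>) * y powr \<gamma>"
        using y0 y gamma_pos by (simp add: powr_minus field_simps powr_mono2)
      also have "\<dots> \<le> C * y powr \<gamma>" using alpha_pos by (intro mult_right_mono) (auto simp: C_def)
      finally show ?thesis using prob_le_1[of "{1 - y..1}"] by linarith
    qed
    show "c * y powr \<gamma> \<le> prob {1 - y..1}"
    proof (cases "y < b")
      case True
      have "y0 powr \<gamma> \<le> 1 powr \<gamma>" using y0 gamma_pos by (intro powr_mono2) auto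
      then have "c * y powr \<gamma> \<le> \<alpha> / 2 * 1 * y powr \<gamma>"
        unfolding c_def using alpha_pos by (intro mult_right_mono mult_left_mono) auto
      also have "\<dots> \<le> prob {1 - y..1}" using b(2)[of y] y True by simp
      finally show ?thesis .
    next
      case False
      have "y powr \<gamma> \<le> 1 powr \<gamma>" using y gamma_pos by (intro powr_mono2) auto
      then have "c * y powr \<gamma> \<le> c * 1" using alpha_pos by (intro mult_left_mono) (auto simp: c_def)
      also have "\<dots> \<le> prob {1 - y0..1}" using b(2)[of y0] y0 by (simp add: c_def)
      also have "\<dots> \<le> prob {1 - y..1}"
        using False y0 by (intro finite_measure_mono) (auto simp: sets_law)
      finally show ?thesis .
    qed
  qed
qed

text \<open>The tail bound squeezes the mass of {1} below every C y to the power \<gamma>. Hence all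
  series are almost surely evaluated strictly inside the unit disc.\<close>

lemma AE_unit: "AE x in \<mu>. 0 \<le> x \<and> x < 1"
proof -
  obtain C c where C: "0 < C" "\<And>y. 0 < y \<Longrightarrow> y \<le> 1 \<Longrightarrow> prob {1 - y..1} \<le> C * y powr \<gamma>"
    using tail_bounds by metis
  have "((\<lambda>y. C * y powr \<gamma>) \<longlongrightarrow> 0) (at_right 0)"
    using gamma_pos C(1) by real_asymp
  moreover have "eventually (\<lambda>y. prob {1} \<le> C * y powr \<gamma>) (at_right 0)"
    unfolding eventually_at_right_field
  proof (intro exI[of _ 1] conjI allI impI)
    fix y :: real assume y: "0 < y" "y < 1"
    have "prob {1} \<le> prob {1 - y..1}" using y by (intro finite_measure_mono) (auto simp: sets_law)
    also have "\<dots> \<le> C * y powr \<gamma>" using C y by simp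
    finally show "prob {1} \<le> C * y powr \<gamma>" .
  qed auto
  ultimately have "prob {1} \<le> 0"
    by (intro tendsto_lowerbound[of _ 0 "at_right (0::real)"]) auto
  then have "prob {1} = 0" by (simp add: measure_nonneg antisym)
  then have "emeasure \<mu> {1} = 0" by (simp add: emeasure_eq_measure)
  then have "AE x in \<mu>. x \<noteq> 1"
    by (intro AE_I[of _ _ "{1}"]) (auto simp: sets_law)
  moreover have "AE x in \<mu>. x \<in> {0..1}"
    using support by (subst AE_in_set_eq_1) (auto simp: sets_law)
  ultimately show ?thesis by eventually_elim auto
qed

text \<open>Split at distance y = k to the power - g / \<gamma> from 1. The zone closer to 1 has
  mass of order y to the power \<gamma>, which is k to the power - g; outside it the integrand is at
  most exp (- k y / 2), a stretched exponential because g < \<gamma>.\<close>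

lemma nn_integral_power_le:
  assumes g: "0 < g" "g < \<gamma>"
  obtains C where "0 < C" "\<And>k. 1 \<le> k \<Longrightarrow>
    (\<integral>\<^sup>+x. ennreal (((1 + x) / 2) ^ k * indicator {0..<1} x) \<partial>\<mu>) \<le> ennreal (C * real k powr (- g))"
proof -
  obtain C where C: "0 < C" "\<And>y. 0 < y \<Longrightarrow> y \<le> 1 \<Longrightarrow> prob {1 - y..1} \<le> C * y powr \<gamma>"
    using tail_bounds by metis
  define a where "a = g / \<gamma>"
  have a: "0 < a" "a < 1" using g by (auto simp: a_def)
  have "(\<lambda>k. exp (- (real k powr (1 - a)) / 2) * real k powr g) \<longlonglongrightarrow> 0"
    using a g by real_asymp
  then have "Bseq (\<lambda>k. exp (- (real k powr (1 - a)) / 2) * real k powr g)"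
    by (intro convergent_imp_Bseq convergentI)
  then obtain B where B: "0 < B" "\<And>k. norm (exp (- (real k powr (1 - a)) / 2) * real k powr g) \<le> B"
    by (auto elim: BseqE)
  show thesis
  proof (rule that[of "C + B"])
    fix k :: nat assume k: "1 \<le> k"
    define y where "y = real k powr (- a)"
    have y: "0 < y" "y \<le> 1"
      using k a ge_one_powr_ge_zero[of "real k" a] by (auto simp: y_def powr_minus field_simps)
    have "(\<integral>\<^sup>+x. ennreal (((1 + x) / 2) ^ k * indicator {0..<1} x) \<partial>\<mu>) \<le>
       (\<integral>\<^sup>+x. indicator {1 - y..1} x + ennreal ((1 - y / 2) ^ k) \<partial>\<mu>)"
    proof (intro nn_integral_mono)
      fix x :: real
      show "ennreal (((1 + x) / 2) ^ k * indicator {0..<1} x) \<le> indicator {1 - y..1} x + ennreal ((1 - y / 2) ^ k)"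
      proof (cases "0 \<le> x \<and> x < 1")
        case x: True
        show ?thesis
        proof (cases "1 - y \<le> x")
          case True
          have "((1 + x) / 2) ^ k \<le> 1" using x by (intro power_le_one) auto
          then show ?thesis using True x by (auto intro!: add_increasing2)
        next
          case False
          then have "((1 + x) / 2) ^ k \<le> (1 - y / 2) ^ k" using x by (intro power_mono) auto
          then show ?thesis using False x by (auto intro: ennreal_leI)
        qed
      qed auto
    qed
    also have "\<dots> = ennreal (prob {1 - y..1} + (1 - y / 2) ^ k)"
      using y by (simp add: nn_integral_add sets_law emeasure_eq_measure prob_space)
    also have "\<dots> \<le> ennreal ((C + B) * real k powr (- g))"
    proof (rule ennreal_leI)
      have "y powr \<gamma> = real k powr (- g)"
        using gamma_pos by (simp add: y_def powr_powr a_def)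
      then have "prob {1 - y..1} \<le> C * real k powr (- g)" using C(2)[of y] y by simp
      moreover have "(1 - y / 2) ^ k \<le> B * real k powr (- g)"
      proof -
        have "(1 - y / 2) ^ k \<le> exp (- (y / 2)) ^ k"
          using y exp_ge_add_one_self[of "- (y / 2)"] by (intro power_mono) auto
        also have "\<dots> = exp (- (real k powr (1 - a)) / 2)"
          using k by (simp add: exp_of_nat_mult[symmetric] y_def powr_diff powr_minus field_simps)
        also have "\<dots> \<le> B * real k powr (- g)"
          using B(2)[of k] k by (simp add: powr_minus field_simps)
        finally show ?thesis .
      qed
      ultimately show "prob {1 - y..1} + (1 - y / 2) ^ k \<le> (C + B) * real k powr (- g)"
        by (simp add: algebra_simps)
    qed
    finally show "(\<integral>\<^sup>+x. ennreal (((1 + x) / 2) ^ k * indicator {0..<1} x) \<partial>\<mu>) \<le>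
      ennreal ((C + B) * real k powr (- g))" .
  qed (use C B in auto)
qed

text \<open>
  After rescaling by a maximum close to 1, a fitness \<open>x\<close> not too close to 1 is still at most \<open>(1 + x) / 2\<close>.
  The series for \<open>tail_moment\<close> may diverge at 1, hence the case distinction.
\<close>

definition half_moment :: "nat pmf \<Rightarrow> real \<Rightarrow> real \<Rightarrow> real" where
  "half_moment p c x = (if 0 \<le> x \<and> x < 1 then tail_moment p c ((1 + x) / 2) else 0)"

lemma half_moment_nonneg: "0 \<le> half_moment p c x"
  by (auto simp: half_moment_def intro!: tail_moment_nonneg)

lemma borel_measurable_half_moment [measurable]: "half_moment p c \<in> borel_measurable borel"
  unfolding half_moment_def[abs_def] by measurable

text \<open>Integrating the series term by term gives terms of order k to the power 1 + c - \<beta>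
  - g for any g < \<gamma>. They are summable for g close to \<gamma> precisely because c < \<beta>
  + \<gamma> - 2.\<close>

lemma integrable_half_moment:
  assumes C: "\<And>k. 1 \<le> k \<Longrightarrow> pmf p k \<le> C * real k powr (- \<beta>)"
    and c: "0 < c" "c < \<beta> + \<gamma> - 2" and \<beta>: "1 < \<beta>"
  shows "integrable \<mu> (half_moment p c)"
proof -
  \<comment> \<open>Midpoint between c + 2 - \<beta>, above which the series converges, and
    \<gamma>; the alternative \<gamma> / 2 keeps g positive.\<close>
  define g where "g = max (\<gamma> / 2) ((c + 2 - \<beta> + \<gamma>) / 2)"
  have g: "0 < g" "g < \<gamma>" "1 + c - \<beta> - g < -1"
    using gamma_pos c by (auto simp: g_def max_def field_simps)
  obtain A where A: "0 < A" "\<And>k. 1 \<le> k \<Longrightarrow>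
    (\<integral>\<^sup>+x. ennreal (((1 + x) / 2) ^ k * indicator {0..<1} x) \<partial>\<mu>) \<le> ennreal (A * real k powr (- g))"
    using nn_integral_power_le[OF g(1,2)] by metis
  have C0: "0 \<le> C" using C[of 1] pmf_nonneg[of p 1] by (simp del: pmf_nonneg)
  have "(\<integral>\<^sup>+x. ennreal (half_moment p c x) \<partial>\<mu>) =
      (\<integral>\<^sup>+x. (\<Sum>k. ennreal (real k powr (1 + c) * pmf p k * (((1 + x) / 2) ^ k * indicator {0..<1} x))) \<partial>\<mu>)"
  proof (intro nn_integral_cong)
    fix x :: real
    show "ennreal (half_moment p c x) =
        (\<Sum>k. ennreal (real k powr (1 + c) * pmf p k * (((1 + x) / 2) ^ k * indicator {0..<1} x)))"
    proof (cases "0 \<le> x \<and> x < 1")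
      case True
      then have "ennreal (tail_moment p c ((1 + x) / 2)) =
          (\<Sum>k. ennreal (real k powr (1 + c) * pmf p k * ((1 + x) / 2) ^ k))"
        unfolding tail_moment_def by (intro ennreal_suminf summable_tail_moment) auto
      then show ?thesis using True by (simp add: half_moment_def)
    qed (auto simp: half_moment_def)
  qed
  also have "\<dots> = (\<Sum>k. \<integral>\<^sup>+x. ennreal (real k powr (1 + c) * pmf p k * (((1 + x) / 2) ^ k * indicator {0..<1} x)) \<partial>\<mu>)"
    by (rule nn_integral_suminf) measurable
  also have "\<dots> \<le> (\<Sum>k. ennreal (C * A * real k powr (1 + c - \<beta> - g)))"
  proof (intro suminf_le summableI)
    fix k :: nat
    show "(\<integral>\<^sup>+x. ennreal (real k powr (1 + c) * pmf p k * (((1 + x) / 2) ^ k * indicator {0..<1} x)) \<partial>\<mu>) \<le>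
        ennreal (C * A * real k powr (1 + c - \<beta> - g))"
    proof (cases "k = 0")
      case False
      then have k: "1 \<le> k" by simp
      have "(\<integral>\<^sup>+x. ennreal (real k powr (1 + c) * pmf p k * (((1 + x) / 2) ^ k * indicator {0..<1} x)) \<partial>\<mu>) =
        ennreal (real k powr (1 + c) * pmf p k) * (\<integral>\<^sup>+x. ennreal (((1 + x) / 2) ^ k * indicator {0..<1} x) \<partial>\<mu>)"
        by (subst nn_integral_cmult[symmetric]) (auto simp: ennreal_mult' intro!: nn_integral_cong)
      also have "\<dots> \<le> ennreal (real k powr (1 + c) * (C * real k powr (- \<beta>))) * ennreal (A * real k powr (- g))"
        using A(2)[OF k] C[OF k] by (intro mult_mono ennreal_leI mult_left_mono) auto
      also have "\<dots> = ennreal (real k powr (1 + c) * (C * real k powr (- \<beta>)) * (A * real k powr (- g)))"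
        using C0 A by (subst ennreal_mult) auto
      also have "real k powr (1 + c) * (C * real k powr (- \<beta>)) * (A * real k powr (- g)) =
          C * A * real k powr (1 + c - \<beta> - g)"
        using k by (simp add: powr_add powr_diff powr_minus field_simps)
      finally show ?thesis .
    qed simp
  qed
  also have "\<dots> = ennreal (\<Sum>k. C * A * real k powr (1 + c - \<beta> - g))"
    using g C0 A by (intro ennreal_suminf[symmetric] summable_mult) (auto simp: summable_real_powr_iff)
  also have "\<dots> < \<infinity>" by simp
  finally show ?thesis
    by (intro integrableI_nonneg) (auto simp: half_moment_nonneg)
qed

text \<open>Pointwise, the true mean lies between the truncated mean and the truncated mean plus an
  integrable error of order K to the power - c. This replaces the critical density by the integral
  of a bounded continuous function, with an explicit error.\<close>

lemma critical_density_approx: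
  assumes int: "integrable \<mu> (half_moment p c)" and c: "0 < c" and p: "0 < pmf p 0"
  shows "critical_density \<mu> p < \<infinity>"
    and "1 \<le> K \<Longrightarrow> \<bar>(\<integral>x. trunc_mean p K x \<partial>\<mu>) - enn2real (critical_density \<mu> p)\<bar> \<le>
      real K powr (- c) * (\<integral>x. half_moment p c x \<partial>\<mu>) / pmf p 0"
proof -
  \<comment> \<open>The integrand of the critical density, set to 0 outside [0, 1), a null set; this
    avoids the derivative at the endpoint 1.\<close>
  define g where "g x = (if 0 \<le> x \<and> x < 1 then (\<Sum>k. real k * pmf p k * x ^ k) / genfun p x else 0)" for x
  have [measurable]: "g \<in> borel_measurable borel" unfolding g_def[abs_def] by measurable
  have gb: "trunc_mean p K x \<le> g x" "g x \<le> trunc_mean p K x + real K powr (- c) * half_moment p c x / pmf p 0"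
    if x: "0 \<le> x \<and> x < 1" and K: "1 \<le> K" for x K
  proof -
    have gf: "pmf p 0 \<le> genfun p x" using x by (intro genfun_ge) auto
    then have gf0: "0 < genfun p x" using p by simp
    have b: "(\<Sum>k\<le>K. real k * pmf p k * x ^ k) \<le> (\<Sum>k. real k * pmf p k * x ^ k)"
      "(\<Sum>k. real k * pmf p k * x ^ k) \<le>
           (\<Sum>k\<le>K. real k * pmf p k * x ^ k) + real K powr (- c) * tail_moment p c x"
      using mean_series_tail_bounds[of x K c p] x K c by auto
    show "trunc_mean p K x \<le> g x"
      unfolding trunc_mean_def g_def using b(1) gf0 x by (simp add: divide_right_mono)
    have "g x \<le> trunc_mean p K x + real K powr (- c) * tail_moment p c x / genfun p x"
      unfolding trunc_mean_def g_def using b(2) gf0 x by (simp add: divide_right_mono flip: add_divide_distrib)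
    also have "real K powr (- c) * tail_moment p c x / genfun p x \<le> real K powr (- c) * half_moment p c x / pmf p 0"
    proof (rule frac_le[OF _ _ p gf])
      show "0 \<le> real K powr (- c) * half_moment p c x" by (simp add: half_moment_nonneg)
      show "real K powr (- c) * tail_moment p c x \<le> real K powr (- c) * half_moment p c x"
        using tail_moment_mono[of x "(1 + x) / 2" p c] x by (auto simp: half_moment_def intro!: mult_left_mono)
    qed
    finally show "g x \<le> trunc_mean p K x + real K powr (- c) * half_moment p c x / pmf p 0" by simp
  qed
  have tmi: "integrable \<mu> (trunc_mean p K)" for K
    by (rule integrable_const_bound[of _ "real K"])
       (use AE_unit in eventually_elim, use trunc_mean_bounds[OF p, of _ K] in fastforce, measurable)
  have g0: "0 \<le> g x" for x
    using gb(1)[of x 1] trunc_mean_bounds(1)[OF p, of x 1] by (cases "0 \<le> x \<and> x < 1") (auto simp: g_def)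
  have gi: "integrable \<mu> g"
  proof (rule Bochner_Integration.integrable_bound)
    show "integrable \<mu> (\<lambda>x. trunc_mean p 1 x + real 1 powr (- c) * half_moment p c x / pmf p 0)"
      using tmi int by auto
    show "AE x in \<mu>. norm (g x) \<le> norm (trunc_mean p 1 x + real 1 powr (- c) * half_moment p c x / pmf p 0)"
      using AE_unit
    proof eventually_elim
      case (elim x)
      show ?case using gb(2)[OF elim, of 1] g0[of x] by simp
    qed
  qed measurable
  have "critical_density \<mu> p = (\<integral>\<^sup>+x. ennreal (g x) \<partial>\<mu>)"
    unfolding critical_density_def
  proof (intro nn_integral_cong_AE)
    show "AE x in \<mu>. ennreal (x * deriv (genfun p) x / genfun p x) * indicator {0..1} x = ennreal (g x)"
      using AE_unit by eventually_elim (auto simp: g_def deriv_genfun)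
  qed
  also have "\<dots> = ennreal (\<integral>x. g x \<partial>\<mu>)"
    using gi g0 by (intro nn_integral_eq_integral) auto
  finally have cd: "critical_density \<mu> p = ennreal (\<integral>x. g x \<partial>\<mu>)" .
  then show "critical_density \<mu> p < \<infinity>" by simp
  assume K: "1 \<le> K"
  have "enn2real (critical_density \<mu> p) = (\<integral>x. g x \<partial>\<mu>)"
    using cd g0 by (simp add: integral_nonneg_AE)
  moreover have "(\<integral>x. trunc_mean p K x \<partial>\<mu>) \<le> (\<integral>x. g x \<partial>\<mu>)"
    by (rule integral_mono_AE[OF tmi gi]) (use AE_unit in eventually_elim, use gb(1) K in auto)
  moreover have "(\<integral>x. g x \<partial>\<mu>) \<le> (\<integral>x. trunc_mean p K x + real K powr (- c) * half_moment p c x / pmf p 0 \<partial>\<mu>)"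
    by (rule integral_mono_AE[OF gi]) (use tmi int in simp, use AE_unit in eventually_elim, use gb(2) K in auto)
  moreover have "\<dots> = (\<integral>x. trunc_mean p K x \<partial>\<mu>) + real K powr (- c) * (\<integral>x. half_moment p c x \<partial>\<mu>) / pmf p 0"
    using tmi int by simp
  ultimately show "\<bar>(\<integral>x. trunc_mean p K x \<partial>\<mu>) - enn2real (critical_density \<mu> p)\<bar> \<le>
      real K powr (- c) * (\<integral>x. half_moment p c x \<partial>\<mu>) / pmf p 0"
    by linarith
qed

end

section \<open>Typical fitness samples\<close>

context fitness_law
begin

abbreviation sample :: "nat \<Rightarrow> (nat \<Rightarrow> real) measure" where
  "sample n \<equiv> (\<Pi>\<^sub>M i\<in>{1..n}. \<mu>)"

lemma prob_space_sample: "prob_space (sample n)"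
  by (intro prob_space_PiM) unfold_locales

lemma measurable_sample_component:
  assumes "f \<in> borel_measurable borel" "i \<in> {1..n}"
  shows "(\<lambda>x. f (x i)) \<in> borel_measurable (sample n)"
proof -
  have "(\<lambda>x. x i) \<in> measurable (sample n) borel"
    using measurable_component_singleton[OF assms(2), of "\<lambda>_. \<mu>"]
    by (simp add: measurable_cong_sets[OF refl sets_law])
  then show ?thesis using assms(1) by (rule measurable_compose)
qed

lemma measurable_sample_sum:
  fixes f :: "real \<Rightarrow> real"
  assumes "f \<in> borel_measurable borel"
  shows "(\<lambda>x. \<Sum>i=1..n. f (x i)) \<in> borel_measurable (sample n)"
  by (rule borel_measurable_sum) (rule measurable_sample_component[OF assms])

lemma distr_sample_component: "i \<in> {1..n} \<Longrightarrow> distr (sample n) \<mu> (\<lambda>x. x i) = \<mu>"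
  by (rule distr_PiM_component[of "{1..n}" "\<lambda>_. \<mu>"]) unfold_locales

lemma sample_component:
  fixes f :: "real \<Rightarrow> real"
  assumes f: "integrable \<mu> f" and i: "i \<in> {1..n}"
  shows "integrable (sample n) (\<lambda>x. f (x i))" "(\<integral>x. f (x i) \<partial>sample n) = (\<integral>x. f x \<partial>\<mu>)"
proof -
  have m: "(\<lambda>x. x i) \<in> measurable (sample n) \<mu>" using i by (rule measurable_component_singleton)
  show "integrable (sample n) (\<lambda>x. f (x i))"
    using integrable_distr[OF m, of f] f unfolding distr_sample_component[OF i] by blast
  show "(\<integral>x. f (x i) \<partial>sample n) = (\<integral>x. f x \<partial>\<mu>)"
    using integral_distr[OF m, of f] f unfolding distr_sample_component[OF i] by simp
qed

lemma sample_sum_markov: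
  assumes f: "integrable \<mu> f" "f \<in> borel_measurable borel" "\<And>x. 0 \<le> f x" and a: "0 < a"
  shows "measure (sample n) {x \<in> space (sample n). a < (\<Sum>i=1..n. f (x i))} \<le> n * (\<integral>x. f x \<partial>\<mu>) / a"
proof -
  interpret P: prob_space "sample n" by (rule prob_space_sample)
  note m = measurable_sample_sum[OF f(2), of n, measurable]
  have "P.prob {x \<in> space (sample n). a < (\<Sum>i=1..n. f (x i))} \<le> P.prob {x \<in> space (sample n). a \<le> (\<Sum>i=1..n. f (x i))}"
  proof (rule P.finite_measure_mono)
    show "{x \<in> space (sample n). a \<le> (\<Sum>i=1..n. f (x i))} \<in> P.events" by measurable
  qed auto
  also have "\<dots> \<le> (\<integral>x. (\<Sum>i=1..n. f (x i)) \<partial>sample n) / a"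
    by (rule integral_Markov_inequality_measure[where A = "{}"])
       (use f a sample_component(1)[OF f(1)] in \<open>auto intro!: sum_nonneg\<close>)
  also have "(\<integral>x. (\<Sum>i=1..n. f (x i)) \<partial>sample n) = (\<Sum>i=1..n. \<integral>x. f x \<partial>\<mu>)"
    using sample_component[OF f(1)] by simp
  finally show ?thesis by simp
qed

lemma sample_sum_hoeffding:
  assumes h: "h \<in> borel_measurable borel" "AE x in \<mu>. 0 \<le> h x \<and> h x \<le> b" and b: "0 < b"
    and \<eta>: "0 < \<eta>" and n: "1 \<le> n"
  shows "measure (sample n) {x \<in> space (sample n). \<eta> * n < \<bar>(\<Sum>i=1..n. h (x i)) - n * (\<integral>x. h x \<partial>\<mu>)\<bar>} \<le>
    2 * exp (- 2 * real n * \<eta>\<^sup>2 / b\<^sup>2)"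
proof -
  interpret P: prob_space "sample n" by (rule prob_space_sample)
  have m: "(\<lambda>x. x i) \<in> measurable (sample n) \<mu>" if "i \<in> {1..n}" for i
    using that by (rule measurable_component_singleton)
  have "P.indep_vars (\<lambda>_. \<mu>) (\<lambda>i x. x i) {1..n}"
  proof (subst P.indep_vars_iff_distr_eq_PiM')
    have "distr (sample n) (sample n) (\<lambda>x. \<lambda>i\<in>{1..n}. x i) = distr (sample n) (sample n) (\<lambda>x. x)"
      by (intro distr_cong refl) (auto simp: space_PiM PiE_def extensional_restrict)
    also have "\<dots> = sample n" by simp
    also have "\<dots> = (\<Pi>\<^sub>M i\<in>{1..n}. distr (sample n) \<mu> (\<lambda>x. x i))"
      by (intro PiM_cong refl distr_sample_component[symmetric])
    finally show "distr (sample n) (sample n) (\<lambda>x. \<lambda>i\<in>{1..n}. x i) =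
      (\<Pi>\<^sub>M i\<in>{1..n}. distr (sample n) \<mu> (\<lambda>x. x i))" .
  qed (use m n in auto)
  then have indep: "P.indep_vars (\<lambda>_. borel) (\<lambda>i x. h (x i)) {1..n}"
    by (rule P.indep_vars_compose2) (use h(1) in \<open>simp add: measurable_cong_sets[OF sets_law refl]\<close>)
  have AEh: "AE x in sample n. h (x i) \<in> {0..b}" if "i \<in> {1..n}" for i
    by (rule AE_PiM_component) (use that h(2) prob_space_axioms in auto)
  have hb: "integrable \<mu> h"
    by (rule integrable_const_bound[of _ b])
       (use h(2) in eventually_elim, use h(1) in \<open>auto simp: measurable_cong_sets[OF sets_law refl]\<close>)
  have sum_h: "n * (\<integral>x. h x \<partial>\<mu>) = (\<Sum>i=1..n. \<integral>x. h (x i) \<partial>sample n)"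
    using sample_component(2)[OF hb] by simp
  interpret H: Hoeffding_ineq "sample n" "{1..n}" "\<lambda>i x. h (x i)" "\<lambda>_. 0" "\<lambda>_. b"
    "n * (\<integral>x. h x \<partial>\<mu>)"
    by unfold_locales (use indep AEh sum_h in auto)
  have "P.prob {x \<in> space (sample n). \<eta> * n < \<bar>(\<Sum>i=1..n. h (x i)) - n * (\<integral>x. h x \<partial>\<mu>)\<bar>} \<le>
    P.prob {x \<in> space (sample n). \<eta> * n \<le> \<bar>(\<Sum>i=1..n. h (x i)) - n * (\<integral>x. h x \<partial>\<mu>)\<bar>}"
  proof (rule P.finite_measure_mono)
    note m = measurable_sample_sum[OF h(1), of n, measurable]
    show "{x \<in> space (sample n). \<eta> * n \<le> \<bar>(\<Sum>i=1..n. h (x i)) - n * (\<integral>x. h x \<partial>\<mu>)\<bar>} \<in> P.events" by measurable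
  qed auto
  also have "\<dots> \<le> 2 * exp (- 2 * (\<eta> * n)\<^sup>2 / (\<Sum>i=1..n. (b - 0)\<^sup>2))"
    by (rule H.Hoeffding_ineq_abs_ge) (use \<eta> b n in auto)
  also have "- 2 * (\<eta> * n)\<^sup>2 / (\<Sum>i=1..n. (b - 0)\<^sup>2) = - 2 * real n * \<eta>\<^sup>2 / b\<^sup>2"
    using n by (simp add: power2_eq_square)
  finally show ?thesis .
qed

text \<open>With y = n to the power - d, divided by 2, independence gives at most (1 - c
  y^\<gamma>)^n \<le> exp (- c n y^\<gamma>), and n y^\<gamma> is of order n to the power 1 - d
  \<gamma>, which diverges.\<close>

lemma sample_max_small:
  assumes d: "d * \<gamma> < 1" "0 < d"
  shows "(\<lambda>n. measure (sample n) {x \<in> space (sample n). \<forall>i\<in>{1..n}. x i < 1 - real n powr (- d) / 2}) \<longlonglongrightarrow> 0"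
proof -
  obtain c where c: "0 < c" "\<And>y. 0 < y \<Longrightarrow> y \<le> 1 \<Longrightarrow> c * y powr \<gamma> \<le> prob {1 - y..1}"
    using tail_bounds by metis
  define c' where "c' = c / 2 powr \<gamma>"
  have c': "0 < c'" using c by (simp add: c'_def)
  define e where "e = 1 - d * \<gamma>"
  have e: "0 < e" using d by (simp add: e_def)
  have lim: "(\<lambda>n. exp (- c' * real n powr e)) \<longlonglongrightarrow> 0"
    using c' e by real_asymp
  have le: "measure (sample n) {x \<in> space (sample n). \<forall>i\<in>{1..n}. x i < 1 - real n powr (- d) / 2} \<le>
      exp (- c' * real n powr e)" if n: "1 \<le> n" for n
  proof -
    interpret F: finite_product_prob_space "\<lambda>_. \<mu>" "{1..n}"
      by unfold_locales auto
    define y where "y = real n powr (- d) / 2"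
    have "real n powr (- d) \<le> 1"
      using n d ge_one_powr_ge_zero[of "real n" d] by (simp add: powr_minus field_simps)
    then have y: "0 < y" "y \<le> 1" using n by (auto simp: y_def)
    have "prob {..<1 - y} + prob {1 - y..1} = prob ({..<1 - y} \<union> {1 - y..1})"
      by (intro finite_measure_Union[symmetric]) (auto simp: sets_law)
    also have "\<dots> \<le> 1" by simp
    finally have "prob {..<1 - y} \<le> 1 - c * y powr \<gamma>" using c(2)[OF y] by simp
    also have "\<dots> \<le> exp (- c * y powr \<gamma>)" using exp_ge_add_one_self[of "- c * y powr \<gamma>"] by simp
    finally have pr: "prob {..<1 - y} \<le> exp (- c * y powr \<gamma>)" .
    have "{x \<in> space (sample n). \<forall>i\<in>{1..n}. x i < 1 - y} = (\<Pi>\<^sub>E i\<in>{1..n}. {..<1 - y})"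
      using sets_eq_imp_space_eq[OF sets_law] by (auto simp: space_PiM PiE_iff extensional_def)
    then have "measure (sample n) {x \<in> space (sample n). \<forall>i\<in>{1..n}. x i < 1 - y} = prob {..<1 - y} ^ n"
      using F.prob_times[of "\<lambda>_. {..<1 - y}"] by (simp add: sets_law)
    also have "\<dots> \<le> exp (- c * y powr \<gamma>) ^ n"
      by (intro power_mono pr) simp
    also have "\<dots> = exp (- c' * real n powr e)"
      using n by (simp add: exp_of_nat_mult[symmetric] y_def c'_def e_def powr_divide powr_mult powr_powr powr_diff
          powr_minus field_simps)
    finally show ?thesis by (simp add: y_def)
  qed
  show ?thesis
    by (rule tendsto_sandwich[OF _ eventually_mono[OF eventually_ge_at_top[of 1] le] tendsto_const lim])
       auto
qed

text \<open>The expected count is at most of order n to the power 1 - d \<gamma>; Markov's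
  inequality gains the positive exponent a - (1 - d \<gamma>).\<close>

lemma sample_near_one_count:
  assumes d: "0 < d" and a: "1 - d * \<gamma> < a"
  shows "(\<lambda>n. measure (sample n) {x \<in> space (sample n).
     real n powr a < real (card {i \<in> {1..n}. 1 - real n powr (- d) \<le> x i})}) \<longlonglongrightarrow> 0"
proof -
  obtain C where C: "0 < C" "\<And>y. 0 < y \<Longrightarrow> y \<le> 1 \<Longrightarrow> prob {1 - y..1} \<le> C * y powr \<gamma>"
    using tail_bounds by metis
  define e where "e = a - (1 - d * \<gamma>)"
  have e: "0 < e" using a by (simp add: e_def)
  have lim: "(\<lambda>n. C * real n powr (- e)) \<longlonglongrightarrow> 0"
    using C e by real_asymp
  have le: "measure (sample n) {x \<in> space (sample n).
     real n powr a < real (card {i \<in> {1..n}. 1 - real n powr (- d) \<le> x i})} \<le> C * real n powr (- e)"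
    if n: "1 \<le> n" for n
  proof -
    define y where "y = real n powr (- d)"
    have y: "0 < y" "y \<le> 1"
      using n d ge_one_powr_ge_zero[of "real n" d] by (auto simp: y_def powr_minus field_simps)
    define f where "f = (indicator {1 - y..} :: real \<Rightarrow> real)"
    have f: "integrable \<mu> f" "f \<in> borel_measurable borel" "\<And>x. 0 \<le> f x"
      by (auto simp: f_def sets_law emeasure_eq_measure)
    have "real (card {i \<in> {1..n}. 1 - y \<le> x i}) = (\<Sum>i=1..n. f (x i))" for x :: "nat \<Rightarrow> real"
      by (simp add: f_def indicator_def sum.If_cases Int_def conj_commute)
    then have "measure (sample n) {x \<in> space (sample n). real n powr a < real (card {i \<in> {1..n}. 1 - y \<le> x i})} \<le>
        n * (\<integral>x. f x \<partial>\<mu>) / real n powr a"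
      using sample_sum_markov[OF f, of "real n powr a" n] n by simp
    also have "(\<integral>x. f x \<partial>\<mu>) = prob {1 - y..}"
      by (simp add: f_def sets_law sets_eq_imp_space_eq[OF sets_law])
    also have "\<dots> = prob {1 - y..1}"
      using AE_unit by (intro finite_measure_eq_AE) (auto simp: sets_law elim: eventually_mono)
    also have "\<dots> \<le> C * y powr \<gamma>" using C(2)[OF y] .
    also have "y powr \<gamma> = real n powr (- (d * \<gamma>))"
      by (simp add: y_def powr_powr)
    also have "real n * (C * real n powr (- (d * \<gamma>))) / real n powr a = C * real n powr (- e)"
      using n by (simp add: e_def powr_diff powr_add powr_minus field_simps)
    finally show ?thesis
      by (simp add: y_def divide_right_mono mult_left_mono)
  qed
  show ?thesis
    by (rule tendsto_sandwich[OF _ eventually_mono[OF eventually_ge_at_top[of 1] le] tendsto_const lim])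
       auto
qed

text \<open>The second clause puts the maximum within half the width of the near zone of the third
  clause. This gap is what keeps the sites outside the zone away from 1 after division by the
  maximum.\<close>

definition typical :: "nat pmf \<Rightarrow> real \<Rightarrow> real \<Rightarrow> real \<Rightarrow> real \<Rightarrow> nat \<Rightarrow> real \<Rightarrow> nat \<Rightarrow> (nat \<Rightarrow> real) \<Rightarrow> bool" where
  "typical p d a c L K \<eta> n x \<longleftrightarrow>
     (\<forall>i\<in>{1..n}. 0 \<le> x i \<and> x i < 1) \<and>
     \<not> (\<forall>i\<in>{1..n}. x i < 1 - real n powr (- d) / 2) \<and>
     real (card {i \<in> {1..n}. 1 - real n powr (- d) \<le> x i}) \<le> real n powr a \<and>
     (\<Sum>i=1..n. half_moment p c (x i)) \<le> L * n \<and>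
     \<bar>(\<Sum>i=1..n. trunc_mean p K (x i)) - n * (\<integral>x. trunc_mean p K x \<partial>\<mu>)\<bar> \<le> \<eta> * n"

text \<open>The complement is a union of five events. The first is null, and three have vanishing
  probability; the one on the moment sum is only bounded by Markov's inequality, uniformly in n.
  Hence L must be chosen large in terms of \<epsilon>.\<close>

lemma
  assumes p: "0 < pmf p 0" and d: "0 < d" "d * \<gamma> < 1" and a: "1 - d * \<gamma> < a" and K: "1 \<le> K" and \<eta>: "0 < \<eta>"
    and int: "integrable \<mu> (half_moment p c)" and L: "0 < L" "(\<integral>x. half_moment p c x \<partial>\<mu>) < L * \<epsilon>"
  shows sets_not_typical: "{x \<in> space (sample n). \<not> typical p d a c L K \<eta> n x} \<in> sets (sample n)"
    and eventually_typical: "eventually (\<lambda>n. measure (sample n) {x \<in> space (sample n). \<not> typical p d a c L K \<eta> n x} \<le> \<epsilon>) sequentially"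
proof -
  define B1 where "B1 n = {x \<in> space (sample n). \<not> (\<forall>i\<in>{1..n}. 0 \<le> x i \<and> x i < 1)}" for n
  define B2 where "B2 n = {x \<in> space (sample n). \<forall>i\<in>{1..n}. x i < 1 - real n powr (- d) / 2}" for n
  define B3 where "B3 n = {x \<in> space (sample n). real n powr a < real (card {i \<in> {1..n}. 1 - real n powr (- d) \<le> x i})}" for n
  define B4 where "B4 n = {x \<in> space (sample n). L * n < (\<Sum>i=1..n. half_moment p c (x i))}" for n
  define B5 where "B5 n = {x \<in> space (sample n). \<eta> * n < \<bar>(\<Sum>i=1..n. trunc_mean p K (x i)) - n * (\<integral>x. trunc_mean p K x \<partial>\<mu>)\<bar>}" for n
  have un: "{x \<in> space (sample n). \<not> typical p d a c L K \<eta> n x} = B1 n \<union> B2 n \<union> B3 n \<union> B4 n \<union> B5 n" for n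
    unfolding typical_def B1_def B2_def B3_def B4_def B5_def de_Morgan_conj not_not not_le
    by (simp only: Collect_disj_eq[symmetric] conj_disj_distribL disj_assoc)
  have m: "i \<in> {1..n} \<Longrightarrow> (\<lambda>x. x i) \<in> borel_measurable (sample n)" for i n
    by (rule measurable_sample_component) auto
  have s1: "B1 n \<in> sets (sample n)" for n
    unfolding B1_def
    by (rule sets.sets_Collect_neg, rule sets.sets_Collect_finite_All, rule sets.sets_Collect_conj)
       (auto intro!: borel_measurable_le borel_measurable_less m simp del: One_nat_def)
  have s2: "B2 n \<in> sets (sample n)" for n
    unfolding B2_def
    by (rule sets.sets_Collect_finite_All) (auto intro!: borel_measurable_less m simp del: One_nat_def)
  have s45: "B4 n \<in> sets (sample n)" "B5 n \<in> sets (sample n)" for n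
    unfolding B4_def B5_def
    by (rule borel_measurable_less borel_measurable_const borel_measurable_abs borel_measurable_diff
        measurable_sample_sum borel_measurable_half_moment borel_measurable_trunc_mean)+
  have s3: "B3 n \<in> sets (sample n)" for n
  proof -
    have "real (card {i \<in> {1..n}. 1 - real n powr (- d) \<le> x i}) = (\<Sum>i=1..n. indicator {1 - real n powr (- d)..} (x i))" for x :: "nat \<Rightarrow> real"
      by (simp add: indicator_def sum.If_cases Int_def conj_commute)
    then show ?thesis
      unfolding B3_def by (simp only:) (intro borel_measurable_less borel_measurable_const measurable_sample_sum
          borel_measurable_indicator, simp)
  qed
  note s = s1 s2 s3 s45
  show "{x \<in> space (sample n). \<not> typical p d a c L K \<eta> n x} \<in> sets (sample n)"
    unfolding un using s by auto
  have b1: "measure (sample n) (B1 n) = 0" for n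
  proof -
    have "AE x in sample n. \<forall>i\<in>{1..n}. 0 \<le> x i \<and> x i < 1"
      by (intro eventually_ball_finite ballI AE_PiM_component AE_unit prob_space_axioms) auto
    then have "AE x in sample n. x \<notin> B1 n" by eventually_elim (auto simp: B1_def)
    then have "emeasure (sample n) (B1 n) = 0"
      using s AE_iff_measurable[of "B1 n" "sample n" "\<lambda>x. x \<notin> B1 n"]
      by (auto simp: sets.sets_into_space B1_def)
    then show ?thesis by (simp add: measure_def)
  qed
  have b4: "measure (sample n) (B4 n) \<le> (\<integral>x. half_moment p c x \<partial>\<mu>) / L" if n: "1 \<le> n" for n
    using sample_sum_markov[OF int borel_measurable_half_moment half_moment_nonneg, of "L * n" n] n L
    by (simp add: B4_def)
  have b5: "measure (sample n) (B5 n) \<le> 2 * exp (- 2 * real n * \<eta>\<^sup>2 / (real K)\<^sup>2)" if n: "1 \<le> n" for n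
    unfolding B5_def
  proof (rule sample_sum_hoeffding)
    show "AE x in \<mu>. 0 \<le> trunc_mean p K x \<and> trunc_mean p K x \<le> real K"
      using AE_unit by eventually_elim (use trunc_mean_bounds[OF p, of _ K] in auto)
  qed (use n \<eta> K in auto)
  have "(\<lambda>n. 2 * exp (- 2 * real n * \<eta>\<^sup>2 / (real K)\<^sup>2)) \<longlonglongrightarrow> 0"
    using \<eta> K by real_asymp
  then have lim: "(\<lambda>n. measure (sample n) (B2 n) + measure (sample n) (B3 n) + (\<integral>x. half_moment p c x \<partial>\<mu>) / L +
      2 * exp (- 2 * real n * \<eta>\<^sup>2 / (real K)\<^sup>2)) \<longlonglongrightarrow> 0 + 0 + (\<integral>x. half_moment p c x \<partial>\<mu>) / L + 0"
    unfolding B2_def B3_def by (intro tendsto_add tendsto_const sample_max_small sample_near_one_count d a)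
  have "eventually (\<lambda>n. measure (sample n) (B2 n) + measure (sample n) (B3 n) + (\<integral>x. half_moment p c x \<partial>\<mu>) / L +
      2 * exp (- 2 * real n * \<eta>\<^sup>2 / (real K)\<^sup>2) < \<epsilon>) sequentially"
    by (rule order_tendstoD(2)[OF lim]) (use L in \<open>simp add: field_simps\<close>)
  then show "eventually (\<lambda>n. measure (sample n) {x \<in> space (sample n). \<not> typical p d a c L K \<eta> n x} \<le> \<epsilon>) sequentially"
    using eventually_ge_at_top[of 1]
  proof eventually_elim
    case (elim n)
    interpret P: prob_space "sample n" by (rule prob_space_sample)
    have "P.prob (B1 n \<union> B2 n \<union> B3 n \<union> B4 n \<union> B5 n) \<le>
      P.prob (B1 n) + P.prob (B2 n) + P.prob (B3 n) + P.prob (B4 n) + P.prob (B5 n)"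
      by (intro order.trans[OF measure_Un_le] add_mono order.refl) (use s in auto)
    then show ?case
      unfolding un using b1[of n] b4[of n] b5[of n] elim by linarith
  qed
qed

end

section \<open>Deviation bounds in a rescaled environment\<close>

lemma prod_one_minus_ge:
  fixes b :: "'a \<Rightarrow> real"
  assumes "finite I" "\<And>i. i \<in> I \<Longrightarrow> 0 \<le> b i \<and> b i \<le> 1"
  shows "1 - (\<Sum>i\<in>I. b i) \<le> (\<Prod>i\<in>I. 1 - b i)"
  using assms
proof (induction I rule: finite_induct)
  case (insert j I)
  have "0 \<le> (\<Prod>i\<in>I. 1 - b i)" "(\<Prod>i\<in>I. 1 - b i) \<le> 1"
    using insert.prems by (auto intro!: prod_nonneg prod_le_1)
  then have "b j * (\<Prod>i\<in>I. 1 - b i) \<le> b j * 1"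
    using insert.prems by (intro mult_left_mono) auto
  then show ?case
    using insert by (simp add: left_diff_distrib)
qed simp

lemma exp_minus_one_le: "exp x - 1 \<le> x * exp x" for x :: real
proof -
  have "(1 - x) * exp x \<le> exp (- x) * exp x"
    using exp_ge_add_one_self[of "- x"] by (intro mult_right_mono) auto
  then show ?thesis by (simp add: algebra_simps flip: exp_add)
qed

lemma exp_neg_le_quadratic:
  fixes x :: real
  assumes "0 \<le> x"
  shows "exp (- x) - 1 \<le> - x + x\<^sup>2 / 2"
proof -
  \<comment> \<open>This factorisation converts the quadratic Taylor lower bound for exp x into an
    upper bound for exp (- x).\<close>
  have "1 \<le> 1 + x ^ 4 / 4" by simp
  also have "\<dots> = (1 - x + x\<^sup>2 / 2) * (1 + x + x\<^sup>2 / 2)"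
    by (simp add: algebra_simps power2_eq_square power4_eq_xxxx)
  also have "\<dots> \<le> (1 - x + x\<^sup>2 / 2) * exp x"
  proof (rule mult_left_mono)
    show "1 + x + x\<^sup>2 / 2 \<le> exp x" using assms by (rule exp_lower_Taylor_quadratic)
    have "0 \<le> (1 - x)\<^sup>2 + 1" by simp
    then show "0 \<le> 1 - x + x\<^sup>2 / 2" by (simp add: power2_eq_square algebra_simps)
  qed
  finally have "1 * exp (- x) \<le> (1 - x + x\<^sup>2 / 2) * exp x * exp (- x)"
    by (rule mult_right_mono) simp
  then show ?thesis by (simp add: mult.assoc flip: exp_add)
qed

lemma le_powr_ratio:
  fixes y k c :: real
  assumes "0 < y" "y \<le> k" "0 \<le> c"
  shows "k \<le> y powr (- c) * k powr (1 + c)"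
proof -
  have "1 \<le> (k / y) powr c" using assms by (intro ge_one_powr_ge_zero) auto
  then have "k * 1 \<le> k * (k / y) powr c" using assms by (intro mult_left_mono) auto
  then show ?thesis using assms by (simp add: powr_divide powr_add powr_minus field_simps)
qed

text \<open>Markov's inequality of order 1 + e. Summability is a hypothesis so that two regimes are
  covered: e = c for z < 1, and e = s - 1 up to z = 1.\<close>

lemma genfun_tail_le:
  assumes z: "0 \<le> z" "z \<le> 1" and e: "-1 < e" and l: "1 \<le> l"
    and s: "summable (\<lambda>k. real k powr (1 + e) * pmf p k * z ^ k)"
  shows "genfun p z - (\<Sum>k\<le>l. pmf p k * z ^ k) \<le> real l powr (- (1 + e)) * tail_moment p e z"
proof -
  note sg = summable_genfun[OF z, of p]
  have "genfun p z - (\<Sum>k\<le>l. pmf p k * z ^ k) = (\<Sum>k. pmf p (k + Suc l) * z ^ (k + Suc l))"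
    unfolding genfun_def suminf_split_initial_segment[OF sg, of "Suc l"] by (simp add: lessThan_Suc_atMost)
  also have "\<dots> \<le> (\<Sum>k. real l powr (- (1 + e)) * (real (k + Suc l) powr (1 + e) * pmf p (k + Suc l) * z ^ (k + Suc l)))"
  proof (rule suminf_le)
    show "summable (\<lambda>k. pmf p (k + Suc l) * z ^ (k + Suc l))"
      by (subst summable_iff_shift) (rule sg)
    show "summable (\<lambda>k. real l powr (- (1 + e)) * (real (k + Suc l) powr (1 + e) * pmf p (k + Suc l) * z ^ (k + Suc l)))"
      by (intro summable_mult) (subst summable_iff_shift, rule s)
    fix k
    have "1 \<le> (real (k + Suc l) / real l) powr (1 + e)"
      using l e by (intro ge_one_powr_ge_zero) auto
    also have "\<dots> = real l powr (- (1 + e)) * real (k + Suc l) powr (1 + e)"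
      unfolding powr_minus[of "real l" "1 + e"] by (simp add: powr_divide field_simps)
    finally have "1 * (pmf p (k + Suc l) * z ^ (k + Suc l)) \<le>
       (real l powr (- (1 + e)) * real (k + Suc l) powr (1 + e)) * (pmf p (k + Suc l) * z ^ (k + Suc l))"
      by (rule mult_right_mono) (use z in auto)
    then show "pmf p (k + Suc l) * z ^ (k + Suc l) \<le>
        real l powr (- (1 + e)) * (real (k + Suc l) powr (1 + e) * pmf p (k + Suc l) * z ^ (k + Suc l))"
      by (simp only: mult.assoc mult_1)
  qed
  also have "\<dots> = real l powr (- (1 + e)) * (\<Sum>k. real (k + Suc l) powr (1 + e) * pmf p (k + Suc l) * z ^ (k + Suc l))"
    by (rule suminf_mult) (subst summable_iff_shift, rule s)
  also have "(\<Sum>k. real (k + Suc l) powr (1 + e) * pmf p (k + Suc l) * z ^ (k + Suc l)) \<le> tail_moment p e z"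
    unfolding tail_moment_def suminf_split_initial_segment[OF s, of "Suc l"]
    using z by (simp add: sum_nonneg del: sum.lessThan_Suc)
  finally show ?thesis by (simp add: mult_left_mono)
qed

text \<open>The value above the level is 0 rather than l: the sum of the cuts is the content of the
  sites not exceeding l, and the remainder of the total sits in the large sites.\<close>

definition cut :: "nat \<Rightarrow> nat \<Rightarrow> real" where
  "cut l k = (if k \<le> l then real k else 0)"

text \<open>
  Fitnesses rescaled such that the largest one, at site \<open>M\<close>, equals 1; \<open>H\<close> is the set of the few
  sites whose fitness is close to it.
\<close>

locale rescaled_env =
  fixes p :: "nat pmf" and n :: nat and r :: "nat \<Rightarrow> real" and H :: "nat set" and M :: nat
    and s c L h \<eta> \<theta> :: real and K :: nat
  assumes p0: "0 < pmf p 0"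
    and r_nonneg: "i \<in> {1..n} \<Longrightarrow> 0 \<le> r i" and r_le_1: "i \<in> {1..n} \<Longrightarrow> r i \<le> 1" and rM: "r M = 1"
    and MH: "M \<in> H" and H: "H \<subseteq> {1..n}"
    and off: "i \<in> {1..n} \<Longrightarrow> i \<notin> H \<Longrightarrow> r i \<le> \<theta>" and \<theta>: "0 \<le> \<theta>" "\<theta> < 1"
    and card_H: "real (card H) \<le> real n powr (s - c)"
    and moment: "(\<Sum>i\<in>{1..n} - H. tail_moment p c (r i)) \<le> L * n"
    and mean: "\<bar>(\<Sum>i=1..n. trunc_mean p K (r i)) - n * h\<bar> \<le> \<eta> * n"
    and s: "0 < s" "s < 1" and c: "0 < c" and K: "1 \<le> K"
    and summable_s: "summable (\<lambda>k. real k powr s * pmf p k)"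
begin

definition a :: "nat \<Rightarrow> nat \<Rightarrow> real" where "a i k = pmf p k * r i ^ k"

text \<open>The moment of order s of \<open>p\<close> itself. It dominates the moment of every
  tilted weight, including those of the sites in H, whose moments of order 1 + c may be
  infinite.\<close>

definition D :: real where "D = tail_moment p (s - 1) 1"

abbreviation \<Phi> :: "nat \<Rightarrow> real" where "\<Phi> i \<equiv> genfun p (r i)"

lemma n_pos: "1 \<le> n" using MH H by auto

lemma off_lt_1: "i \<in> {1..n} \<Longrightarrow> i \<notin> H \<Longrightarrow> r i < 1"
  using off \<theta> by fastforce

lemma a_nonneg: "i \<in> {1..n} \<Longrightarrow> 0 \<le> a i k"
  using r_nonneg by (auto simp: a_def)

lemma \<Phi>_ge: "i \<in> {1..n} \<Longrightarrow> pmf p 0 \<le> \<Phi> i"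
  using r_nonneg r_le_1 by (intro genfun_ge) auto

lemma \<Phi>_pos: "i \<in> {1..n} \<Longrightarrow> 0 < \<Phi> i"
  using \<Phi>_ge p0 by fastforce

lemma sum_a_le: "i \<in> {1..n} \<Longrightarrow> (\<Sum>k\<le>m. a i k) \<le> \<Phi> i"
  unfolding genfun_def a_def
  by (intro sum_le_suminf summable_genfun) (use r_nonneg r_le_1 in auto)

lemma sum_a_K: "i \<in> {1..n} \<Longrightarrow> (\<Sum>k\<le>K. real k * a i k) = trunc_mean p K (r i) * \<Phi> i"
  using \<Phi>_pos[of i] by (simp add: trunc_mean_def a_def mult.assoc)

lemma summable_D: "0 \<le> z \<Longrightarrow> z \<le> 1 \<Longrightarrow> summable (\<lambda>k. real k powr (1 + (s - 1)) * pmf p k * z ^ k)"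
proof (rule summable_comparison_test'[OF summable_s, of 0])
  fix k assume z: "0 \<le> z" "z \<le> 1"
  then have "(real k powr s * pmf p k) * z ^ k \<le> (real k powr s * pmf p k) * 1"
    by (intro mult_left_mono power_le_one) auto
  then show "norm (real k powr (1 + (s - 1)) * pmf p k * z ^ k) \<le> real k powr s * pmf p k"
    using z by simp
qed

lemma D_nonneg: "0 \<le> D"
  unfolding D_def tail_moment_def by (intro suminf_nonneg summable_D) auto

lemma tail_moment_le_D: "0 \<le> z \<Longrightarrow> z \<le> 1 \<Longrightarrow> tail_moment p (s - 1) z \<le> D"
  unfolding D_def tail_moment_def
proof (intro suminf_le summable_D)
  fix k assume z: "0 \<le> z" "z \<le> 1"
  then show "real k powr (1 + (s - 1)) * pmf p k * z ^ k \<le> real k powr (1 + (s - 1)) * pmf p k * 1 ^ k"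
    by (intro mult_left_mono power_mono) auto
qed auto

lemma moment_nonneg: "i \<in> {1..n} - H \<Longrightarrow> 0 \<le> tail_moment p c (r i)"
  using r_nonneg off_lt_1 by (intro tail_moment_nonneg) auto

lemma L_nonneg: "0 \<le> L"
proof -
  have "0 \<le> (\<Sum>i\<in>{1..n} - H. tail_moment p c (r i))" by (intro sum_nonneg moment_nonneg)
  then have "0 \<le> L * n" using moment by linarith
  then show ?thesis using n_pos by (simp add: zero_le_mult_iff)
qed

text \<open>Bound for the Chernoff exponent, divided by t n. Its terms come from contents up to K,
  from K to v and from v to l at sites outside H, and from the sites in H. In the application exp (t
  l) is a small power of n; the powers of v, l and n next to it make the last two terms vanish, and
  the second is small through K.\<close>

definition growth :: "real \<Rightarrow> real \<Rightarrow> nat \<Rightarrow> real" where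
  "growth t v l = exp (t * K) * (h + \<eta>) +
     ((exp (t * v) * real K powr (- c) + exp (t * l) * v powr (- c)) * L +
      real n powr (s - c - 1) * (exp (t * l) * real l powr (1 - s) * D)) / pmf p 0"

text \<open>By exp y - 1 \<le> y exp y it suffices to bound k exp (t k). Up to K this is a multiple
  of the truncated mean. Beyond K, the moment of order 1 + c gains K to the power - c while exp (t
  k) is at most exp (t v), and beyond v it gains v to the power - c against the larger exp (t
  l).\<close>

lemma exponent_site_off:
  assumes i: "i \<in> {1..n}" "i \<notin> H" and t: "0 \<le> t" and v: "0 < v"
  shows "(\<Sum>k\<le>m. a i k * (exp (t * cut l k) - 1)) \<le>
    t * (exp (t * K) * (\<Sum>k\<le>K. real k * a i k) +
      (exp (t * v) * real K powr (- c) + exp (t * l) * v powr (- c)) * tail_moment p c (r i))"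
proof -
  define E where "E = exp (t * v) * real K powr (- c) + exp (t * l) * v powr (- c)"
  have E: "0 \<le> E" by (simp add: E_def)
  have ri: "0 \<le> r i" "r i < 1" using r_nonneg off_lt_1 i by auto
  have pt: "exp (t * cut l k) - 1 \<le> t * (exp (t * K) * cut K k + E * real k powr (1 + c))" for k
  proof (cases "k \<le> l")
    case kl: True
    have "exp (t * k) - 1 \<le> t * (k * exp (t * k))"
      using exp_minus_one_le[of "t * k"] by simp
    also have "\<dots> \<le> t * (exp (t * K) * cut K k + E * real k powr (1 + c))"
    proof (rule mult_left_mono[OF _ t])
      consider "k \<le> K" | "K < k" "real k \<le> v" | "K < k" "v < real k" by linarith
      then show "k * exp (t * k) \<le> exp (t * K) * cut K k + E * real k powr (1 + c)"
      proof cases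
        case 1
        have "k * exp (t * k) \<le> exp (t * K) * cut K k"
          using 1 t by (auto simp: cut_def mult.commute intro!: mult_left_mono)
        then show ?thesis using E by (simp add: add_increasing2)
      next
        case 2
        have "k * exp (t * k) \<le> (real K powr (- c) * real k powr (1 + c)) * exp (t * v)"
          by (intro mult_mono le_powr_ratio) (use 2 K c t in \<open>auto intro!: mult_left_mono\<close>)
        also have "\<dots> \<le> E * real k powr (1 + c)"
          by (simp add: E_def algebra_simps)
        finally show ?thesis using 2 by (simp add: cut_def)
      next
        case 3
        have "k * exp (t * k) \<le> (v powr (- c) * real k powr (1 + c)) * exp (t * l)"
          by (intro mult_mono le_powr_ratio) (use 3 v c t kl in \<open>auto intro!: mult_left_mono\<close>)
        also have "\<dots> \<le> E * real k powr (1 + c)"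
          by (simp add: E_def algebra_simps)
        finally show ?thesis using 3 by (simp add: cut_def)
      qed
    qed
    finally show ?thesis using kl by (simp add: cut_def)
  next
    case False
    then show ?thesis using t E by (auto simp: cut_def)
  qed
  have "(\<Sum>k\<le>m. a i k * (exp (t * cut l k) - 1)) \<le>
      (\<Sum>k\<le>m. a i k * (t * (exp (t * K) * cut K k + E * real k powr (1 + c))))"
    by (intro sum_mono mult_left_mono pt a_nonneg i)
  also have "\<dots> = t * (exp (t * K) * (\<Sum>k\<le>m. cut K k * a i k) + E * (\<Sum>k\<le>m. real k powr (1 + c) * pmf p k * r i ^ k))"
    by (simp add: a_def sum_distrib_left sum.distrib algebra_simps)
  also have "\<dots> \<le> t * (exp (t * K) * (\<Sum>k\<le>K. real k * a i k) + E * tail_moment p c (r i))"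
  proof (intro mult_left_mono add_mono t E sum_le_tail_moment ri)
    have "(\<Sum>k\<le>m. cut K k * a i k) = (\<Sum>k\<le>m. if k \<in> {..K} then real k * a i k else 0)"
      by (intro sum.cong) (auto simp: cut_def)
    also have "\<dots> = (\<Sum>k\<in>{..m} \<inter> {..K}. real k * a i k)"
      by (rule sum.inter_restrict[symmetric]) simp
    also have "\<dots> \<le> (\<Sum>k\<le>K. real k * a i k)"
      using a_nonneg[OF i(1)] by (intro sum_mono2) auto
    finally show "(\<Sum>k\<le>m. cut K k * a i k) \<le> (\<Sum>k\<le>K. real k * a i k)" .
  qed auto
  finally show ?thesis by (simp add: E_def)
qed

text \<open>Only the moment of order s is available here, so k \<le> l is written as a product of
  powers of orders 1 - s and s, and the first is bounded by its value at l. The loss is compensated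
  by the small number of such sites.\<close>

lemma exponent_site_near:
  assumes i: "i \<in> {1..n}" and t: "0 \<le> t"
  shows "(\<Sum>k\<le>m. a i k * (exp (t * cut l k) - 1)) \<le> t * (exp (t * l) * real l powr (1 - s) * D)"
proof -
  have ri: "0 \<le> r i" "r i \<le> 1" using r_nonneg r_le_1 i by auto
  have pt: "exp (t * cut l k) - 1 \<le> t * (exp (t * l) * real l powr (1 - s) * real k powr s)" for k
  proof (cases "k \<le> l \<and> 1 \<le> k")
    case True
    have "exp (t * k) - 1 \<le> t * (k * exp (t * k))"
      using exp_minus_one_le[of "t * k"] by simp
    also have "\<dots> \<le> t * ((real l powr (1 - s) * real k powr s) * exp (t * l))"
    proof (intro mult_left_mono[OF _ t] mult_mono)
      have "real k = real k powr (1 - s) * real k powr s" using True by (simp flip: powr_add)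
      also have "\<dots> \<le> real l powr (1 - s) * real k powr s"
        using True s by (intro mult_right_mono powr_mono2) auto
      finally show "real k \<le> real l powr (1 - s) * real k powr s" .
    qed (use True t in \<open>auto intro!: mult_left_mono\<close>)
    finally show ?thesis using True by (simp add: cut_def mult_ac)
  next
    case False
    then have "cut l k = 0" by (auto simp: cut_def)
    then show ?thesis using t by simp
  qed
  have "(\<Sum>k\<le>m. a i k * (exp (t * cut l k) - 1)) \<le>
      (\<Sum>k\<le>m. a i k * (t * (exp (t * l) * real l powr (1 - s) * real k powr s)))"
    by (intro sum_mono mult_left_mono pt a_nonneg i)
  also have "\<dots> = t * (exp (t * l) * real l powr (1 - s) * (\<Sum>k\<le>m. real k powr (1 + (s - 1)) * pmf p k * r i ^ k))"
    by (simp add: a_def sum_distrib_left algebra_simps)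
  also have "(\<Sum>k\<le>m. real k powr (1 + (s - 1)) * pmf p k * r i ^ k) \<le> tail_moment p (s - 1) (r i)"
    unfolding tail_moment_def by (intro sum_le_suminf summable_D ri) (use ri in auto)
  also have "\<dots> \<le> D" using ri by (rule tail_moment_le_D)
  finally show ?thesis using t by (simp add: mult_left_mono)
qed

text \<open>All summands are nonnegative, so the bound for all sites serves every subset; it is
  applied to all sites and to all sites except M.\<close>

lemma exponent_le:
  assumes I: "I \<subseteq> {1..n}" and t: "0 \<le> t" and v: "0 < v"
  shows "(\<Sum>i\<in>I. (\<Sum>k\<le>m. a i k * (exp (t * cut l k) - 1)) / \<Phi> i) \<le> t * n * growth t v l"
proof -
  define E where "E = exp (t * v) * real K powr (- c) + exp (t * l) * v powr (- c)"
  define W where "W = exp (t * l) * real l powr (1 - s) * D"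
  have E: "0 \<le> E" and W: "0 \<le> W" using D_nonneg by (auto simp: E_def W_def)
  have tm: "0 \<le> trunc_mean p K (r i)" if "i \<in> {1..n}" for i
    using trunc_mean_bounds(1)[OF p0] r_nonneg r_le_1 that by auto
  define w where "w i = (if i \<in> H then W else E * tail_moment p c (r i))" for i
  have w: "0 \<le> w i" if "i \<in> {1..n}" for i
    using that W E moment_nonneg[of i] by (auto simp: w_def)
  have cutnn: "0 \<le> cut l k" for k by (simp add: cut_def)
  have "(\<Sum>i\<in>I. (\<Sum>k\<le>m. a i k * (exp (t * cut l k) - 1)) / \<Phi> i) \<le>
      (\<Sum>i\<in>{1..n}. (\<Sum>k\<le>m. a i k * (exp (t * cut l k) - 1)) / \<Phi> i)"
    by (intro sum_mono2) (use I \<Phi>_pos a_nonneg t cutnn in \<open>auto intro!: divide_nonneg_pos sum_nonneg mult_nonneg_nonneg\<close>)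
  also have "\<dots> \<le> (\<Sum>i\<in>{1..n}. t * (exp (t * K) * trunc_mean p K (r i) + w i / pmf p 0))"
  proof (rule sum_mono)
    fix i assume i: "i \<in> {1..n}"
    have "(\<Sum>k\<le>m. a i k * (exp (t * cut l k) - 1)) \<le> t * (exp (t * K) * (trunc_mean p K (r i) * \<Phi> i) + w i)"
    proof (cases "i \<in> H")
      case True
      have "(\<Sum>k\<le>m. a i k * (exp (t * cut l k) - 1)) \<le> t * w i"
        using exponent_site_near[OF i t, where m = m and l = l] True by (simp add: w_def W_def)
      also have "\<dots> \<le> t * (exp (t * K) * (trunc_mean p K (r i) * \<Phi> i) + w i)"
        using t tm[OF i] \<Phi>_pos[OF i] by (intro mult_left_mono) auto
      finally show ?thesis .
    next
      case False
      then show ?thesis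
        using exponent_site_off[OF i False t v, where m = m and l = l] sum_a_K[OF i] by (simp add: w_def E_def)
    qed
    then have "(\<Sum>k\<le>m. a i k * (exp (t * cut l k) - 1)) / \<Phi> i \<le>
        t * (exp (t * K) * (trunc_mean p K (r i) * \<Phi> i) + w i) / \<Phi> i"
      using \<Phi>_pos[OF i] by (intro divide_right_mono) auto
    also have "\<dots> = t * (exp (t * K) * trunc_mean p K (r i) + w i / \<Phi> i)"
      using \<Phi>_pos[OF i] by (simp add: field_simps)
    also have "\<dots> \<le> t * (exp (t * K) * trunc_mean p K (r i) + w i / pmf p 0)"
      using \<Phi>_ge[OF i] p0 w[OF i] t by (intro mult_left_mono add_left_mono divide_left_mono) auto
    finally show "(\<Sum>k\<le>m. a i k * (exp (t * cut l k) - 1)) / \<Phi> i \<le>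
      t * (exp (t * K) * trunc_mean p K (r i) + w i / pmf p 0)" .
  qed
  also have "\<dots> = t * (exp (t * K) * (\<Sum>i=1..n. trunc_mean p K (r i)) + (\<Sum>i=1..n. w i) / pmf p 0)"
    by (simp add: sum_distrib_left sum.distrib sum_divide_distrib algebra_simps)
  also have "(\<Sum>i=1..n. w i) = (\<Sum>i\<in>H. w i) + (\<Sum>i\<in>{1..n} - H. w i)"
    using H by (simp add: sum.subset_diff add.commute)
  also have "(\<Sum>i\<in>H. w i) = card H * W" by (simp add: w_def)
  also have "(\<Sum>i\<in>{1..n} - H. w i) = E * (\<Sum>i\<in>{1..n} - H. tail_moment p c (r i))"
    by (simp add: w_def sum_distrib_left)
  also have "t * (exp (t * K) * (\<Sum>i=1..n. trunc_mean p K (r i)) +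
      (card H * W + E * (\<Sum>i\<in>{1..n} - H. tail_moment p c (r i))) / pmf p 0) \<le>
      t * (exp (t * K) * (n * (h + \<eta>)) + (real n powr (s - c) * W + E * (L * n)) / pmf p 0)"
  proof (intro mult_left_mono add_mono divide_right_mono mult_right_mono)
    show "(\<Sum>i=1..n. trunc_mean p K (r i)) \<le> n * (h + \<eta>)"
      using mean by (simp add: algebra_simps)
  qed (use t E W moment card_H p0 in auto)
  also have "real n powr (s - c) = n * real n powr (s - c - 1)"
    using n_pos by (simp add: powr_diff)
  also have "t * (exp (t * K) * (n * (h + \<eta>)) + (n * real n powr (s - c - 1) * W + E * (L * n)) / pmf p 0) =
      t * n * growth t v l"
    by (simp add: growth_def E_def W_def field_simps)
  finally show ?thesis .
qed

lemma weight_eq: "weight p n r q = (\<Prod>i=1..n. a i (q i))"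
  by (simp add: weight_def a_def mult.commute)

text \<open>The constraint on the total content is dropped and the sum extended to a product set.
  The price of this appears only on division by the partition function.\<close>

lemma upper_deviation:
  assumes t: "0 \<le> t" and v: "0 < v"
  shows "(\<Sum>q | q \<in> configs m n \<and> B \<le> (\<Sum>i=1..n. cut l (q i)). weight p n r q) \<le>
    (\<Prod>i=1..n. \<Phi> i) * exp (- t * B + t * n * growth t v l)"
proof -
  have fin: "finite ({1..n} \<rightarrow>\<^sub>E {..m})" by (intro finite_PiE) auto
  have "(\<Sum>q | q \<in> configs m n \<and> B \<le> (\<Sum>i=1..n. cut l (q i)). weight p n r q) \<le>
    (\<Sum>q | q \<in> {1..n} \<rightarrow>\<^sub>E {..m} \<and> B \<le> (\<Sum>i=1..n. cut l (q i)). weight p n r q)"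
    by (intro sum_mono2 weight_nonneg r_nonneg)
       (use configs_subset_PiE fin in \<open>auto intro: finite_subset[OF _ fin]\<close>)
  also have "\<dots> \<le> (\<Prod>i=1..n. \<Phi> i) *
      exp (- t * B + (\<Sum>i=1..n. (\<Sum>k\<le>m. a i k * (exp (t * cut l k) - 1)) / \<Phi> i))"
    unfolding weight_eq by (intro chernoff_bound a_nonneg \<Phi>_pos sum_a_le t) auto
  also have "\<dots> \<le> (\<Prod>i=1..n. \<Phi> i) * exp (- t * B + t * n * growth t v l)"
    using exponent_le[of "{1..n}" t v, where m = m and l = l] t v \<Phi>_pos
    by (intro mult_left_mono prod_nonneg) (auto simp: less_imp_le)
  finally show ?thesis .
qed

text \<open>Cutting at the fixed level K suffices from below and gives bounded summands, so the
  exponent is linear in t up to an error of order \<open>t\<^sup>2 * (real K)\<^sup>2\<close>. A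
  constant tilt then yields exponential decay in n.\<close>

lemma lower_deviation:
  assumes t: "0 \<le> t" and Km: "K \<le> m"
  shows "(\<Sum>q | q \<in> configs m n \<and> (\<Sum>i=1..n. cut K (q i)) \<le> B. weight p n r q) \<le>
    (\<Prod>i=1..n. \<Phi> i) * exp (t * B - t * n * (h - \<eta>) + t\<^sup>2 * (real K)\<^sup>2 / 2 * n)"
proof -
  have fin: "finite ({1..n} \<rightarrow>\<^sub>E {..m})" by (intro finite_PiE) auto
  have "(\<Sum>q | q \<in> configs m n \<and> (\<Sum>i=1..n. cut K (q i)) \<le> B. weight p n r q) \<le>
    (\<Sum>q | q \<in> {1..n} \<rightarrow>\<^sub>E {..m} \<and> - B \<le> (\<Sum>i=1..n. - cut K (q i)). weight p n r q)"
    by (intro sum_mono2 weight_nonneg r_nonneg)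
       (use configs_subset_PiE fin in \<open>auto intro: finite_subset[OF _ fin] simp: sum_negf\<close>)
  also have "\<dots> \<le> (\<Prod>i=1..n. \<Phi> i) *
      exp (- t * - B + (\<Sum>i=1..n. (\<Sum>k\<le>m. a i k * (exp (t * - cut K k) - 1)) / \<Phi> i))"
    unfolding weight_eq by (intro chernoff_bound a_nonneg \<Phi>_pos sum_a_le t) auto
  also have "\<dots> \<le> (\<Prod>i=1..n. \<Phi> i) * exp (t * B - t * n * (h - \<eta>) + t\<^sup>2 * (real K)\<^sup>2 / 2 * n)"
  proof (intro mult_left_mono prod_nonneg)
    have site: "(\<Sum>k\<le>m. a i k * (exp (t * - cut K k) - 1)) / \<Phi> i \<le>
        - t * trunc_mean p K (r i) + t\<^sup>2 * (real K)\<^sup>2 / 2" if i: "i \<in> {1..n}" for i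
    proof -
      have "(\<Sum>k\<le>m. a i k * (exp (t * - cut K k) - 1)) \<le>
          (\<Sum>k\<le>m. a i k * (- t * cut K k + t\<^sup>2 * (real K)\<^sup>2 / 2))"
      proof (intro sum_mono mult_left_mono a_nonneg i)
        fix k
        have ck: "0 \<le> cut K k" "cut K k \<le> K" by (auto simp: cut_def)
        have "exp (- (t * cut K k)) - 1 \<le> - (t * cut K k) + (t * cut K k)\<^sup>2 / 2"
          using t ck by (intro exp_neg_le_quadratic) auto
        also have "(t * cut K k)\<^sup>2 \<le> (t * real K)\<^sup>2"
          using t ck by (intro power_mono mult_left_mono) auto
        finally show "exp (t * - cut K k) - 1 \<le> - t * cut K k + t\<^sup>2 * (real K)\<^sup>2 / 2"
          by (simp add: power_mult_distrib)
      qed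
      also have "\<dots> = - t * (\<Sum>k\<le>m. cut K k * a i k) + t\<^sup>2 * (real K)\<^sup>2 / 2 * (\<Sum>k\<le>m. a i k)"
        by (simp add: sum_distrib_left sum.distrib algebra_simps sum_subtractf sum_negf sum_divide_distrib)
      also have "(\<Sum>k\<le>m. cut K k * a i k) = (\<Sum>k\<le>K. cut K k * a i k)"
        using Km by (intro sum.mono_neutral_right) (auto simp: cut_def)
      also have "\<dots> = trunc_mean p K (r i) * \<Phi> i"
        unfolding sum_a_K[OF i, symmetric] by (intro sum.cong) (auto simp: cut_def)
      also have "- t * (trunc_mean p K (r i) * \<Phi> i) + t\<^sup>2 * (real K)\<^sup>2 / 2 * (\<Sum>k\<le>m. a i k) \<le>
          - t * (trunc_mean p K (r i) * \<Phi> i) + t\<^sup>2 * (real K)\<^sup>2 / 2 * \<Phi> i"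
        using sum_a_le[OF i] by (intro add_left_mono mult_left_mono) auto
      also have "\<dots> = (- t * trunc_mean p K (r i) + t\<^sup>2 * (real K)\<^sup>2 / 2) * \<Phi> i"
        by (simp only: distrib_right mult.assoc)
      finally show ?thesis
        by (simp only: pos_divide_le_eq[OF \<Phi>_pos[OF i]])
    qed
    have "(\<Sum>i=1..n. (\<Sum>k\<le>m. a i k * (exp (t * - cut K k) - 1)) / \<Phi> i) \<le>
        (\<Sum>i=1..n. - t * trunc_mean p K (r i) + t\<^sup>2 * (real K)\<^sup>2 / 2)"
      by (intro sum_mono site)
    also have "\<dots> = - t * (\<Sum>i=1..n. trunc_mean p K (r i)) + t\<^sup>2 * (real K)\<^sup>2 / 2 * n"
      by (simp add: sum.distrib sum_distrib_left sum_negf sum_subtractf)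
    also have "- t * (\<Sum>i=1..n. trunc_mean p K (r i)) \<le> - t * (n * (h - \<eta>))"
    proof -
      have "t * (n * (h - \<eta>)) \<le> t * (\<Sum>i=1..n. trunc_mean p K (r i))"
        using mean t by (intro mult_left_mono) (auto simp: algebra_simps)
      then show ?thesis by simp
    qed
    finally show "exp (- t * - B + (\<Sum>i=1..n. (\<Sum>k\<le>m. a i k * (exp (t * - cut K k) - 1)) / \<Phi> i)) \<le>
        exp (t * B - t * n * (h - \<eta>) + t\<^sup>2 * (real K)\<^sup>2 / 2 * n)"
      by (simp add: algebra_simps)
  qed (use \<Phi>_pos in \<open>auto simp: less_imp_le\<close>)
  finally show ?thesis .
qed

text \<open>Bound for the expected number of sites with content above l under the normalised product
  weights: Markov's inequality of order s on H and of order 1 + c elsewhere.\<close>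

definition large_prob :: "nat \<Rightarrow> real" where
  "large_prob l = (real n powr (s - c) * real l powr (- s) * D + n * L * real l powr (- (1 + c))) / pmf p 0"

text \<open>A union bound in product form: each factor is \<open>\<Phi> i\<close> times one minus
  the probability that the site exceeds l, and the sum of these probabilities is at most
  \<open>large_prob l\<close>.\<close>

lemma truncated_product_ge:
  assumes I: "I \<subseteq> {1..n}" and l: "1 \<le> l"
  shows "(\<Prod>i\<in>I. \<Phi> i) * (1 - large_prob l) \<le> (\<Prod>i\<in>I. \<Sum>k\<le>l. a i k)"
proof -
  have fI: "finite I" using I by (rule finite_subset) auto
  define b where "b i = 1 - (\<Sum>k\<le>l. a i k) / \<Phi> i" for i
  have b: "0 \<le> b i \<and> b i \<le> 1" if "i \<in> {1..n}" for i
    using sum_a_le[OF that, of l] \<Phi>_pos[OF that] a_nonneg[OF that] by (auto simp: b_def intro!: divide_nonneg_pos sum_nonneg)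
  define w where "w i = (if i \<in> H then real l powr (- s) * D else real l powr (- (1 + c)) * tail_moment p c (r i))" for i
  have bw: "b i \<le> w i / pmf p 0" if i: "i \<in> {1..n}" for i
  proof -
    have ri: "0 \<le> r i" "r i \<le> 1" using r_nonneg r_le_1 i by auto
    have "\<Phi> i - (\<Sum>k\<le>l. a i k) \<le> w i"
    proof (cases "i \<in> H")
      case True
      have "\<Phi> i - (\<Sum>k\<le>l. a i k) \<le> real l powr (- (1 + (s - 1))) * tail_moment p (s - 1) (r i)"
        unfolding a_def by (intro genfun_tail_le summable_D ri l) (use s in auto)
      also have "\<dots> \<le> real l powr (- (1 + (s - 1))) * D"
        by (intro mult_left_mono tail_moment_le_D ri) auto
      finally show ?thesis using True by (simp add: w_def)
    next
      case False
      have "\<Phi> i - (\<Sum>k\<le>l. a i k) \<le> real l powr (- (1 + c)) * tail_moment p c (r i)"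
        unfolding a_def by (intro genfun_tail_le summable_tail_moment ri l off_lt_1 i False) (use c in auto)
      then show ?thesis using False by (simp add: w_def)
    qed
    moreover have "b i * \<Phi> i = \<Phi> i - (\<Sum>k\<le>l. a i k)"
      using \<Phi>_pos[OF i] by (simp add: b_def field_simps)
    moreover have "b i * pmf p 0 \<le> b i * \<Phi> i"
      using b[OF i] \<Phi>_ge[OF i] by (intro mult_left_mono) auto
    ultimately show ?thesis using p0 by (simp add: le_divide_eq)
  qed
  have w0: "0 \<le> w i" if "i \<in> {1..n}" for i
    using that D_nonneg moment_nonneg[of i] by (auto simp: w_def)
  have "(\<Sum>i\<in>I. b i) \<le> (\<Sum>i\<in>I. w i / pmf p 0)" using I by (intro sum_mono bw) auto
  also have "\<dots> \<le> (\<Sum>i=1..n. w i / pmf p 0)"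
    using I w0 by (intro sum_mono2) auto
  also have "\<dots> = ((\<Sum>i\<in>H. w i) + (\<Sum>i\<in>{1..n} - H. w i)) / pmf p 0"
    using H by (simp add: sum.subset_diff[of H] sum_divide_distrib[symmetric] add.commute)
  also have "\<dots> = (card H * (real l powr (- s) * D) + real l powr (- (1 + c)) * (\<Sum>i\<in>{1..n} - H. tail_moment p c (r i))) / pmf p 0"
    by (simp add: w_def sum_distrib_left)
  also have "\<dots> \<le> (real n powr (s - c) * (real l powr (- s) * D) + real l powr (- (1 + c)) * (L * n)) / pmf p 0"
    using card_H moment D_nonneg p0 by (intro divide_right_mono add_mono mult_left_mono mult_right_mono) auto
  also have "\<dots> = large_prob l" by (simp add: large_prob_def mult_ac)
  finally have "1 - large_prob l \<le> 1 - (\<Sum>i\<in>I. b i)" by simp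
  also have "\<dots> \<le> (\<Prod>i\<in>I. 1 - b i)"
    using fI I b by (intro prod_one_minus_ge) auto
  finally have "(\<Prod>i\<in>I. \<Phi> i) * (1 - large_prob l) \<le> (\<Prod>i\<in>I. \<Phi> i) * (\<Prod>i\<in>I. 1 - b i)"
    using I \<Phi>_pos by (intro mult_left_mono prod_nonneg) (auto simp: less_imp_le subset_iff)
  also have "\<dots> = (\<Prod>i\<in>I. \<Sum>k\<le>l. a i k)"
    unfolding prod.distrib[symmetric]
  proof (intro prod.cong refl)
    fix i assume "i \<in> I"
    then have "\<Phi> i \<noteq> 0" using \<Phi>_pos[of i] I by auto
    then show "\<Phi> i * (1 - b i) = (\<Sum>k\<le>l. a i k)" by (simp add: b_def)
  qed
  finally show ?thesis .
qed

text \<open>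
  Site \<open>M\<close> absorbs the excess over a typical total content of the other sites, at the cost of a
  single factor \<open>pmf p\<close>.
\<close>

lemma partition_fun_ge:
  assumes t: "0 \<le> t" and v: "0 < v" and l: "1 \<le> l" and \<pi>: "0 \<le> \<pi>"
    and B: "\<And>S. real S \<le> B \<Longrightarrow> S \<le> m \<and> \<pi> \<le> pmf p (m - S)"
  shows "\<pi> * (\<Prod>i=1..n. \<Phi> i) * (1 - large_prob l - exp (- t * B + t * n * growth t v l)) \<le> partition_fun p m n r"
proof -
  define I where "I = {1..n} - {M}"
  have M: "M \<in> {1..n}" using MH H by auto
  have I: "I \<subseteq> {1..n}" "finite I" by (auto simp: I_def)
  define S where "S = {q \<in> I \<rightarrow>\<^sub>E {..l}. real (\<Sum>i\<in>I. q i) \<le> B}"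
  have fP: "finite (I \<rightarrow>\<^sub>E {..l})" using I by (intro finite_PiE) auto
  have fS: "finite S" using fP by (simp add: S_def)
  \<comment> \<open>Site M receives whatever is missing to the total m. The configuration of the
    other sites determines the result, so no weight is counted twice.\<close>
  define g where "g = (\<lambda>q::nat \<Rightarrow> nat. q(M := m - (\<Sum>i\<in>I. q i)))"
  have pr: "0 \<le> (\<Prod>i\<in>I. a i (q i))" for q :: "nat \<Rightarrow> nat"
    using I by (intro prod_nonneg a_nonneg) auto
  have inj: "inj_on g S"
  proof (rule inj_onI)
    fix q q' assume qq: "q \<in> S" "q' \<in> S" and eq: "g q = g q'"
    have "q i = q' i" for i
    proof (cases "i = M")
      case True
      then show ?thesis using qq PiE_arb[of q I "\<lambda>_. {..l}" M] PiE_arb[of q' I "\<lambda>_. {..l}" M]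
        by (auto simp: S_def I_def)
    next
      case False
      then show ?thesis using fun_cong[OF eq, of i] by (simp add: g_def)
    qed
    then show "q = q'" by auto
  qed
  have gS: "g q \<in> configs m n" if "q \<in> S" for q
  proof -
    have le: "(\<Sum>i\<in>I. q i) \<le> m" using that B by (auto simp: S_def)
    have "(\<Sum>i\<in>{1..n}. g q i) = g q M + (\<Sum>i\<in>I. g q i)"
      unfolding I_def using M by (intro sum.remove) auto
    also have "(\<Sum>i\<in>I. g q i) = (\<Sum>i\<in>I. q i)" by (intro sum.cong) (auto simp: g_def I_def)
    finally have "(\<Sum>i\<in>{1..n}. g q i) = m" using le by (simp add: g_def)
    moreover have "g q \<in> {1..n} \<rightarrow>\<^sub>E UNIV"
      using that M by (auto simp: S_def g_def PiE_iff extensional_def I_def)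
    ultimately show ?thesis by (simp add: configs_def)
  qed
  have "(\<Prod>i\<in>I. \<Phi> i) * (1 - large_prob l) \<le> (\<Prod>i\<in>I. \<Sum>k\<le>l. a i k)"
    by (rule truncated_product_ge[OF I(1) l])
  also have "\<dots> = (\<Sum>q\<in>I \<rightarrow>\<^sub>E {..l}. \<Prod>i\<in>I. a i (q i))"
    using I by (intro prod_sum_PiE) auto
  \<comment> \<open>A configuration with all contents at most l either belongs to S or has an
    excessive cut sum; the latter is removed by the Chernoff bound.\<close>
  also have "\<dots> \<le> (\<Sum>q\<in>S \<union> {q. q \<in> I \<rightarrow>\<^sub>E {..l} \<and> B \<le> (\<Sum>i\<in>I. cut l (q i))}. \<Prod>i\<in>I. a i (q i))"
  proof (rule sum_mono2)
    have "real (\<Sum>i\<in>I. q i) = (\<Sum>i\<in>I. cut l (q i))" if "q \<in> I \<rightarrow>\<^sub>E {..l}" for q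
    proof -
      have "cut l (q i) = real (q i)" if "i \<in> I" for i
        using PiE_mem[OF \<open>q \<in> _\<close> that] by (simp add: cut_def)
      then show ?thesis by simp
    qed
    then show "I \<rightarrow>\<^sub>E {..l} \<subseteq> S \<union> {q. q \<in> I \<rightarrow>\<^sub>E {..l} \<and> B \<le> (\<Sum>i\<in>I. cut l (q i))}"
      unfolding S_def by (smt (verit) Un_iff mem_Collect_eq subsetI)
  qed (use fS fP pr in \<open>auto intro: finite_subset[OF _ fP]\<close>)
  also have "\<dots> \<le> (\<Sum>q\<in>S. \<Prod>i\<in>I. a i (q i)) +
      (\<Sum>q | q \<in> I \<rightarrow>\<^sub>E {..l} \<and> B \<le> (\<Sum>i\<in>I. cut l (q i)). \<Prod>i\<in>I. a i (q i))"
  proof -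
    have f2: "finite {q. q \<in> I \<rightarrow>\<^sub>E {..l} \<and> B \<le> (\<Sum>i\<in>I. cut l (q i))}"
      by (rule finite_subset[OF _ fP]) auto
    show ?thesis
      unfolding sum_Un[OF fS f2] using pr by (auto intro!: sum_nonneg)
  qed
  also have "(\<Sum>q | q \<in> I \<rightarrow>\<^sub>E {..l} \<and> B \<le> (\<Sum>i\<in>I. cut l (q i)). \<Prod>i\<in>I. a i (q i)) \<le>
      (\<Prod>i\<in>I. \<Phi> i) * exp (- t * B + (\<Sum>i\<in>I. (\<Sum>k\<le>l. a i k * (exp (t * cut l k) - 1)) / \<Phi> i))"
    using I by (intro chernoff_bound a_nonneg \<Phi>_pos sum_a_le t) auto
  also have "\<dots> \<le> (\<Prod>i\<in>I. \<Phi> i) * exp (- t * B + t * n * growth t v l)"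
    using exponent_le[OF I(1) t v, where m = l and l = l] I \<Phi>_pos
    by (intro mult_left_mono prod_nonneg) (auto simp: less_imp_le subset_iff)
  finally have "(\<Prod>i\<in>I. \<Phi> i) * (1 - large_prob l - exp (- t * B + t * n * growth t v l)) \<le> (\<Sum>q\<in>S. \<Prod>i\<in>I. a i (q i))"
    by (simp add: algebra_simps)
  then have "\<pi> * ((\<Prod>i\<in>I. \<Phi> i) * (1 - large_prob l - exp (- t * B + t * n * growth t v l))) \<le>
      \<pi> * (\<Sum>q\<in>S. \<Prod>i\<in>I. a i (q i))"
    using \<pi> by (rule mult_left_mono)
  also have "\<dots> \<le> (\<Sum>q\<in>S. weight p n r (g q))"
    unfolding sum_distrib_left
  proof (rule sum_mono)
    fix q assume q: "q \<in> S"
    have "weight p n r (g q) = a M (g q M) * (\<Prod>i\<in>I. a i (g q i))"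
      unfolding weight_eq I_def using M by (intro prod.remove) auto
    also have "(\<Prod>i\<in>I. a i (g q i)) = (\<Prod>i\<in>I. a i (q i))"
      by (intro prod.cong) (auto simp: g_def I_def)
    also have "a M (g q M) = pmf p (m - (\<Sum>i\<in>I. q i))" by (simp add: a_def rM g_def)
    finally have "weight p n r (g q) = pmf p (m - (\<Sum>i\<in>I. q i)) * (\<Prod>i\<in>I. a i (q i))" .
    moreover have "\<pi> \<le> pmf p (m - (\<Sum>i\<in>I. q i))" using q B by (auto simp: S_def)
    ultimately show "\<pi> * (\<Prod>i\<in>I. a i (q i)) \<le> weight p n r (g q)"
      using pr by (simp add: mult_right_mono)
  qed
  also have "\<dots> = (\<Sum>q\<in>g ` S. weight p n r q)"
    by (simp add: sum.reindex[OF inj])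
  also have "\<dots> \<le> partition_fun p m n r"
    unfolding partition_fun_def
    by (intro sum_mono2 finite_configs weight_nonneg r_nonneg) (use gS in auto)
  \<comment> \<open>Site M has fitness 1, and \<open>genfun p 1 = 1\<close>, so omitting it leaves
    the product unchanged.\<close>
  also have "(\<Prod>i\<in>I. \<Phi> i) = (\<Prod>i=1..n. \<Phi> i)"
    unfolding I_def using M by (subst (2) prod.remove[of _ M]) (auto simp: rM genfun_one)
  finally show ?thesis by (simp add: mult.assoc)
qed

end

text \<open>The last event uses the fixed level K: for K \<le> l, enough content below K is enough
  content below l, and bounded summands have exponential lower tails.\<close>

definition atypical :: "nat \<Rightarrow> nat \<Rightarrow> nat \<Rightarrow> real \<Rightarrow> real \<Rightarrow> (nat \<Rightarrow> nat) \<Rightarrow> bool" where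
  "atypical n l K u w q \<longleftrightarrow>
     (\<exists>i\<in>{1..n}. \<exists>j\<in>{1..n}. i \<noteq> j \<and> l < q i \<and> l < q j) \<or>
     u \<le> (\<Sum>i=1..n. cut l (q i)) \<or> (\<Sum>i=1..n. cut K (q i)) \<le> w"

context rescaled_env
begin

text \<open>The deviation bounds are relative to the product P of the masses
  \<open>\<Phi> i\<close>, whereas the partition function is at least \<pi> P / 2; hence the factor
  2 / \<pi>. The thresholds leave a margin \<eta> on both sides: h + 5 \<eta> against the growth
  bound h + 4 \<eta>, and h - 2 \<eta> against the mean bound h - \<eta>. The transfer bounds are
  already relative to the partition function.\<close>

lemma atypical_le:
  fixes t v \<tau> \<pi> \<kappa>\<^sub>1 \<kappa>\<^sub>2 :: real
  assumes t: "0 \<le> t" and v: "0 < v" and l: "1 \<le> l" and \<tau>: "0 \<le> \<tau>" and Km: "K \<le> m"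
    and \<eta>: "0 \<le> \<eta>" and \<pi>: "0 < \<pi>" and \<kappa>: "0 \<le> \<kappa>\<^sub>1" "0 \<le> \<kappa>\<^sub>2"
    and growth: "growth t v l \<le> h + 4 * \<eta>" and large: "large_prob l \<le> 1 / 4" and small: "exp (- t * n * \<eta>) \<le> 1 / 4"
    and B: "\<And>S. real S \<le> (h + 5 * \<eta>) * n \<Longrightarrow> S \<le> m \<and> \<pi> \<le> pmf p (m - S)"
    and p1: "\<And>a b. l < b \<Longrightarrow> a + b \<le> m \<Longrightarrow> pmf p a * pmf p b \<le> \<kappa>\<^sub>1 * (pmf p 0 * pmf p (a + b))"
    and p2: "\<And>a b. l < a \<Longrightarrow> l < b \<Longrightarrow> a + b \<le> m \<Longrightarrow> pmf p a * pmf p b \<le> \<kappa>\<^sub>2 * (pmf p 0 * pmf p (a + b))"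
  shows "0 < partition_fun p m n r"
    and "(\<Sum>q | q \<in> configs m n \<and> atypical n l K ((h + 5 * \<eta>) * n) ((h - 2 * \<eta>) * n) q. weight p n r q) \<le>
      (n * (real (m + 1) * \<kappa>\<^sub>1 * \<theta> ^ Suc l) + real n powr (s - c) * (real (m + 1) * \<kappa>\<^sub>2) * (real m / real (Suc l)) +
       2 / \<pi> * exp (- t * n * \<eta>) + 2 / \<pi> * exp (- (\<tau> * \<eta> * n) + \<tau>\<^sup>2 * (real K)\<^sup>2 / 2 * n)) * partition_fun p m n r"
proof -
  define Z where "Z = partition_fun p m n r"
  define P where "P = (\<Prod>i=1..n. \<Phi> i)"
  have P: "0 < P" unfolding P_def by (intro prod_pos) (use \<Phi>_pos in auto)
  have ex: "exp (- t * ((h + 5 * \<eta>) * n) + t * n * growth t v l) \<le> exp (- t * n * \<eta>)"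
  proof -
    have "t * n * growth t v l \<le> t * n * (h + 4 * \<eta>)"
      using t growth by (intro mult_left_mono) auto
    then show ?thesis by (simp add: algebra_simps)
  qed
  have "\<pi> * P * (1 - large_prob l - exp (- t * ((h + 5 * \<eta>) * n) + t * n * growth t v l)) \<le> Z"
    unfolding P_def Z_def by (rule partition_fun_ge[OF t v l _ B]) (use \<pi> in simp)
  moreover have "\<pi> * P * (1 / 2) \<le> \<pi> * P * (1 - large_prob l - exp (- t * ((h + 5 * \<eta>) * n) + t * n * growth t v l))"
    using \<pi> P large small ex by (intro mult_left_mono) (linarith, simp)
  ultimately have ZP: "\<pi> * P \<le> 2 * Z" by simp
  then have Z: "0 < Z" using \<pi> P mult_pos_pos[of \<pi> P] by linarith
  then show "0 < partition_fun p m n r" by (simp add: Z_def)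
  have PZ: "P \<le> 2 / \<pi> * Z" using ZP \<pi> by (simp add: field_simps)
  define S1 where "S1 = {q. q \<in> configs m n \<and> (\<exists>j\<in>{1..n} - H. Suc l \<le> q j)}"
  define S2 where "S2 = {q. q \<in> configs m n \<and> (\<exists>i\<in>H. \<exists>j\<in>H. i \<noteq> j \<and> Suc l \<le> q i \<and> Suc l \<le> q j)}"
  define S3 where "S3 = {q. q \<in> configs m n \<and> (h + 5 * \<eta>) * n \<le> (\<Sum>i=1..n. cut l (q i))}"
  define S4 where "S4 = {q. q \<in> configs m n \<and> (\<Sum>i=1..n. cut K (q i)) \<le> (h - 2 * \<eta>) * n}"
  have fin: "finite S1" "finite S2" "finite S3" "finite S4"
    using finite_configs by (auto simp: S1_def S2_def S3_def S4_def)
  have w: "0 \<le> weight p n r q" for q by (intro weight_nonneg r_nonneg)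
  have sub: "{q. q \<in> configs m n \<and> atypical n l K ((h + 5 * \<eta>) * n) ((h - 2 * \<eta>) * n) q} \<subseteq> S1 \<union> S2 \<union> S3 \<union> S4"
    unfolding atypical_def S1_def S2_def S3_def S4_def Suc_le_eq by blast
  have un: "(\<Sum>q\<in>A \<union> B. weight p n r q) \<le> (\<Sum>q\<in>A. weight p n r q) + (\<Sum>q\<in>B. weight p n r q)"
    if "finite A" "finite B" for A B
    unfolding sum_Un[OF that] using w by (simp add: sum_nonneg)
  have "(\<Sum>q | q \<in> configs m n \<and> atypical n l K ((h + 5 * \<eta>) * n) ((h - 2 * \<eta>) * n) q. weight p n r q) \<le>
      (\<Sum>q\<in>S1 \<union> S2 \<union> S3 \<union> S4. weight p n r q)"
    by (intro sum_mono2 sub w) (use fin in auto)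
  also have "\<dots> \<le> (\<Sum>q\<in>S1. weight p n r q) + (\<Sum>q\<in>S2. weight p n r q) + (\<Sum>q\<in>S3. weight p n r q) + (\<Sum>q\<in>S4. weight p n r q)"
    using un[of "S1 \<union> S2 \<union> S3" S4] un[of "S1 \<union> S2" S3] un[of S1 S2] fin by simp
  also have "(\<Sum>q\<in>S1. weight p n r q) \<le> n * (real (m + 1) * \<kappa>\<^sub>1 * \<theta> ^ Suc l) * Z"
    unfolding S1_def Z_def
    by (rule large_off_sites_bound[where M = M])
       (use r_nonneg MH H off rM \<theta> \<kappa> p1 in \<open>auto simp: Suc_le_eq subset_iff\<close>)
  also have "(\<Sum>q\<in>S2. weight p n r q) \<le> real n powr (s - c) * (real (m + 1) * \<kappa>\<^sub>2) * (real m / real (Suc l)) * Z"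
  proof -
    have "(\<Sum>q\<in>S2. weight p n r q) \<le> real (card H) * (real (m + 1) * \<kappa>\<^sub>2) * (real m / real (Suc l)) * Z"
      unfolding S2_def Z_def
      by (rule two_large_sites_bound) (use r_nonneg H \<kappa> p2 in \<open>auto simp: Suc_le_eq\<close>)
    also have "\<dots> \<le> real n powr (s - c) * (real (m + 1) * \<kappa>\<^sub>2) * (real m / real (Suc l)) * Z"
      using card_H \<kappa> Z by (intro mult_right_mono) auto
    finally show ?thesis .
  qed
  also have "(\<Sum>q\<in>S3. weight p n r q) \<le> 2 / \<pi> * exp (- t * n * \<eta>) * Z"
  proof -
    have "(\<Sum>q\<in>S3. weight p n r q) \<le> P * exp (- t * ((h + 5 * \<eta>) * n) + t * n * growth t v l)"
      unfolding S3_def P_def by (rule upper_deviation[OF t v])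
    also have "\<dots> \<le> (2 / \<pi> * Z) * exp (- t * n * \<eta>)"
      using PZ ex P Z \<pi> by (intro mult_mono) auto
    finally show ?thesis by (simp add: mult_ac)
  qed
  also have "(\<Sum>q\<in>S4. weight p n r q) \<le> 2 / \<pi> * exp (- (\<tau> * \<eta> * n) + \<tau>\<^sup>2 * (real K)\<^sup>2 / 2 * n) * Z"
  proof -
    have "(\<Sum>q\<in>S4. weight p n r q) \<le>
        P * exp (\<tau> * ((h - 2 * \<eta>) * n) - \<tau> * n * (h - \<eta>) + \<tau>\<^sup>2 * (real K)\<^sup>2 / 2 * n)"
      unfolding S4_def P_def by (rule lower_deviation[OF \<tau> Km])
    also have "\<tau> * ((h - 2 * \<eta>) * n) - \<tau> * n * (h - \<eta>) = - (\<tau> * \<eta> * n)"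
      by (simp add: algebra_simps)
    also have "P * exp (- (\<tau> * \<eta> * n) + \<tau>\<^sup>2 * (real K)\<^sup>2 / 2 * n) \<le>
        (2 / \<pi> * Z) * exp (- (\<tau> * \<eta> * n) + \<tau>\<^sup>2 * (real K)\<^sup>2 / 2 * n)"
      using PZ by (intro mult_right_mono) auto
    finally show ?thesis by (simp add: mult_ac)
  qed
  finally show "(\<Sum>q | q \<in> configs m n \<and> atypical n l K ((h + 5 * \<eta>) * n) ((h - 2 * \<eta>) * n) q. weight p n r q) \<le>
      (n * (real (m + 1) * \<kappa>\<^sub>1 * \<theta> ^ Suc l) + real n powr (s - c) * (real (m + 1) * \<kappa>\<^sub>2) * (real m / real (Suc l)) +
       2 / \<pi> * exp (- t * n * \<eta>) + 2 / \<pi> * exp (- (\<tau> * \<eta> * n) + \<tau>\<^sup>2 * (real K)\<^sup>2 / 2 * n)) * partition_fun p m n r"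
    unfolding Z_def distrib_right by linarith
qed

end

text \<open>The environment is quantified inside \<open>eventually\<close>: the index from which the
  bound holds depends on the constants only, so it applies to every typical sample at once.\<close>

lemma eventually_atypical_le:
  fixes m :: "nat \<Rightarrow> nat"
  assumes p0: "0 < pmf p 0" and \<beta>: "1 < \<beta>"
    and C: "0 < C" "\<And>k. 1 \<le> k \<Longrightarrow> pmf p k \<le> C * real k powr (- \<beta>)"
    and c0: "0 < c\<^sub>0" "\<And>k. k\<^sub>0 \<le> k \<Longrightarrow> c\<^sub>0 * real k powr (- \<beta>) \<le> pmf p k"
    and s: "0 < s" "s < 1" "s < \<beta> - 1" and c: "0 < c" and d: "d < 1" and K: "1 \<le> K" and h: "0 \<le> h"
    and \<eta>: "0 < \<eta>" and KL: "real K powr (- c) * L / pmf p 0 < \<eta>" and L: "0 \<le> L"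
    and \<epsilon>: "0 < \<epsilon>" "\<epsilon> \<le> 1" "(\<beta> + 1) / \<eta> * \<epsilon> \<le> c / 4"
    and m: "(\<lambda>n. real (m n) / real n) \<longlonglongrightarrow> \<rho>" and \<rho>: "h + 6 * \<eta> < \<rho>" and \<delta>: "0 < \<delta>"
  shows "eventually (\<lambda>n. \<forall>r H M. rescaled_env p n r H M s c L h \<eta> (1 - real n powr (- d) / 2) K \<longrightarrow>
     0 < partition_fun p (m n) n r \<and>
     (\<Sum>q | q \<in> configs (m n) n \<and> atypical n (nat \<lfloor>\<epsilon> * n\<rfloor>) K ((h + 5 * \<eta>) * n) ((h - 2 * \<eta>) * n) q.
        weight p n r q) \<le> \<delta> * partition_fun p (m n) n r) sequentially"
proof -
  \<comment> \<open>The tilt will be A ln n / n. This A makes exp (- t n \<eta>) equal to n to the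
    power - (\<beta> + 1), one power better than the conditioning cost, and the assumption on
    \<epsilon> keeps exp (t l) below n to the power c / 4.\<close>
  define A where "A = (\<beta> + 1) / \<eta>"
  have A: "0 < A" "A * \<epsilon> \<le> c / 4" "A * \<eta> = \<beta> + 1"
    using \<beta> \<eta> \<epsilon> by (auto simp: A_def)
  define DD where "DD = tail_moment p (s - 1) 1"
  define R where "R = \<rho> + 1"
  have R: "0 < R" using h \<eta> \<rho> by (simp add: R_def)
  \<comment> \<open>Ratio of the upper bound for \<open>pmf p\<close> at contents of order
    \<epsilon> n to \<open>pmf p 0\<close> times its lower bound at contents up to R n; the powers
    of n cancel.\<close>
  define \<kappa> where "\<kappa> = C * (R / \<epsilon>) powr \<beta> / (pmf p 0 * c\<^sub>0)"
  have \<kappa>: "0 < \<kappa>" using C R \<epsilon> p0 c0 by (simp add: \<kappa>_def)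
  \<comment> \<open>Minimiser of the quadratic exponent of the lower deviation.\<close>
  define \<tau> where "\<tau> = \<eta> / (real K)\<^sup>2"
  have \<tau>: "0 < \<tau>" using \<eta> K by (simp add: \<tau>_def)
  \<comment> \<open>Environment-free majorant of \<open>growth\<close>, with v = sqrt n: small
    enough for t v to vanish, large enough for v to the power - c to beat n to the power c /
    4.\<close>
  define G where "G n = exp (A * ln (real n) / n * K) * (h + \<eta>) +
     ((exp (A * ln (real n) / n * sqrt n) * real K powr (- c) + real n powr (c / 4) * real n powr (- (c / 2))) * L +
      real n powr (s - c - 1) * (real n powr (c / 4) * real n powr (1 - s) * DD)) / pmf p 0" for n :: nat
  have "(\<lambda>n. exp (A * ln (real n) / n * K)) \<longlonglongrightarrow> 1" by real_asymp
  moreover have "(\<lambda>n. exp (A * ln (real n) / n * sqrt n)) \<longlonglongrightarrow> 1" by real_asymp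
  moreover have "(\<lambda>n. real n powr (c / 4) * real n powr (- (c / 2))) \<longlonglongrightarrow> 0" using c by real_asymp
  moreover have "(\<lambda>n. real n powr (s - c - 1) * (real n powr (c / 4) * real n powr (1 - s) * DD)) \<longlonglongrightarrow> 0"
  proof -
    have eq: "real n powr (s - c - 1) * (real n powr (c / 4) * real n powr (1 - s) * DD) = real n powr (- (3 * c / 4)) * DD" for n :: nat
      by (simp add: mult.assoc[symmetric] flip: powr_add)
    show ?thesis unfolding eq using c by real_asymp
  qed
  ultimately have "G \<longlonglongrightarrow> 1 * (h + \<eta>) + ((1 * real K powr (- c) + 0) * L + 0) / pmf p 0"
    unfolding G_def by (intro tendsto_intros) (use p0 in simp_all)
  then have "G \<longlonglongrightarrow> h + \<eta> + real K powr (- c) * L / pmf p 0" by simp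
  then have G: "eventually (\<lambda>n. G n < h + 4 * \<eta>) sequentially"
    by (rule order_tendstoD(2)) (use KL \<eta> in linarith)
  define LP where "LP n = (real n powr (s - c) * (\<epsilon> * n / 2) powr (- s) * DD + n * L * (\<epsilon> * n / 2) powr (- (1 + c))) / pmf p 0" for n :: nat
  have "LP \<longlonglongrightarrow> (0 + 0) / pmf p 0"
    unfolding LP_def
  proof (intro tendsto_divide tendsto_add tendsto_const)
    show "(\<lambda>n. real n powr (s - c) * (\<epsilon> * n / 2) powr (- s) * DD) \<longlonglongrightarrow> 0"
      using c s \<epsilon>(1) by real_asymp
    show "(\<lambda>n. n * L * (\<epsilon> * n / 2) powr (- (1 + c))) \<longlonglongrightarrow> 0"
      using c \<epsilon>(1) by real_asymp
  qed (use p0 in auto)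
  then have LP: "eventually (\<lambda>n. LP n < 1 / 4) sequentially"
    by (rule order_tendstoD(2)) auto
  have "(\<lambda>n. real n powr (- (\<beta> + 1))) \<longlonglongrightarrow> 0" using \<beta> by real_asymp
  then have small: "eventually (\<lambda>n. real n powr (- (\<beta> + 1)) < 1 / 4) sequentially"
    by (rule order_tendstoD(2)) auto
  \<comment> \<open>The four terms are respectively a stretched exponential times a power of n, a
    power of order s - c + 1 - \<beta> < 0, a power of order - 1, and an exponential times a
    power.\<close>
  define T where "T n = n * ((R * n + 1) * \<kappa> * exp (- (\<epsilon> / 2 * real n powr (1 - d)))) +
      real n powr (s - c) * ((R * n + 1) * (\<kappa> * C * (\<epsilon> * n) powr (- \<beta>))) * (R / \<epsilon>) +
      2 / (c\<^sub>0 * (R * n) powr (- \<beta>)) * real n powr (- (\<beta> + 1)) +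
      2 / (c\<^sub>0 * (R * n) powr (- \<beta>)) * exp (- (\<eta>\<^sup>2 / (2 * (real K)\<^sup>2) * n))" for n :: nat
  have "T \<longlonglongrightarrow> 0 + 0 + 0 + 0"
    unfolding T_def
  proof (intro tendsto_add)
    show "(\<lambda>n. n * ((R * n + 1) * \<kappa> * exp (- (\<epsilon> / 2 * real n powr (1 - d))))) \<longlonglongrightarrow> 0"
      using d \<epsilon>(1) by real_asymp
    show "(\<lambda>n. real n powr (s - c) * ((R * n + 1) * (\<kappa> * C * (\<epsilon> * n) powr (- \<beta>))) * (R / \<epsilon>)) \<longlonglongrightarrow> 0"
      using s c \<beta> \<epsilon>(1) R by real_asymp
    show "(\<lambda>n. 2 / (c\<^sub>0 * (R * n) powr (- \<beta>)) * real n powr (- (\<beta> + 1))) \<longlonglongrightarrow> 0"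
      using c0(1) \<beta> R by real_asymp
    define e where "e = \<eta>\<^sup>2 / (2 * (real K)\<^sup>2)"
    have "0 < e" using \<eta> K by (simp add: e_def)
    then show "(\<lambda>n. 2 / (c\<^sub>0 * (R * n) powr (- \<beta>)) * exp (- (\<eta>\<^sup>2 / (2 * (real K)\<^sup>2) * n))) \<longlonglongrightarrow> 0"
      unfolding e_def[symmetric] using c0(1) \<beta> R by real_asymp
  qed
  then have T: "eventually (\<lambda>n. T n < \<delta>) sequentially"
    by (rule order_tendstoD(2)) (use \<delta> in auto)
  have m_lower: "eventually (\<lambda>n. h + 6 * \<eta> < real (m n) / n) sequentially"
    by (rule order_tendstoD(1)[OF m \<rho>])
  have m_upper: "eventually (\<lambda>n. real (m n) / n < R) sequentially"
    by (rule order_tendstoD(2)[OF m]) (simp add: R_def)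
  have big: "eventually (\<lambda>n. x \<le> real n) sequentially" for x :: real
    using filterlim_real_sequentially by (simp add: filterlim_at_top)
  show ?thesis
    using G LP small T m_lower m_upper big[of "4 / \<epsilon>"] big[of "real (Suc k\<^sub>0) / \<eta>"] big[of "real k\<^sub>0 / \<epsilon>"]
      big[of "real K / \<eta>"] eventually_ge_at_top[of 2]
  proof eventually_elim
    case (elim n)
    have n: "2 \<le> real n" "0 < real n" using elim by auto
    define l where "l = nat \<lfloor>\<epsilon> * n\<rfloor>"
    \<comment> \<open>The constant 4 makes rounding cost less than half of \<epsilon> n; the second
      bound puts contents above l in the range where the lower bound on \<open>pmf p\<close>
      holds.\<close>
    have en: "4 \<le> \<epsilon> * n" "real k\<^sub>0 \<le> \<epsilon> * n" using elim \<epsilon> by (auto simp: field_simps)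
    have l: "real l \<le> \<epsilon> * n" "\<epsilon> * n \<le> real (Suc l)" "\<epsilon> * n / 2 \<le> real l" "1 \<le> l"
      using en by (auto simp: l_def) linarith+
    have l_n: "real l \<le> n" using l(1) \<epsilon> n mult_right_mono[of \<epsilon> 1 "real n"] by linarith
    have mR: "real (m n) \<le> R * n" using elim n by (simp add: field_simps)
    have ml: "(h + 6 * \<eta>) * n \<le> real (m n)" using elim n by (simp add: field_simps)
    have k0: "real (Suc k\<^sub>0) \<le> \<eta> * n" using elim \<eta> by (simp add: field_simps)
    have Kn: "real K \<le> \<eta> * n" using elim \<eta> by (simp add: field_simps)
    define t where "t = A * ln n / n"
    have t: "0 \<le> t" using A n by (simp add: t_def)
    have tn: "exp (- t * n * \<eta>) = real n powr (- (\<beta> + 1))"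
      unfolding A(3)[symmetric] using n by (simp add: t_def powr_def)
    have tl: "exp (t * l) \<le> real n powr (c / 4)"
    proof -
      have "t * l \<le> t * (\<epsilon> * n)" using t l(1) by (intro mult_left_mono) auto
      also have "\<dots> = (A * \<epsilon>) * ln n" using n by (simp add: t_def)
      also have "\<dots> \<le> c / 4 * ln n" using A n by (intro mult_right_mono) auto
      finally show ?thesis using n by (simp add: powr_def)
    qed
    have pl: "c\<^sub>0 * (R * n) powr (- \<beta>) \<le> pmf p k" if "k\<^sub>0 \<le> k" "k \<le> m n" "1 \<le> k" for k
    proof -
      have "(R * n) powr (- \<beta>) \<le> real k powr (- \<beta>)"
        using that mR \<beta> R n by (intro powr_mono2') auto
      then have "c\<^sub>0 * (R * n) powr (- \<beta>) \<le> c\<^sub>0 * real k powr (- \<beta>)"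
        using c0(1) by (intro mult_left_mono) auto
      then show ?thesis using c0(2)[OF that(1)] by simp
    qed
    have pu: "pmf p b \<le> C * (\<epsilon> * n) powr (- \<beta>)" if "l < b" for b
    proof -
      have "\<epsilon> * n \<le> real b" using l(2) that by linarith
      then have "C * real b powr (- \<beta>) \<le> C * (\<epsilon> * n) powr (- \<beta>)"
        using C(1) \<beta> en by (intro mult_left_mono powr_mono2') auto
      then show ?thesis using C(2)[of b] that by simp
    qed
    have \<kappa>_eq: "\<kappa> * (pmf p 0 * (c\<^sub>0 * (R * n) powr (- \<beta>))) = C * (\<epsilon> * n) powr (- \<beta>)"
      using p0 c0(1) R \<epsilon> n by (simp add: \<kappa>_def powr_mult powr_divide powr_minus field_simps)
    have p1: "pmf p a * pmf p b \<le> \<kappa> * (pmf p 0 * pmf p (a + b))" if "l < b" "a + b \<le> m n" for a b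
    proof -
      have "pmf p a * pmf p b \<le> 1 * (C * (\<epsilon> * n) powr (- \<beta>))"
        using C(1) by (intro mult_mono pu that pmf_le_1) auto
      also have "\<dots> = \<kappa> * (pmf p 0 * (c\<^sub>0 * (R * n) powr (- \<beta>)))" using \<kappa>_eq by simp
      also have "\<dots> \<le> \<kappa> * (pmf p 0 * pmf p (a + b))"
      proof (intro mult_left_mono pl)
        show "k\<^sub>0 \<le> a + b" using en(2) l(1) l(2) that by linarith
      qed (use \<kappa> that in auto)
      finally show ?thesis .
    qed
    have p2: "pmf p a * pmf p b \<le> (\<kappa> * C * (\<epsilon> * n) powr (- \<beta>)) * (pmf p 0 * pmf p (a + b))"
      if "l < a" "l < b" "a + b \<le> m n" for a b
    proof -
      have "pmf p a * pmf p b \<le> (C * (\<epsilon> * n) powr (- \<beta>)) * (C * (\<epsilon> * n) powr (- \<beta>))"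
        using C(1) by (intro mult_mono pu that) auto
      \<comment> \<open>Only one of the two small factors is exchanged for the merged weight; the
        other one survives and pays for the number of sites in H.\<close>
      also have "\<dots> = (\<kappa> * C * (\<epsilon> * n) powr (- \<beta>)) * (pmf p 0 * (c\<^sub>0 * (R * n) powr (- \<beta>)))"
        by (subst (1) \<kappa>_eq[symmetric]) (simp only: mult_ac)
      also have "\<dots> \<le> (\<kappa> * C * (\<epsilon> * n) powr (- \<beta>)) * (pmf p 0 * pmf p (a + b))"
      proof (intro mult_left_mono pl)
        show "k\<^sub>0 \<le> a + b" using en(2) l(1) l(2) that by linarith
      qed (use \<kappa> C that in auto)
      finally show ?thesis .
    qed
    show ?case
    proof (intro allI impI)
      fix r H M
      assume env: "rescaled_env p n r H M s c L h \<eta> (1 - real n powr (- d) / 2) K"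
      interpret rescaled_env p n r H M s c L h \<eta> "1 - real n powr (- d) / 2" K by (rule env)
      have D: "D = DD" by (simp add: D_def DD_def)
      have D0: "0 \<le> DD" using D_nonneg by (simp add: D)
      have growth: "growth t (sqrt n) l \<le> h + 4 * \<eta>"
      proof -
        have "growth t (sqrt n) l \<le> G n"
          unfolding growth_def G_def t_def[symmetric] D
        proof (intro add_mono divide_right_mono mult_right_mono mult_left_mono mult_mono order.refl)
          show "sqrt (real n) powr (- c) \<le> real n powr (- (c / 2))"
            using n by (simp add: powr_half_sqrt[symmetric] powr_powr)
          show "real l powr (1 - s) \<le> real n powr (1 - s)"
            using l_n s by (intro powr_mono2) auto
        qed (use tl D0 L_nonneg p0 h \<eta> in auto)
        then show ?thesis using elim by linarith
      qed
      have large: "large_prob l \<le> 1 / 4"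
      proof -
        have "large_prob l \<le> LP n"
          unfolding large_prob_def LP_def D
        proof (intro divide_right_mono add_mono mult_left_mono mult_right_mono)
          show "real l powr (- s) \<le> (\<epsilon> * n / 2) powr (- s)"
            using l en s by (intro powr_mono2') auto
          show "real l powr (- (1 + c)) \<le> (\<epsilon> * n / 2) powr (- (1 + c))"
            using l en c by (intro powr_mono2') auto
        qed (use D0 L_nonneg p0 in auto)
        then show ?thesis using elim by linarith
      qed
      have B: "S \<le> m n \<and> c\<^sub>0 * (R * n) powr (- \<beta>) \<le> pmf p (m n - S)" if "real S \<le> (h + 5 * \<eta>) * n" for S
      proof -
        \<comment> \<open>The margin \<eta> n between the threshold and m forces the content left
          for site M into the range where the lower bound on \<open>pmf p\<close> is valid.\<close>
        have "real S + real (Suc k\<^sub>0) \<le> real (m n)" using that k0 ml by (simp add: algebra_simps)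
        then have "S + Suc k\<^sub>0 \<le> m n" by linarith
        then show ?thesis by (intro conjI pl) auto
      qed
      have Km: "K \<le> m n"
      proof -
        have "\<eta> * n \<le> (h + 6 * \<eta>) * n" using h \<eta> n by (intro mult_right_mono) auto
        then show ?thesis using Kn ml by linarith
      qed
      note at = atypical_le[of t "sqrt n" l \<tau> "m n" "c\<^sub>0 * (R * n) powr (- \<beta>)" \<kappa> "\<kappa> * C * (\<epsilon> * n) powr (- \<beta>)"]
      have prem: "0 < sqrt (real n)" "0 \<le> \<tau>" "0 \<le> \<eta>" "0 < c\<^sub>0 * (R * n) powr (- \<beta>)" "0 \<le> \<kappa>"
        "0 \<le> \<kappa> * C * (\<epsilon> * n) powr (- \<beta>)" "exp (- t * n * \<eta>) \<le> 1 / 4"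
        using n \<tau> \<eta> c0(1) R \<kappa> C(1) elim tn by auto
      have Z: "0 < partition_fun p (m n) n r"
        by (rule at(1)[OF t prem(1) l(4) prem(2) Km prem(3-6) growth large prem(7) B p1 p2])
      have "(\<Sum>q | q \<in> configs (m n) n \<and> atypical n l K ((h + 5 * \<eta>) * n) ((h - 2 * \<eta>) * n) q. weight p n r q) \<le>
        (n * (real (m n + 1) * \<kappa> * (1 - real n powr (- d) / 2) ^ Suc l) +
         real n powr (s - c) * (real (m n + 1) * (\<kappa> * C * (\<epsilon> * n) powr (- \<beta>))) * (real (m n) / real (Suc l)) +
         2 / (c\<^sub>0 * (R * n) powr (- \<beta>)) * exp (- t * n * \<eta>) +
         2 / (c\<^sub>0 * (R * n) powr (- \<beta>)) * exp (- (\<tau> * \<eta> * n) + \<tau>\<^sup>2 * (real K)\<^sup>2 / 2 * n)) * partition_fun p (m n) n r"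
        by (rule at(2)[OF t prem(1) l(4) prem(2) Km prem(3-6) growth large prem(7) B p1 p2])
      also have "\<dots> \<le> \<delta> * partition_fun p (m n) n r"
      proof (rule mult_right_mono)
        have "(1 - real n powr (- d) / 2) ^ Suc l \<le> exp (- (\<epsilon> / 2 * real n powr (1 - d)))"
        proof -
          have "(1 - real n powr (- d) / 2) ^ Suc l \<le> exp (- (real n powr (- d) / 2)) ^ Suc l"
            using \<theta> exp_ge_add_one_self[of "- (real n powr (- d) / 2)"] by (intro power_mono) auto
          also have "\<dots> = exp (- (real n powr (- d) / 2 * real (Suc l)))"
            by (simp only: exp_of_nat_mult[symmetric]) (simp add: algebra_simps)
          also have "\<dots> \<le> exp (- (real n powr (- d) / 2 * (\<epsilon> * n)))"
            unfolding exp_le_cancel_iff neg_le_iff_le using l by (intro mult_left_mono) auto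
          also have "real n powr (- d) / 2 * (\<epsilon> * n) = \<epsilon> / 2 * real n powr (1 - d)"
            using n by (simp add: powr_diff powr_minus field_simps)
          finally show ?thesis .
        qed
        then have e1: "n * (real (m n + 1) * \<kappa> * (1 - real n powr (- d) / 2) ^ Suc l) \<le>
            n * ((R * n + 1) * \<kappa> * exp (- (\<epsilon> / 2 * real n powr (1 - d))))"
          using mR \<kappa> \<theta> R n by (intro mult_left_mono mult_mono) auto
        have "real (m n) / real (Suc l) \<le> (R * n) / (\<epsilon> * n)"
          using mR l(2) en R n by (intro frac_le) auto
        then have "real (m n) / real (Suc l) \<le> R / \<epsilon>" using n by simp
        then have e2: "real n powr (s - c) * (real (m n + 1) * (\<kappa> * C * (\<epsilon> * n) powr (- \<beta>))) * (real (m n) / real (Suc l)) \<le>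
            real n powr (s - c) * ((R * n + 1) * (\<kappa> * C * (\<epsilon> * n) powr (- \<beta>))) * (R / \<epsilon>)"
          using mR \<kappa> C(1) R \<epsilon> n by (intro mult_mono mult_left_mono mult_right_mono mult_nonneg_nonneg) auto
        have e4: "- (\<tau> * \<eta> * n) + \<tau>\<^sup>2 * (real K)\<^sup>2 / 2 * n = - (\<eta>\<^sup>2 / (2 * (real K)\<^sup>2) * n)"
          using K by (simp add: \<tau>_def power2_eq_square field_simps)
        show "n * (real (m n + 1) * \<kappa> * (1 - real n powr (- d) / 2) ^ Suc l) +
         real n powr (s - c) * (real (m n + 1) * (\<kappa> * C * (\<epsilon> * n) powr (- \<beta>))) * (real (m n) / real (Suc l)) +
         2 / (c\<^sub>0 * (R * n) powr (- \<beta>)) * exp (- t * n * \<eta>) +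
         2 / (c\<^sub>0 * (R * n) powr (- \<beta>)) * exp (- (\<tau> * \<eta> * n) + \<tau>\<^sup>2 * (real K)\<^sup>2 / 2 * n) \<le> \<delta>"
          using e1 e2 elim(4) unfolding tn e4 T_def by linarith
      qed (use Z in simp)
      finally show "0 < partition_fun p (m n) n r \<and>
       (\<Sum>q | q \<in> configs (m n) n \<and> atypical n (nat \<lfloor>\<epsilon> * n\<rfloor>) K ((h + 5 * \<eta>) * n) ((h - 2 * \<eta>) * n) q.
          weight p n r q) \<le> \<delta> * partition_fun p (m n) n r"
        using Z by (simp add: l_def)
    qed
  qed
qed

section \<open>Condensation\<close>

text \<open>If no content exceeded l, the cut sum would be m, contradicting u \<le> m. So exactly
  one site j exceeds l, and m = q j plus the cut sum, which lies strictly between w and u.\<close>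

lemma not_atypical_order_stats:
  assumes q: "q \<in> configs m n" and at: "\<not> atypical n l K u w q" and n: "2 \<le> n" and Kl: "K \<le> l" and u: "u \<le> real m"
  shows "order_stat n 2 q \<le> l" and "real m - u < order_stat n 1 q" and "order_stat n 1 q < real m - w"
proof -
  have two: "\<not> (\<exists>i\<in>{1..n}. \<exists>j\<in>{1..n}. i \<noteq> j \<and> l < q i \<and> l < q j)"
    and T: "(\<Sum>i=1..n. cut l (q i)) < u" and TK: "w < (\<Sum>i=1..n. cut K (q i))"
    using at unfolding atypical_def by auto
  show "order_stat n 2 q \<le> l"
  proof (rule ccontr)
    assume "\<not> order_stat n 2 q \<le> l"
    then show False
      using order_stat_two_ge[OF n, of "Suc l" q] two by (auto simp: Suc_le_eq)
  qed
  have TK': "(\<Sum>i=1..n. cut K (q i)) \<le> (\<Sum>i=1..n. cut l (q i))"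
    using Kl by (intro sum_mono) (auto simp: cut_def)
  have sum_q: "(\<Sum>i=1..n. real (q i)) = real m"
    using configs_sum[OF q] by (simp flip: of_nat_sum)
  have "\<exists>j\<in>{1..n}. l < q j"
  proof (rule ccontr)
    assume "\<not> (\<exists>j\<in>{1..n}. l < q j)"
    then have "(\<Sum>i=1..n. cut l (q i)) = (\<Sum>i=1..n. real (q i))"
      by (intro sum.cong) (auto simp: cut_def not_less)
    then show False using T sum_q u by linarith
  qed
  then obtain j where j: "j \<in> {1..n}" "l < q j" by auto
  have small: "q i \<le> l" if "i \<in> {1..n} - {j}" for i
    using that j two by (metis DiffE insertI1 not_le)
  have "(\<Sum>i=1..n. real (q i)) = q j + (\<Sum>i\<in>{1..n} - {j}. real (q i))"
    using j by (subst sum.remove[of _ j]) auto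
  also have "(\<Sum>i\<in>{1..n} - {j}. real (q i)) = (\<Sum>i\<in>{1..n} - {j}. cut l (q i))"
    using small by (intro sum.cong) (auto simp: cut_def)
  also have "\<dots> = (\<Sum>i=1..n. cut l (q i))"
    using j by (subst (2) sum.remove[of _ j]) (auto simp: cut_def)
  finally have m: "real m = q j + (\<Sum>i=1..n. cut l (q i))" using sum_q by simp
  have "order_stat n 1 q = Max (q ` {1..n})"
    using n by (intro order_stat_one) auto
  also have "\<dots> = q j"
  proof (rule Max_eqI)
    fix y assume "y \<in> q ` {1..n}"
    then obtain i where "i \<in> {1..n}" "y = q i" by auto
    then show "y \<le> q j" using small[of i] j by (cases "i = j") auto
  qed (use j in auto)
  finally have "order_stat n 1 q = q j" .
  then show "real m - u < order_stat n 1 q" "order_stat n 1 q < real m - w"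
    using m T TK TK' by linarith+
qed

context fitness_law
begin

text \<open>Division by the maximum X moves each fitness by at most \<delta>, so the truncated means
  change by at most \<eta> each; added to the sampling error this gives 2 \<eta>. The series of
  order 1 + c are more sensitive, which is why the typical event controls them at (1 + x) / 2
  instead of x.\<close>

lemma typical_rescaled_env:
  assumes p: "0 < pmf p 0" and s: "0 < s" "s < 1" and c: "0 < c" and K: "1 \<le> K" and d: "0 < d" and n: "1 \<le> n"
    and summable_s: "summable (\<lambda>k. real k powr s * pmf p k)"
    and uc: "\<And>x y. x \<in> {0..1} \<Longrightarrow> y \<in> {0..1} \<Longrightarrow> \<bar>y - x\<bar> \<le> real n powr (- d) \<Longrightarrow>
      \<bar>trunc_mean p K y - trunc_mean p K x\<bar> \<le> \<eta>"
    and tx: "typical p d (s - c) c L K \<eta> n x"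
  obtains b H M where "0 < b"
    "rescaled_env p n (\<lambda>i. b * x i) H M s c L (\<integral>x. trunc_mean p K x \<partial>\<mu>) (2 * \<eta>) (1 - real n powr (- d) / 2) K"
proof -
  define \<delta> where "\<delta> = real n powr (- d)"
  have \<delta>: "0 < \<delta>" "\<delta> \<le> 1"
    using n d ge_one_powr_ge_zero[of "real n" d] by (auto simp: \<delta>_def powr_minus field_simps)
  have x: "0 \<le> x i" "x i < 1" if "i \<in> {1..n}" for i
    using tx that by (auto simp: typical_def)
  define X where "X = Max (x ` {1..n})"
  have "X \<in> x ` {1..n}" unfolding X_def using n by (intro Max_in) auto
  then obtain M where M: "M \<in> {1..n}" "x M = X" by auto
  have xX: "x i \<le> X" if "i \<in> {1..n}" for i using that by (auto simp: X_def)
  obtain i0 where i0: "i0 \<in> {1..n}" "1 - \<delta> / 2 \<le> x i0"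
    using tx unfolding typical_def \<delta>_def[symmetric] by (auto simp: not_less)
  have X: "1 - \<delta> / 2 \<le> X" "X < 1" using i0 xX[of i0] x[OF M(1)] M by auto
  have X0: "1 / 2 \<le> X" "0 < X" using X \<delta> by auto
  define r where "r i = 1 / X * x i" for i
  define H where "H = {i \<in> {1..n}. 1 - \<delta> \<le> x i}"
  have r: "0 \<le> r i" "r i \<le> 1" if "i \<in> {1..n}" for i
    using x[OF that] xX[OF that] X0 by (auto simp: r_def)
  have off: "r i \<le> 1 - \<delta> / 2" "r i \<le> (1 + x i) / 2" if i: "i \<in> {1..n}" "i \<notin> H" for i
  proof -
    have xi: "x i < 1 - \<delta>" "0 \<le> x i" using i x by (auto simp: H_def)
    \<comment> \<open>A distance \<delta> from 1 leaves room for two factors 1 - \<delta> / 2: one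
      is lost to X, the other bounds the ratio.\<close>
    have "x i \<le> (1 - \<delta> / 2) * (1 - \<delta> / 2)"
      using xi(1) \<delta> by (simp add: algebra_simps add_increasing2)
    also have "\<dots> \<le> (1 - \<delta> / 2) * X" using X \<delta> by (intro mult_left_mono) auto
    finally show "r i \<le> 1 - \<delta> / 2" using X0 by (simp add: r_def divide_le_eq)
    \<comment> \<open>Replacing x by (1 + x) / 2 gains (1 - x) / 2 > \<delta> / 2, while the factor
      1 - \<delta> / 2 loses at most \<delta> / 2.\<close>
    have "x i * \<delta> \<le> 1 * \<delta>" using xi \<delta> by (intro mult_right_mono) auto
    moreover have "(1 + x i) / 2 * (1 - \<delta> / 2) = 1 / 2 + x i / 2 - \<delta> / 4 - x i * \<delta> / 4"
      by (simp add: field_simps)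
    ultimately have "x i \<le> (1 + x i) / 2 * (1 - \<delta> / 2)"
      using xi(1) \<delta> by linarith
    also have "\<dots> \<le> (1 + x i) / 2 * X" using X xi by (intro mult_left_mono) auto
    finally show "r i \<le> (1 + x i) / 2" using X0 by (simp add: r_def divide_le_eq)
  qed
  have near: "\<bar>r i - x i\<bar> \<le> \<delta>" if i: "i \<in> {1..n}" for i
  proof -
    have "x i \<le> r i" using x[OF i] X X0 by (simp add: r_def le_divide_eq mult_left_le)
    have "r i - x i = r i * (1 - X)" using X0 by (simp add: r_def field_simps)
    also have "\<dots> \<le> 1 * (1 - X)" using r[OF i] X by (intro mult_right_mono) auto
    also have "\<dots> \<le> \<delta>" using X \<delta> by simp
    finally show ?thesis using \<open>x i \<le> r i\<close> by simp
  qed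
  have "rescaled_env p n r H M s c L (\<integral>x. trunc_mean p K x \<partial>\<mu>) (2 * \<eta>) (1 - real n powr (- d) / 2) K"
    unfolding \<delta>_def[symmetric]
  proof (unfold_locales; (fact)?)
    show "r M = 1" using M X0 by (simp add: r_def)
    show "M \<in> H" using M X \<delta> by (auto simp: H_def)
    show "H \<subseteq> {1..n}" by (auto simp: H_def)
    show "0 \<le> 1 - \<delta> / 2" "1 - \<delta> / 2 < 1" using \<delta> by auto
    show "real (card H) \<le> real n powr (s - c)"
      using tx unfolding typical_def \<delta>_def[symmetric] H_def by blast
    show "(\<Sum>i\<in>{1..n} - H. tail_moment p c (r i)) \<le> L * n"
    proof -
      have "(\<Sum>i\<in>{1..n} - H. tail_moment p c (r i)) \<le> (\<Sum>i\<in>{1..n} - H. half_moment p c (x i))"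
      proof (rule sum_mono)
        fix i assume i: "i \<in> {1..n} - H"
        then show "tail_moment p c (r i) \<le> half_moment p c (x i)"
          using x[of i] r[of i] off[of i] by (auto simp: half_moment_def intro!: tail_moment_mono)
      qed
      also have "\<dots> \<le> (\<Sum>i=1..n. half_moment p c (x i))"
        by (intro sum_mono2) (auto simp: half_moment_nonneg)
      also have "\<dots> \<le> L * n" using tx unfolding typical_def by blast
      finally show ?thesis .
    qed
    show "\<bar>(\<Sum>i=1..n. trunc_mean p K (r i)) - n * (\<integral>x. trunc_mean p K x \<partial>\<mu>)\<bar> \<le> 2 * \<eta> * n"
    proof -
      have "\<bar>(\<Sum>i=1..n. trunc_mean p K (r i)) - (\<Sum>i=1..n. trunc_mean p K (x i))\<bar> \<le>
          (\<Sum>i=1..n. \<bar>trunc_mean p K (r i) - trunc_mean p K (x i)\<bar>)"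
        unfolding sum_subtractf[symmetric] by (rule sum_abs)
      also have "\<dots> \<le> (\<Sum>i=1..n. \<eta>)"
      proof (rule sum_mono)
        fix i assume i: "i \<in> {1..n}"
        show "\<bar>trunc_mean p K (r i) - trunc_mean p K (x i)\<bar> \<le> \<eta>"
          using x[OF i] r[OF i] near[OF i] by (intro uc) (auto simp: \<delta>_def)
      qed
      finally have "\<bar>(\<Sum>i=1..n. trunc_mean p K (r i)) - (\<Sum>i=1..n. trunc_mean p K (x i))\<bar> \<le> \<eta> * n"
        by (simp add: mult.commute)
      moreover have "\<bar>(\<Sum>i=1..n. trunc_mean p K (x i)) - n * (\<integral>x. trunc_mean p K x \<partial>\<mu>)\<bar> \<le> \<eta> * n"
        using tx unfolding typical_def by blast
      ultimately show ?thesis by linarith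
    qed
  qed
  then show thesis
    using X0 by (intro that[of "1 / X" H M]) (auto simp: r_def[abs_def])
qed

lemma trunc_mean_uniformly_continuous:
  assumes "0 < pmf p 0" "0 < d" "0 < \<eta>"
  shows "eventually (\<lambda>n. \<forall>x\<in>{0..1}. \<forall>y\<in>{0..1}. \<bar>y - x\<bar> \<le> real n powr (- d) \<longrightarrow>
    \<bar>trunc_mean p K y - trunc_mean p K x\<bar> \<le> \<eta>) sequentially"
proof -
  have "uniformly_continuous_on {0..1} (trunc_mean p K)"
    by (intro compact_uniformly_continuous continuous_on_trunc_mean assms) auto
  then obtain w where w: "0 < w" "\<And>x y. x \<in> {0..1} \<Longrightarrow> y \<in> {0..1} \<Longrightarrow> dist y x < w \<Longrightarrow>
      dist (trunc_mean p K y) (trunc_mean p K x) < \<eta>"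
    using assms(3) unfolding uniformly_continuous_on_def by metis
  have "(\<lambda>n. real n powr (- d)) \<longlonglongrightarrow> 0" using assms(2) by real_asymp
  then have "eventually (\<lambda>n. real n powr (- d) < w) sequentially"
    by (rule order_tendstoD(2)) (rule w(1))
  then show ?thesis
    by eventually_elim (use w(2) in \<open>force simp: dist_real_def\<close>)
qed

text \<open>The event B is kept abstract so that one estimate serves both order statistics. One
  \<delta> pays for atypical configurations in a typical sample, the other for atypical
  samples.\<close>

lemma eventually_annealed_le:
  fixes m :: "nat \<Rightarrow> nat"
  assumes p0: "0 < pmf p 0" and \<beta>: "1 < \<beta>" and \<beta>\<gamma>: "2 < \<beta> + \<gamma>"
    and C: "0 < C" "\<And>k. 1 \<le> k \<Longrightarrow> pmf p k \<le> C * real k powr (- \<beta>)"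
    and c0: "0 < c\<^sub>0" "\<And>k. k\<^sub>0 \<le> k \<Longrightarrow> c\<^sub>0 * real k powr (- \<beta>) \<le> pmf p k"
    and m: "(\<lambda>n. real (m n) / real n) \<longlonglongrightarrow> \<rho>" and \<rho>: "enn2real (critical_density \<mu> p) < \<rho>"
    and \<eta>: "0 < \<eta>" and \<delta>: "0 < \<delta>"
    and B: "\<And>n q. B n q \<Longrightarrow>
      \<bar>real (order_stat n 1 q) - (\<rho> - enn2real (critical_density \<mu> p)) * real n\<bar> > \<eta> * real n \<or>
      real (order_stat n 2 q) > \<eta> * real n"
  shows "eventually (\<lambda>n. measure (annealed_law \<mu> p (m n) n)
    {\<omega> \<in> space (annealed_law \<mu> p (m n) n). B n (snd \<omega>)} \<le> 2 * \<delta>) sequentially"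
proof -
  define \<rho>' where "\<rho>' = enn2real (critical_density \<mu> p)"
  \<comment> \<open>The largest accumulated error is 7 e: e from m / n, e from replacing the
    critical density by h, and 5 e from the upper threshold. The bound by \<rho> minus the critical
    density leaves space for h + 6 e < \<rho>.\<close>
  define e where "e = min \<eta> (\<rho> - \<rho>') / 10"
  have e: "0 < e" "10 * e \<le> \<eta>" "10 * e \<le> \<rho> - \<rho>'" using \<eta> \<rho> by (auto simp: e_def \<rho>'_def)
  \<comment> \<open>Midpoint of the admissible interval: u < \<gamma> makes the near zone wider than
    1 / n, u < 1 makes the maximum fall close enough to 1, and u > 2 - \<beta> makes the near sites
    few enough.\<close>
  define u where "u = (max 0 (2 - \<beta>) + min \<gamma> 1) / 2"
  have u: "0 < u" "2 - \<beta> < u" "u < \<gamma>" "u < 1"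
    using \<beta> \<beta>\<gamma> gamma_pos by (auto simp: u_def)
  define d where "d = u / \<gamma>"
  have d: "0 < d" "d < 1" "d * \<gamma> = u" using u gamma_pos by (auto simp: d_def)
  \<comment> \<open>Midpoint between 1 - u, the exponent of the number of near sites, and the
    largest order below which \<open>p\<close> has moments, capped at 1.\<close>
  define s where "s = ((1 - u) + min 1 (\<beta> - 1)) / 2"
  have s: "0 < s" "s < 1" "s < \<beta> - 1" "1 - u < s" using u by (auto simp: s_def)
  \<comment> \<open>At most half the gap between s and 1 - u, so that n to the power s - c still
    dominates the number of near sites.\<close>
  define c where "c = min (s - (1 - u)) (\<beta> + \<gamma> - 2) / 2"
  have c: "0 < c" "c < \<beta> + \<gamma> - 2" "1 - d * \<gamma> < s - c"
  proof -
    have "c \<le> (s - (1 - u)) / 2" by (simp add: c_def)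
    then show "1 - d * \<gamma> < s - c" unfolding d(3) using s(4) by (simp add: field_simps)
  qed (use s \<beta>\<gamma> in \<open>auto simp: c_def\<close>)
  have int: "integrable \<mu> (half_moment p c)"
    using integrable_half_moment[OF C(2) c(1,2) \<beta>] by blast
  define D where "D = (\<integral>x. half_moment p c x \<partial>\<mu>)"
  have D: "0 \<le> D" unfolding D_def by (intro integral_nonneg_AE) (auto simp: half_moment_nonneg)
  \<comment> \<open>Large enough for Markov's inequality on the moment sum to give less than
    \<delta>.\<close>
  define L where "L = D / \<delta> + 1"
  have L: "0 < L" "D < L * \<delta>" "0 \<le> L" using D \<delta> by (auto simp: L_def field_simps add_nonneg_pos)
  have "(\<lambda>K. real K powr (- c) * (L + D) / pmf p 0) \<longlonglongrightarrow> 0 * (L + D) / pmf p 0"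
    by (intro tendsto_intros) (use c p0 in \<open>real_asymp | simp\<close>)+
  then have "eventually (\<lambda>K. real K powr (- c) * (L + D) / pmf p 0 < e) sequentially"
    by (rule order_tendstoD(2)) (use e in simp)
  then have "eventually (\<lambda>K. real K powr (- c) * (L + D) / pmf p 0 < e \<and> 1 \<le> K) sequentially"
    using eventually_ge_at_top[of 1] by eventually_elim auto
  then obtain K where K: "1 \<le> K" "real K powr (- c) * (L + D) / pmf p 0 < e"
    by (auto simp: eventually_sequentially)
  have "real K powr (- c) * L / pmf p 0 \<le> real K powr (- c) * (L + D) / pmf p 0"
    using D p0 by (intro divide_right_mono mult_left_mono) auto
  then have KL: "real K powr (- c) * L / pmf p 0 < e" using K by linarith
  have "real K powr (- c) * D / pmf p 0 \<le> real K powr (- c) * (L + D) / pmf p 0"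
    using L p0 by (intro divide_right_mono mult_left_mono) auto
  then have KD: "real K powr (- c) * D / pmf p 0 < e" using K by linarith
  define h where "h = (\<integral>x. trunc_mean p K x \<partial>\<mu>)"
  have h_rho: "\<bar>h - \<rho>'\<bar> \<le> e"
    using critical_density_approx(2)[OF int c(1) p0 K(1)] KD by (simp add: h_def \<rho>'_def D_def)
  have h: "0 \<le> h"
    unfolding h_def
  proof (rule integral_nonneg_AE)
    show "AE x in \<mu>. 0 \<le> trunc_mean p K x"
      using AE_unit by eventually_elim (use trunc_mean_bounds(1)[OF p0] in auto)
  qed
  \<comment> \<open>The bound by e makes the level l at most \<eta> n, which settles the second
    order statistic; the last bound is the constraint imposed by the tilt.\<close>
  define \<epsilon> where "\<epsilon> = min (min 1 e) (c * e / (4 * (\<beta> + 1)))"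
  have \<epsilon>: "0 < \<epsilon>" "\<epsilon> \<le> 1" "\<epsilon> \<le> e" "(\<beta> + 1) / e * \<epsilon> \<le> c / 4"
  proof -
    show "0 < \<epsilon>" "\<epsilon> \<le> 1" "\<epsilon> \<le> e" using e c \<beta> by (auto simp: \<epsilon>_def)
    have cancel: "b / e * (c * e / (4 * b)) = c / 4" if "0 < b" for b
      using that e(1) by simp
    have "(\<beta> + 1) / e * \<epsilon> \<le> (\<beta> + 1) / e * (c * e / (4 * (\<beta> + 1)))"
      using e \<beta> by (intro mult_left_mono) (auto simp: \<epsilon>_def)
    also have "\<dots> = c / 4" using \<beta> by (intro cancel) simp
    finally show "(\<beta> + 1) / e * \<epsilon> \<le> c / 4" .
  qed
  have summ: "summable (\<lambda>k. real k powr s * pmf p k)"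
    using C(2) s(3) by (rule summable_powr_pmf)
  have \<rho>h: "h + 6 * e < \<rho>" using e h_rho by linarith
  have atyp: "eventually (\<lambda>n. \<forall>r H M. rescaled_env p n r H M s c L h e (1 - real n powr (- d) / 2) K \<longrightarrow>
     0 < partition_fun p (m n) n r \<and>
     (\<Sum>q | q \<in> configs (m n) n \<and> atypical n (nat \<lfloor>\<epsilon> * n\<rfloor>) K ((h + 5 * e) * n) ((h - 2 * e) * n) q.
        weight p n r q) \<le> \<delta> * partition_fun p (m n) n r) sequentially"
    by (rule eventually_atypical_le[where \<beta> = \<beta> and C = C and c\<^sub>0 = c\<^sub>0 and k\<^sub>0 = k\<^sub>0 and \<rho> = \<rho>])
       (fact p0 \<beta> C c0 s c(1) d(2) K(1) h e(1) KL L(3) \<epsilon> m \<rho>h \<delta>)+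
  \<comment> \<open>Half of e, because rescaling doubles the error in the truncated means.\<close>
  have e2: "0 < e / 2" using e by simp
  have dg: "d * \<gamma> < 1" using d(3) u by simp
  note tx = eventually_typical[OF p0 d(1) dg c(3) K(1) e2 int L(1) L(2)[unfolded D_def]]
  note uc = trunc_mean_uniformly_continuous[OF p0 d(1) e2, of K]
  have mlim: "eventually (\<lambda>n. \<rho> - e < real (m n) / n \<and> real (m n) / n < \<rho> + e) sequentially"
    using order_tendstoD[OF m] e(1) by (intro eventually_conj) auto
  have big: "eventually (\<lambda>n. (real K + 1) / \<epsilon> \<le> real n) sequentially"
    using filterlim_real_sequentially by (simp add: filterlim_at_top)
  show ?thesis
    using atyp tx uc mlim big eventually_ge_at_top[of 2]
  proof eventually_elim
    case (elim n)
    define l where "l = nat \<lfloor>\<epsilon> * n\<rfloor>"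
    have Kn: "real K + 1 \<le> \<epsilon> * n" using elim \<epsilon> by (simp add: field_simps)
    then have Kl: "K \<le> l" unfolding l_def by linarith
    have ln: "real l \<le> \<epsilon> * n" using Kn unfolding l_def by simp
    have n: "2 \<le> n" "0 < real n" using elim by auto
    have mn: "(\<rho> - e) * n < m n" "m n < (\<rho> + e) * n" using elim n by (auto simp: field_simps)
    let ?at = "atypical n l K ((h + 5 * e) * n) ((h - 2 * e) * n)"
    have sub: "?at q" if q: "q \<in> configs (m n) n" and Bq: "B n q" for q
    proof (rule ccontr)
      assume na: "\<not> ?at q"
      have um: "(h + 5 * e) * n \<le> real (m n)"
      proof -
        have "(h + 5 * e) * n \<le> (\<rho> - e) * n" using \<rho>h e by (intro mult_right_mono) auto
        then show ?thesis using mn by linarith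
      qed
      note os = not_atypical_order_stats[OF q na n(1) Kl um]
      have "real (order_stat n 2 q) \<le> \<epsilon> * n" using os(1) ln by linarith
      also have "\<dots> \<le> \<eta> * n" using \<epsilon> e by (intro mult_right_mono) auto
      finally have o2: "real (order_stat n 2 q) \<le> \<eta> * n" .
      have hn: "(\<rho>' - e) * n \<le> h * n" "h * n \<le> (\<rho>' + e) * n" using h_rho by (auto intro!: mult_right_mono)
      have en: "7 * e * n \<le> \<eta> * n" using e by (intro mult_right_mono) auto
      have "\<bar>real (order_stat n 1 q) - (\<rho> - \<rho>') * n\<bar> \<le> \<eta> * n"
        using os(2,3) mn hn en unfolding abs_le_iff
        by (simp add: algebra_simps)
      then show False using B[OF Bq] o2 unfolding \<rho>'_def by auto
    qed
    have "measure (annealed_law \<mu> p (m n) n) {\<omega> \<in> space (annealed_law \<mu> p (m n) n). B n (snd \<omega>)} \<le>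
      \<delta> + measure (sample n) {x \<in> space (sample n). \<not> typical p d (s - c) c L K (e / 2) n x}"
    proof (rule annealed_measure_le[OF prob_space_axioms sets_law])
      show "AE x in \<mu>. 0 \<le> x" using AE_unit by eventually_elim auto
      show "{x \<in> space (sample n). \<not> typical p d (s - c) c L K (e / 2) n x} \<in> sets (sample n)"
        by (rule sets_not_typical[OF p0 d(1) dg c(3) K(1) e2 int L(1) L(2)[unfolded D_def]])
      fix x assume x: "typical p d (s - c) c L K (e / 2) n x"
      have n1: "1 \<le> n" using n by simp
      obtain b H M where b: "0 < b" and
        env: "rescaled_env p n (\<lambda>i. b * x i) H M s c L h e (1 - real n powr (- d) / 2) K"
        using typical_rescaled_env[OF p0 s(1,2) c(1) K(1) d(1) n1 summ _ x] elim(3)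
        unfolding h_def by auto
      have x0: "\<forall>i\<in>{1..n}. 0 \<le> x i" using x by (auto simp: typical_def)
      \<comment> \<open>All configurations have total m, so rescaling multiplies every weight by the
        same factor, which cancels in the comparison.\<close>
      have Z: "partition_fun p (m n) n (\<lambda>i. b * x i) = b ^ m n * partition_fun p (m n) n x"
        unfolding partition_fun_def sum_distrib_left by (intro sum.cong weight_scale) auto
      have W: "(\<Sum>q | q \<in> configs (m n) n \<and> ?at q. weight p n (\<lambda>i. b * x i) q) =
          b ^ m n * (\<Sum>q | q \<in> configs (m n) n \<and> ?at q. weight p n x q)"
        unfolding sum_distrib_left by (intro sum.cong weight_scale) auto
      have "0 < b ^ m n * partition_fun p (m n) n x \<and>
        b ^ m n * (\<Sum>q | q \<in> configs (m n) n \<and> ?at q. weight p n x q) \<le> \<delta> * (b ^ m n * partition_fun p (m n) n x)"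
        using elim(1)[rule_format, OF env] unfolding Z l_def[symmetric] W .
      moreover have bm: "0 < b ^ m n" using b by simp
      ultimately have Zx: "0 < partition_fun p (m n) n x"
        and at: "(\<Sum>q | q \<in> configs (m n) n \<and> ?at q. weight p n x q) \<le> \<delta> * partition_fun p (m n) n x"
        unfolding mult.left_commute[of \<delta>] by (blast intro: zero_less_mult_pos, simp add: bm)
      have "(\<Sum>q | q \<in> configs (m n) n \<and> B n q. weight p n x q) \<le>
          (\<Sum>q | q \<in> configs (m n) n \<and> ?at q. weight p n x q)"
        by (intro sum_mono2 weight_nonneg) (use finite_configs sub x0 in auto)
      then show "(\<forall>i\<in>{1..n}. 0 \<le> x i) \<and> 0 < partition_fun p (m n) n x \<and>
          (\<Sum>q | q \<in> configs (m n) n \<and> B n q. weight p n x q) \<le> \<delta> * partition_fun p (m n) n x"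
        using x0 Zx at by linarith
    qed (use \<delta> in simp)
    then show ?case using elim(2) by linarith
  qed
qed

end

lemma pmf_bounds:
  assumes "0 < \<alpha>" "asymp_equiv (\<lambda>k. pmf p k) at_top (\<lambda>k. \<alpha> * real k powr (- \<beta>))" "1 < \<beta>"
  obtains C c k\<^sub>0 where "0 < C" "0 < c" "\<And>k. 1 \<le> k \<Longrightarrow> pmf p k \<le> C * real k powr (- \<beta>)"
    "\<And>k. k\<^sub>0 \<le> k \<Longrightarrow> c * real k powr (- \<beta>) \<le> pmf p k"
proof -
  have "eventually (\<lambda>k. 0 < \<alpha> * real k powr (- \<beta>)) at_top"
    using eventually_gt_at_top[of 0] by eventually_elim (use assms(1) in simp)
  from asymp_equiv_eventually_bounds[OF assms(2) this]
  obtain k0 where k0: "\<And>k. k0 \<le> k \<Longrightarrow> \<alpha> * real k powr (- \<beta>) / 2 \<le> pmf p k \<and> pmf p k \<le> 2 * (\<alpha> * real k powr (- \<beta>))"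
    by (auto simp: eventually_at_top_linorder)
  show thesis
  \<comment> \<open>The summand involving \<open>k0\<close> takes care of 1 \<le> k <
    \<open>k0\<close>, where 1 \<le> (\<open>k0\<close> / k) to the power \<beta> bounds the
    probability.\<close>
  proof (rule that[of "2 * \<alpha> + real k0 powr \<beta>" "\<alpha> / 2" k0])
    show "0 < 2 * \<alpha> + real k0 powr \<beta>" "0 < \<alpha> / 2" using assms(1) by (auto simp: add_pos_nonneg)
    show "\<alpha> / 2 * real k powr (- \<beta>) \<le> pmf p k" if "k0 \<le> k" for k using k0[OF that] by simp
    fix k :: nat assume k: "1 \<le> k"
    show "pmf p k \<le> (2 * \<alpha> + real k0 powr \<beta>) * real k powr (- \<beta>)"
    proof (cases "k0 \<le> k")
      case True
      then show ?thesis using k0[OF True] by (simp add: algebra_simps add_increasing)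
    next
      case False
      have "pmf p k \<le> 1" by (rule pmf_le_1)
      also have "1 \<le> (real k0 / real k) powr \<beta>"
        using False k assms(3) by (intro ge_one_powr_ge_zero) auto
      also have "\<dots> = real k0 powr \<beta> * real k powr (- \<beta>)"
        by (simp add: powr_divide powr_minus field_simps)
      also have "\<dots> \<le> (2 * \<alpha> + real k0 powr \<beta>) * real k powr (- \<beta>)"
        using assms(1) by (intro mult_right_mono) auto
      finally show ?thesis .
    qed
  qed
qed

lemma LIMSEQ_zeroI:
  fixes f :: "nat \<Rightarrow> real"
  assumes "\<And>n. 0 \<le> f n" "\<And>\<delta>. 0 < \<delta> \<Longrightarrow> eventually (\<lambda>n. f n \<le> 2 * \<delta>) sequentially"
  shows "f \<longlonglongrightarrow> 0"
proof (rule tendstoI)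
  fix e :: real assume "0 < e"
  then have "eventually (\<lambda>n. f n \<le> 2 * (e / 4)) sequentially" by (intro assms(2)) simp
  then show "eventually (\<lambda>n. dist (f n) 0 < e) sequentially"
    by eventually_elim (use assms(1) \<open>0 < e\<close> in \<open>auto simp: dist_real_def\<close>)
qed

theorem theorem2p1:
  fixes \<mu> :: "real measure" and p :: "nat pmf" and \<alpha>\<^sub>1 \<alpha>\<^sub>2 \<beta> \<gamma> :: real
  assumes "prob_space \<mu>" and "sets \<mu> = sets borel" and "measure \<mu> {0..1} = 1"
    and "\<gamma> > 0" and "\<alpha>\<^sub>1 > 0"
    and "asymp_equiv (\<lambda>x. measure \<mu> {1 - x..1}) (at_right 0) (\<lambda>x. \<alpha>\<^sub>1 * x powr \<gamma>)"
    and "pmf p 0 > 0"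
    and "\<beta> > 1" and "\<alpha>\<^sub>2 > 0"
    and "asymp_equiv (\<lambda>k. pmf p k) at_top (\<lambda>k. \<alpha>\<^sub>2 * real k powr (- \<beta>))"
    and "\<beta> + \<gamma> > 2"
  shows "critical_density \<mu> p < \<infinity> \<and>
    (\<forall>(m :: nat \<Rightarrow> nat) (\<rho> :: real).
      (\<forall>n\<ge>1. m n > 0) \<longrightarrow> (\<lambda>n. real (m n) / real n) \<longlonglongrightarrow> \<rho> \<longrightarrow>
      \<rho> > enn2real (critical_density \<mu> p) \<longrightarrow>
      (\<forall>\<eta>>0.
        (\<lambda>n. measure (annealed_law \<mu> p (m n) n)
           {\<omega> \<in> space (annealed_law \<mu> p (m n) n).
             \<bar>real (order_stat n 1 (snd \<omega>)) - (\<rho> - enn2real (critical_density \<mu> p)) * real n\<bar>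
               > \<eta> * real n}) \<longlonglongrightarrow> 0 \<and>
        (\<lambda>n. measure (annealed_law \<mu> p (m n) n)
           {\<omega> \<in> space (annealed_law \<mu> p (m n) n).
             real (order_stat n 2 (snd \<omega>)) > \<eta> * real n}) \<longlonglongrightarrow> 0))"
proof -
  interpret fitness_law \<mu> \<alpha>\<^sub>1 \<gamma>
    by (intro fitness_law.intro fitness_law_axioms.intro assms)
  obtain C c\<^sub>0 k\<^sub>0 where C: "0 < C" "\<And>k. 1 \<le> k \<Longrightarrow> pmf p k \<le> C * real k powr (- \<beta>)"
    and c0: "0 < c\<^sub>0" "\<And>k. k\<^sub>0 \<le> k \<Longrightarrow> c\<^sub>0 * real k powr (- \<beta>) \<le> pmf p k"
    using pmf_bounds[OF assms(9,10,8)] by metis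
  \<comment> \<open>For finiteness of the critical density any exponent strictly between 0 and
    \<beta> + \<gamma> - 2 will do.\<close>
  define c where "c = (\<beta> + \<gamma> - 2) / 2"
  have c: "0 < c" "c < \<beta> + \<gamma> - 2" using assms(11) by (auto simp: c_def)
  have int: "integrable \<mu> (half_moment p c)"
    using integrable_half_moment[OF C(2) c assms(8)] by blast
  show ?thesis
  proof (intro conjI allI impI)
    show "critical_density \<mu> p < \<infinity>"
      by (rule critical_density_approx(1)[OF int c(1) assms(7)])
    fix m :: "nat \<Rightarrow> nat" and \<rho> \<eta> :: real
    assume m: "(\<lambda>n. real (m n) / real n) \<longlonglongrightarrow> \<rho>" and \<rho>: "\<rho> > enn2real (critical_density \<mu> p)" and \<eta>: "0 < \<eta>"
    note le = eventually_annealed_le[OF assms(7,8,11) C c0 m \<rho> \<eta>]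
    show "(\<lambda>n. measure (annealed_law \<mu> p (m n) n)
           {\<omega> \<in> space (annealed_law \<mu> p (m n) n).
             \<bar>real (order_stat n 1 (snd \<omega>)) - (\<rho> - enn2real (critical_density \<mu> p)) * real n\<bar>
               > \<eta> * real n}) \<longlonglongrightarrow> 0"
      by (rule LIMSEQ_zeroI, rule measure_nonneg, rule le[where B = "\<lambda>n q. \<bar>real (order_stat n 1 q) - (\<rho> - enn2real (critical_density \<mu> p)) * real n\<bar> > \<eta> * real n"]) auto
    show "(\<lambda>n. measure (annealed_law \<mu> p (m n) n)
           {\<omega> \<in> space (annealed_law \<mu> p (m n) n).
             real (order_stat n 2 (snd \<omega>)) > \<eta> * real n}) \<longlonglongrightarrow> 0"
      by (rule LIMSEQ_zeroI, rule measure_nonneg, rule le[where B = "\<lambda>n q. real (order_stat n 2 q) > \<eta> * real n"]) auto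
  qed
qed

end
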